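(* If $\mathscr{A}$ is a strictly supersolvable toric arrangement of rank $r$ in $(\mathbb{C}^\times)^d$, then the topological complexity of the complement is $\mathsf{TC}(M(\mathscr{A}))=d+r+1$.
   Context: Let $\Gamma\cong\mathbb{Z}^d$ be a finitely generated free abelian group and $T=\mathrm{Hom}(\Gamma,\mathbb{C}^\times)\cong(\mathbb{C}^\times)^d$. For $\chi\in\Gamma$ put $H_\chi=\{t\in T\mid t(\chi)=1\}$. A toric arrangement $\mathscr{A}$ in $T$ is the set of all connected components of the $H_\chi$, $\chi\in\mathfrak{X}$, for a finite set $\mathfrak{X}\subseteq\Gamma\smallsetminus\{0\}$; its complement is $M(\mathscr{A})=T\smallsetminus\bigcup_{\chi\in\mathfrak X}H_\chi$; its poset of layers $\mathscr{P}(\mathscr{A})$ consists of the nonempty connected components of intersections $\bigcap_{\chi\in S}H_\chi$, $S\subseteq\mathfrak{X}$, ordered by reverse inclusion. The rank of $\mathscr{A}$ is the rank of this poset, equivalently the rank of the subgroup of $\Gamma$ generated by $\mathfrak{X}$. A subgroup $Y\subseteq T$ is admissible if there is a decomposition $\Gamma=\Gamma'\oplus\Gamma''$ with $\Gamma'$ of rank one and $Y=\{t\mid t|_{\Gamma''}\equiv1\}$. Let $p\colon T\to T/Y\cong\mathrm{Hom}(\Gamma'',\mathbb{C}^\times)$ be the projection, $\mathscr{A}_Y=\{H\in\mathscr{A}\mid H\text{ is a union of cosets of }Y\}$, and $\mathscr{A}/Y=\{p(H)\mid H\in\mathscr{A}_Y\}$, a toric arrangement in $T/Y$. $\mathscr{P}(\mathscr{A}_Y)$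 is a TM-ideal of $\mathscr{P}(\mathscr{A})$ if for any distinct $H_1,H_2\in\mathscr{A}\smallsetminus\mathscr{A}_Y$ and any connected component $X$ of $H_1\cap H_2$ there is $H_3\in\mathscr{A}_Y$ with $H_3\supseteq X$, and $H\cap Y$ is connected for all $H\in\mathscr{A}\smallsetminus\mathscr{A}_Y$. $\mathscr{A}$ is strictly supersolvable if either it has rank $0$, or there is an admissible $Y$ such that $\mathscr{P}(\mathscr{A}_Y)$ is a TM-ideal of $\mathscr{P}(\mathscr{A})$ of rank one less than $\mathscr{P}(\mathscr{A})$, and $\mathscr{A}/Y$ is again strictly supersolvable. For a path-connected space $X$ with the homotopy type of a finite cell complex, let $X^I$ be the space of continuous paths $\gamma\colon[0,1]\to X$ and $\pi\colon X^I\to X\times X$, $\gamma\mapsto(\gamma(0),\gamma(1))$. The topological complexity $\mathsf{TC}(X)$ is the smallest positive integer $k$ such that $X\times X=U_1\cup\dots\cup U_k$ with each $U_i$ open and admitting a continuous section $s_i\colon U_i\to X^I$ of $\pi$, i.e. $\pi\circ s_i=\mathrm{id}_{U_i}$ (so $\mathsf{TC}$ of a point is $1$). *)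

theory Defs
  imports
    "HOL-Analysis.Analysis"
    "HOL-Algebra.Product_Groups"
    "HOL-Algebra.Free_Abelian_Groups"
    "HOL-Library.Extended_Nat"
begin

subsection \<open>Tori\<close>

definition free_abelian_of_rank :: "('a, 'b) monoid_scheme \<Rightarrow> nat \<Rightarrow> bool" where
  "free_abelian_of_rank G n \<longleftrightarrow> comm_group G \<and> G \<cong> free_Abelian_group {..<n}"

definition nonzero_complex :: "complex monoid" where
  "nonzero_complex = \<lparr>carrier = - {0}, monoid.mult = (*), one = 1\<rparr>"

text \<open>
  The lattice of characters is a group \<open>G\<close> in multiplicative notation. Elements of
  the torus are extensional functions, so that each homomorphism is counted once.
\<close>

definition torus :: "('a, 'b) monoid_scheme \<Rightarrow> ('a \<Rightarrow> complex) set" where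
  "torus G = hom G nonzero_complex \<inter> extensional (carrier G)"

definition torus_group :: "('a, 'b) monoid_scheme \<Rightarrow> ('a \<Rightarrow> complex) monoid" where
  "torus_group G = (product_group (carrier G) (\<lambda>_. nonzero_complex)) \<lparr>carrier := torus G\<rparr>"

text \<open>
  The topology of pointwise convergence. For \<open>G\<close> free of rank \<open>d\<close>, evaluation on a
  basis identifies it with the usual topology on the \<open>d\<close>-th power of the punctured plane.
\<close>

definition torus_topology :: "('a, 'b) monoid_scheme \<Rightarrow> ('a \<Rightarrow> complex) topology" where
  "torus_topology G =
     subtopology (product_topology (\<lambda>_. euclidean) (carrier G)) (torus G)"

lemma topspace_torus_topology [simp]: "topspace (torus_topology G) = torus G"
  by (auto simp: torus_topology_def torus_def PiE_def)


subsection \<open>Toric arrangements\<close>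

definition hypertorus :: "('a, 'b) monoid_scheme \<Rightarrow> 'a \<Rightarrow> ('a \<Rightarrow> complex) set" where
  "hypertorus G \<alpha> = {t \<in> torus G. t \<alpha> = 1}"

definition components_in ::
    "('a, 'b) monoid_scheme \<Rightarrow> ('a \<Rightarrow> complex) set \<Rightarrow> ('a \<Rightarrow> complex) set set" where
  "components_in G S = connected_components_of (subtopology (torus_topology G) S)"

definition toric_arrangement ::
    "('a, 'b) monoid_scheme \<Rightarrow> 'a set \<Rightarrow> ('a \<Rightarrow> complex) set set" where
  "toric_arrangement G \<XX> = (\<Union>\<alpha>\<in>\<XX>. components_in G (hypertorus G \<alpha>))"

definition arrangement_complement ::
    "('a, 'b) monoid_scheme \<Rightarrow> 'a set \<Rightarrow> ('a \<Rightarrow> complex) set" where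
  "arrangement_complement G \<XX> = torus G - (\<Union>\<alpha>\<in>\<XX>. hypertorus G \<alpha>)"

text \<open>
  Layers are formed from the members of the arrangement, so that the notion also applies to
  a subarrangement given without a defining set of characters. By
  \<open>layers_toric_arrangement\<close> below they are the components of the intersections
  of the sets \<open>hypertorus G \<alpha>\<close>.
\<close>

definition layers ::
    "('a, 'b) monoid_scheme \<Rightarrow> ('a \<Rightarrow> complex) set set \<Rightarrow> ('a \<Rightarrow> complex) set set" where
  "layers G \<A> = (\<Union>\<S>\<in>Pow \<A>. components_in G (torus G \<inter> \<Inter>\<S>))"

lemma components_inD:
  assumes "C \<in> components_in G S"
  shows "C \<subseteq> S" "C \<subseteq> torus G" "C \<noteq> {}" "connectedin (torus_topology G) C"
proof -
  have C: "C \<in> connected_components_of (subtopology (torus_topology G) S)"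
    using assms by (simp add: components_in_def)
  have "C \<subseteq> torus G \<inter> S"
    using connected_components_of_subset[OF C] by simp
  then show "C \<subseteq> S" "C \<subseteq> torus G"
    by blast+
  show "C \<noteq> {}"
    by (rule nonempty_connected_components_of[OF C])
  show "connectedin (torus_topology G) C"
    using connectedin_connected_components_of[OF C] by (simp add: connectedin_subtopology)
qed

lemma components_in_maximal:
  assumes "C \<in> components_in G S" "connectedin (torus_topology G) D" "D \<subseteq> S" "C \<inter> D \<noteq> {}"
  shows "D \<subseteq> C"
proof (rule connected_components_of_maximal)
  show "C \<in> connected_components_of (subtopology (torus_topology G) S)"
    using assms(1) by (simp add: components_in_def)
  show "connectedin (subtopology (torus_topology G) S) D"
    using assms(2,3) by (simp add: connectedin_subtopology)
  show "\<not> disjnt C D"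
    using assms(4) by (simp add: disjnt_def)
qed

lemma components_in_exists:
  assumes "connectedin (torus_topology G) D" "D \<subseteq> S" "D \<noteq> {}"
  obtains C where "C \<in> components_in G S" "D \<subseteq> C"
proof -
  from assms(3) obtain x where x: "x \<in> D" by blast
  have "D \<subseteq> torus G"
    using connectedin_subset_topspace[OF assms(1)] by simp
  then have "x \<in> topspace (subtopology (torus_topology G) S)"
    using x assms(2) by auto
  then have "x \<in> \<Union> (components_in G S)"
    by (simp only: components_in_def Union_connected_components_of)
  then obtain C where C: "C \<in> components_in G S" "x \<in> C"
    by (rule UnionE)
  have "C \<inter> D \<noteq> {}" using C(2) x by blast
  then have "D \<subseteq> C" by (rule components_in_maximal[OF C(1) assms(1,2)])
  with C(1) show thesis by (rule that)
qed

lemma components_in_sandwich: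
  assumes C: "C \<in> components_in G S" and "C \<subseteq> S'"
    and D: "\<And>D. D \<in> components_in G S' \<Longrightarrow> C \<subseteq> D \<Longrightarrow> D \<subseteq> S"
  shows "C \<in> components_in G S'"
proof -
  obtain D where D': "D \<in> components_in G S'" "C \<subseteq> D"
    by (rule components_in_exists[OF components_inD(4)[OF C] assms(2) components_inD(3)[OF C]])
  have "C \<inter> D \<noteq> {}" using components_inD(3)[OF C] D'(2) by blast
  then have "D \<subseteq> C"
    by (rule components_in_maximal[OF C components_inD(4)[OF D'(1)] D[OF D']])
  with D' show ?thesis by (simp add: subset_antisym)
qed

lemma layers_toric_arrangement:
  "layers G (toric_arrangement G \<XX>) =
     (\<Union>S\<in>Pow \<XX>. components_in G (torus G \<inter> (\<Inter>\<alpha>\<in>S. hypertorus G \<alpha>)))"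
proof (intro equalityI subsetI)
  fix C assume "C \<in> layers G (toric_arrangement G \<XX>)"
  then obtain \<S> where \<S>: "\<S> \<subseteq> toric_arrangement G \<XX>"
    and C: "C \<in> components_in G (torus G \<inter> \<Inter>\<S>)"
    unfolding layers_def by blast
  have "\<forall>H\<in>\<S>. \<exists>\<alpha>. \<alpha> \<in> \<XX> \<and> H \<in> components_in G (hypertorus G \<alpha>)"
    using \<S> unfolding toric_arrangement_def by blast
  from bchoice[OF this] obtain c where
    c: "\<And>H. H \<in> \<S> \<Longrightarrow> c H \<in> \<XX>" "\<And>H. H \<in> \<S> \<Longrightarrow> H \<in> components_in G (hypertorus G (c H))"
    by blast
  have "C \<in> components_in G (torus G \<inter> (\<Inter>\<alpha>\<in>c ` \<S>. hypertorus G \<alpha>))"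
  proof (rule components_in_sandwich[OF C])
    have "H \<subseteq> hypertorus G (c H)" if "H \<in> \<S>" for H
      by (rule components_inD(1)[OF c(2)[OF that]])
    then show "C \<subseteq> torus G \<inter> (\<Inter>\<alpha>\<in>c ` \<S>. hypertorus G \<alpha>)"
      using components_inD(1)[OF C] by blast
    fix D assume D: "D \<in> components_in G (torus G \<inter> (\<Inter>\<alpha>\<in>c ` \<S>. hypertorus G \<alpha>))" "C \<subseteq> D"
    have "D \<subseteq> H" if "H \<in> \<S>" for H
    proof (rule components_in_maximal[OF c(2)[OF that] components_inD(4)[OF D(1)]])
      show "D \<subseteq> hypertorus G (c H)" using components_inD(1)[OF D(1)] that by blast
      show "H \<inter> D \<noteq> {}" using components_inD(1,3)[OF C] D(2) that by blast
    qed
    then show "D \<subseteq> torus G \<inter> \<Inter>\<S>" using components_inD(2)[OF D(1)] by blast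
  qed
  moreover have "c ` \<S> \<in> Pow \<XX>" using c(1) by blast
  ultimately show "C \<in> (\<Union>S\<in>Pow \<XX>. components_in G (torus G \<inter> (\<Inter>\<alpha>\<in>S. hypertorus G \<alpha>)))"
    by (rule UN_I[rotated])
next
  fix C assume "C \<in> (\<Union>S\<in>Pow \<XX>. components_in G (torus G \<inter> (\<Inter>\<alpha>\<in>S. hypertorus G \<alpha>)))"
  then obtain S where S: "S \<subseteq> \<XX>"
    and C: "C \<in> components_in G (torus G \<inter> (\<Inter>\<alpha>\<in>S. hypertorus G \<alpha>))"
    by blast
  have "\<exists>K. K \<in> components_in G (hypertorus G \<alpha>) \<and> C \<subseteq> K" if "\<alpha> \<in> S" for \<alpha>
  proof -
    have "C \<subseteq> hypertorus G \<alpha>" using components_inD(1)[OF C] that by blast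
    then obtain K where "K \<in> components_in G (hypertorus G \<alpha>)" "C \<subseteq> K"
      by (rule components_in_exists[OF components_inD(4)[OF C] _ components_inD(3)[OF C]])
    then show ?thesis by blast
  qed
  then have "\<forall>\<alpha>\<in>S. \<exists>K. K \<in> components_in G (hypertorus G \<alpha>) \<and> C \<subseteq> K" by blast
  from bchoice[OF this] obtain K where
    K: "\<And>\<alpha>. \<alpha> \<in> S \<Longrightarrow> K \<alpha> \<in> components_in G (hypertorus G \<alpha>)" "\<And>\<alpha>. \<alpha> \<in> S \<Longrightarrow> C \<subseteq> K \<alpha>"
    by blast
  have "C \<in> components_in G (torus G \<inter> \<Inter>(K ` S))"
  proof (rule components_in_sandwich[OF C])
    show "C \<subseteq> torus G \<inter> \<Inter>(K ` S)" using K(2) components_inD(2)[OF C] by blast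
    fix D assume D: "D \<in> components_in G (torus G \<inter> \<Inter>(K ` S))"
    have "K \<alpha> \<subseteq> hypertorus G \<alpha>" if "\<alpha> \<in> S" for \<alpha>
      by (rule components_inD(1)[OF K(1)[OF that]])
    then show "D \<subseteq> torus G \<inter> (\<Inter>\<alpha>\<in>S. hypertorus G \<alpha>)"
      using components_inD(1)[OF D] by blast
  qed
  moreover have "K ` S \<in> Pow (toric_arrangement G \<XX>)"
    using K(1) S unfolding toric_arrangement_def by blast
  ultimately show "C \<in> layers G (toric_arrangement G \<XX>)"
    unfolding layers_def by (rule UN_I[rotated])
qed

text \<open>
  The rank is the maximal length of a chain of layers, a chain with \<open>n + 1\<close> elements having
  length \<open>n\<close>. Chains are insensitive to reversing the order by inclusion. The maximum
  exists, since a toric arrangement has finitely many layers.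
\<close>

definition poset_rank :: "'c set set \<Rightarrow> nat" where
  "poset_rank P = Max {card C - 1 | C. finite C \<and> subset.chain P C}"

definition arrangement_rank ::
    "('a, 'b) monoid_scheme \<Rightarrow> ('a \<Rightarrow> complex) set set \<Rightarrow> nat" where
  "arrangement_rank G \<A> = poset_rank (layers G \<A>)"


subsection \<open>Strictly supersolvable arrangements\<close>

definition rank_one_splitting :: "('a, 'b) monoid_scheme \<Rightarrow> 'a set \<Rightarrow> 'a set \<Rightarrow> bool" where
  "rank_one_splitting G \<Gamma>' \<Gamma>'' \<longleftrightarrow>
     subgroup \<Gamma>' G \<and> subgroup \<Gamma>'' G \<and>
     \<Gamma>' <#>\<^bsub>G\<^esub> \<Gamma>'' = carrier G \<and> \<Gamma>' \<inter> \<Gamma>'' = {\<one>\<^bsub>G\<^esub>} \<and>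
     free_abelian_of_rank (G\<lparr>carrier := \<Gamma>'\<rparr>) 1"

definition annihilator :: "('a, 'b) monoid_scheme \<Rightarrow> 'a set \<Rightarrow> ('a \<Rightarrow> complex) set" where
  "annihilator G \<Gamma>'' = {t \<in> torus G. \<forall>\<alpha>\<in>\<Gamma>''. t \<alpha> = 1}"

definition subarrangement ::
    "('a, 'b) monoid_scheme \<Rightarrow> ('a \<Rightarrow> complex) set set \<Rightarrow> ('a \<Rightarrow> complex) set
      \<Rightarrow> ('a \<Rightarrow> complex) set set" where
  "subarrangement G \<A> Y = {H \<in> \<A>. \<exists>\<C>. \<C> \<subseteq> rcosets\<^bsub>torus_group G\<^esub> Y \<and> H = \<Union>\<C>}"

text \<open>
  For \<open>Y = annihilator G \<Gamma>''\<close>, the quotient of the torus by \<open>Y\<close> is identified with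
  the torus of \<open>\<Gamma>''\<close>, and the projection becomes restriction of homomorphisms to \<open>\<Gamma>''\<close>.
\<close>

definition quotient_arrangement ::
    "('a, 'b) monoid_scheme \<Rightarrow> ('a \<Rightarrow> complex) set set \<Rightarrow> 'a set
      \<Rightarrow> ('a \<Rightarrow> complex) set set" where
  "quotient_arrangement G \<A> \<Gamma>'' =
     (\<lambda>H. (\<lambda>t. restrict t \<Gamma>'') ` H) ` subarrangement G \<A> (annihilator G \<Gamma>'')"

definition TM_ideal ::
    "('a, 'b) monoid_scheme \<Rightarrow> ('a \<Rightarrow> complex) set set \<Rightarrow> ('a \<Rightarrow> complex) set \<Rightarrow> bool" where
  "TM_ideal G \<A> Y \<longleftrightarrow>
     (\<forall>H\<^sub>1 \<in> \<A> - subarrangement G \<A> Y. \<forall>H\<^sub>2 \<in> \<A> - subarrangement G \<A> Y. H\<^sub>1 \<noteq> H\<^sub>2 \<longrightarrow>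
        (\<forall>X \<in> components_in G (H\<^sub>1 \<inter> H\<^sub>2). \<exists>H\<^sub>3 \<in> subarrangement G \<A> Y. X \<subseteq> H\<^sub>3)) \<and>
     (\<forall>H \<in> \<A> - subarrangement G \<A> Y. connectedin (torus_topology G) (H \<inter> Y))"

inductive strictly_supersolvable ::
    "('a, 'b) monoid_scheme \<Rightarrow> ('a \<Rightarrow> complex) set set \<Rightarrow> bool" where
  rank_zero: "arrangement_rank G \<A> = 0 \<Longrightarrow> strictly_supersolvable G \<A>"
| step: "\<lbrakk>rank_one_splitting G \<Gamma>' \<Gamma>''; Y = annihilator G \<Gamma>''; TM_ideal G \<A> Y;
          arrangement_rank G (subarrangement G \<A> Y) + 1 = arrangement_rank G \<A>;
          strictly_supersolvable (G\<lparr>carrier := \<Gamma>''\<rparr>) (quotient_arrangement G \<A> \<Gamma>'')\<rbrakk>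
         \<Longrightarrow> strictly_supersolvable G \<A>"


subsection \<open>Topological complexity\<close>

definition paths_in :: "'c topology \<Rightarrow> (real \<Rightarrow> 'c) set" where
  "paths_in X = {\<gamma> \<in> extensional {0..1}. pathin X \<gamma>}"

text \<open>The path space carries the compact-open topology.\<close>

definition path_space :: "'c topology \<Rightarrow> (real \<Rightarrow> 'c) topology" where
  "path_space X = topology_generated_by
     {{\<gamma> \<in> paths_in X. \<gamma> ` K \<subseteq> U} | K U. compact K \<and> K \<subseteq> {0..1} \<and> openin X U}"

lemma topspace_path_space [simp]: "topspace (path_space X) = paths_in X"
proof -
  have "{\<gamma> \<in> paths_in X. \<gamma> ` {} \<subseteq> topspace X} \<in>
      {{\<gamma> \<in> paths_in X. \<gamma> ` K \<subseteq> U} | K U. compact K \<and> K \<subseteq> {0..1} \<and> openin X U}"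
    by blast
  then show ?thesis
    unfolding path_space_def topology_generated_by_topspace by auto
qed

definition motion_planner ::
    "'c topology \<Rightarrow> ('c \<times> 'c) set \<Rightarrow> ('c \<times> 'c \<Rightarrow> real \<Rightarrow> 'c) \<Rightarrow> bool" where
  "motion_planner X U s \<longleftrightarrow>
     continuous_map (subtopology (prod_topology X X) U) (path_space X) s \<and>
     (\<forall>p\<in>U. (s p 0, s p 1) = p)"

text \<open>The infimum is \<open>\<infinity>\<close> if no finite cover with sections exists.\<close>

definition topological_complexity :: "'c topology \<Rightarrow> enat" where
  "topological_complexity X =
     Inf {enat k | k. k > 0 \<and>
       (\<exists>U :: nat \<Rightarrow> ('c \<times> 'c) set.
          (\<Union>i<k. U i) = topspace X \<times> topspace X \<and>
          (\<forall>i<k. openin (prod_topology X X) (U i) \<and> (\<exists>s. motion_planner X (U i) s)))}"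

end

(*
  Adapted coordinates identify the torus with (C - 0)^d in such a way that the characters
  involve only the first r coordinates and span a lattice of rank r there.

  Upper bound: stratify the complement by the real periodic arrangement of the arguments of the
  coordinates. The strata of codimension k = 0, ..., r are, in the first r coordinates, disjoint
  unions of convex pieces, and the quotients z'_j / z_j of the other coordinates are either negative or
  not. This gives a filtration of the square of the complement with d + r + 1 strata, each
  carrying a motion planner, and planners extend from closed sets to neighbourhoods by Tietze's theorem.

  Lower bound: two tori with large and small generic radii, of dimensions d and r, have only
  trivial freely homotopic loops in common. Hence an open set with a motion planner pulls back to
  a subset of the torus of dimension d + r whose loops are trivial, and by Lebesgue's covering theorem
  d + r such sets do not cover the torus.
*)

theory Submission
  imports Defs "HOL-Library.Function_Algebras"
begin

subsection \<open>Motion planners\<close>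

text \<open>The number d + r arises as 2r + (d - r). A coordinate met by the characters can cost one
  codimension at each endpoint. The other d - r coordinates form a group factor, where a route
  depends only on the quotient z'/z and the sole obstruction is the branch cut of the logarithm, at
  a cost of one per coordinate. The lower bound has the same shape: the second torus omits the d - r
  free coordinates, because loops in them are freely homotopic between the two tori and would give
  nontrivial classes in common. Inverting the radii separates the remaining classes: log |chi| is
  linear in the logarithms of the radii, so it changes sign, and the circle traced by chi surrounds
  1 on only one of the tori. Strata are merely locally closed, while planners are required on open
  sets. The level is upper semicontinuous, so each stratum is closed in an open set, which is what
  the extension step needs. Both bounds work with lifts to the universal cover: there the
  arrangement is given by integer values of linear forms, and a winding number is the increment of a
  lift.\<close>

text \<open>The adjoint form of a motion planner: one map of pair and time instead of a map into the
  path space. Compactness of the unit interval makes the two interchangeable, and this form can be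
  pasted and extended by Tietze's theorem.\<close>

definition continuous_planner ::
    "'c topology \<Rightarrow> ('c \<times> 'c) set \<Rightarrow> (('c \<times> 'c) \<times> real \<Rightarrow> 'c) \<Rightarrow> bool" where
  "continuous_planner X U h \<longleftrightarrow>
     continuous_map (prod_topology (subtopology (prod_topology X X) U) (top_of_set {0..1})) X h \<and>
     (\<forall>p\<in>U. h (p, 0) = fst p \<and> h (p, 1) = snd p)"

text \<open>Local compactness of the interval: a path that is in \<open>V\<close> at time
  \<open>t\<close> maps a compact neighbourhood of \<open>t\<close> into \<open>V\<close>, and this
  is an open condition on paths.\<close>

lemma continuous_map_path_evaluation:
  "continuous_map (prod_topology (path_space X) (top_of_set {0..1})) X (\<lambda>(\<gamma>, t). \<gamma> t)"
  unfolding continuous_map_def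
proof (intro conjI allI impI)
  show "(\<lambda>(\<gamma>, t). \<gamma> t) \<in> topspace (prod_topology (path_space X) (top_of_set {0..1})) \<rightarrow> topspace X"
    by (auto simp: paths_in_def pathin_def continuous_map_def)
  fix V assume V: "openin X V"
  let ?W = "{x \<in> topspace (prod_topology (path_space X) (top_of_set {0..1})). (\<lambda>(\<gamma>, t). \<gamma> t) x \<in> V}"
  show "openin (prod_topology (path_space X) (top_of_set {0..1})) ?W"
  proof (subst openin_subopen, safe)
    fix \<gamma> :: "real \<Rightarrow> 'a" and t :: real
    assume *: "(\<gamma>, t) \<in> topspace (prod_topology (path_space X) (top_of_set {0..1}))" "\<gamma> t \<in> V"
    have \<gamma>: "\<gamma> \<in> paths_in X" and t: "t \<in> {0..1}" using * by auto
    have "openin (top_of_set {0..1}) {u \<in> {0..1}. \<gamma> u \<in> V}"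
      using \<gamma> V openin_continuous_map_preimage[of "top_of_set {0..1}" X \<gamma> V]
      by (auto simp: paths_in_def pathin_def)
    then obtain e where e: "e > 0" "\<And>u. u \<in> {0..1} \<Longrightarrow> dist u t < e \<Longrightarrow> \<gamma> u \<in> V"
      using * t unfolding openin_euclidean_subtopology_iff by blast
    define K where "K = cball t (e/2) \<inter> {0..1}"
    have K: "compact K" "K \<subseteq> {0..1}" unfolding K_def by (auto intro: compact_Int)
    have KV: "\<gamma> ` K \<subseteq> V" using e by (force simp: K_def dist_commute)
    define A where "A = {\<gamma> \<in> paths_in X. \<gamma> ` K \<subseteq> V}"
    have A: "openin (path_space X) A"
      unfolding path_space_def A_def using K V by (intro topology_generated_by_Basis) blast
    have B: "openin (top_of_set {0..1}) ({0..1} \<inter> ball t (e/2))" by (simp add: openin_open_Int)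
    show "\<exists>T. openin (prod_topology (path_space X) (top_of_set {0..1})) T \<and> (\<gamma>, t) \<in> T \<and> T \<subseteq> ?W"
    proof (intro exI conjI)
      show "openin (prod_topology (path_space X) (top_of_set {0..1})) (A \<times> ({0..1} \<inter> ball t (e/2)))"
        using A B by (simp add: openin_prod_Times_iff)
      show "(\<gamma>, t) \<in> A \<times> ({0..1} \<inter> ball t (e/2))" using \<gamma> KV t e by (simp add: A_def)
      show "A \<times> ({0..1} \<inter> ball t (e/2)) \<subseteq> ?W" by (fastforce simp: A_def K_def)
    qed
  qed
qed

lemma continuous_planner_of_motion_planner:
  assumes "motion_planner X U s"
  shows "continuous_planner X U (\<lambda>(p, t). s p t)"
  unfolding continuous_planner_def
proof
  let ?S = "prod_topology (subtopology (prod_topology X X) U) (top_of_set {0..1::real})"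
  have "continuous_map ?S (prod_topology (path_space X) (top_of_set {0..1})) (\<lambda>x. (s (fst x), snd x))"
    using assms unfolding motion_planner_def
    by (intro continuous_map_pairedI continuous_map_snd)
       (auto intro: continuous_map_compose[OF continuous_map_fst, unfolded comp_def])
  from continuous_map_compose[OF this continuous_map_path_evaluation]
  show "continuous_map ?S X (\<lambda>(p, t). s p t)" by (simp add: comp_def case_prod_unfold)
  show "\<forall>p\<in>U. (case (p, 0) of (p, t) \<Rightarrow> s p t) = fst p \<and> (case (p, 1) of (p, t) \<Rightarrow> s p t) = snd p"
    using assms unfolding motion_planner_def by (metis case_prod_conv fst_conv snd_conv)
qed

text \<open>A form of the tube lemma: the parameters whose path leaves \<open>V\<close> at some time
  in \<open>K\<close> are the projection of a closed set along the compact interval, hence form a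
  closed set.\<close>

lemma motion_planner_of_continuous_planner:
  assumes "continuous_planner X U h" "U \<subseteq> topspace X \<times> topspace X"
  shows "motion_planner X U (\<lambda>p. \<lambda>t\<in>{0..1}. h (p, t))"
  unfolding motion_planner_def
proof
  let ?U = "subtopology (prod_topology X X) U"
  let ?S = "prod_topology ?U (top_of_set {0..1::real})"
  let ?s = "\<lambda>p. \<lambda>t\<in>{0..1}. h (p, t)"
  have h: "continuous_map ?S X h" using assms by (simp add: continuous_planner_def)
  have U: "topspace ?U = U" using assms(2) by auto
  have paths: "?s p \<in> paths_in X" if "p \<in> U" for p
  proof -
    have "continuous_map (top_of_set {0..1::real}) ?S (\<lambda>t. (p, t))"
      using that U by (intro continuous_map_pairedI) auto
    from continuous_map_compose[OF this h]
    have "continuous_map (top_of_set {0..1}) X (\<lambda>t. h (p, t))" by (simp add: comp_def)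
    then have "continuous_map (top_of_set {0..1}) X (?s p)"
      by (rule continuous_map_eq) auto
    then show ?thesis by (simp add: paths_in_def pathin_def)
  qed
  show "continuous_map ?U (path_space X) ?s"
    unfolding path_space_def continuous_on_generated_topo_iff
  proof (intro conjI allI impI)
    fix A assume "A \<in> {{\<gamma> \<in> paths_in X. \<gamma> ` K \<subseteq> V} | K V. compact K \<and> K \<subseteq> {0..1} \<and> openin X V}"
    then obtain K V where A: "A = {\<gamma> \<in> paths_in X. \<gamma> ` K \<subseteq> V}"
      and K: "compact K" "K \<subseteq> {0..1}" and V: "openin X V" by blast
    define F where "F = fst ` ({x \<in> topspace ?S. h x \<in> topspace X - V} \<inter> U \<times> K)"
    have "closedin ?S {x \<in> topspace ?S. h x \<in> topspace X - V}"
      using h V by (intro closedin_continuous_map_preimage[OF h]) auto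
    moreover have "closedin ?S (U \<times> K)"
    proof -
      have "closedin ?U U" using closedin_topspace[of ?U] U by simp
      then show ?thesis using K by (simp add: closedin_prod_Times_iff closed_subset compact_imp_closed)
    qed
    ultimately have "closedin ?S ({x \<in> topspace ?S. h x \<in> topspace X - V} \<inter> U \<times> K)"
      by (rule closedin_Int)
    moreover have "closed_map ?S ?U fst"
      by (rule closed_map_fst) (simp add: compact_space_subtopology)
    ultimately have F: "closedin ?U F" by (simp add: closed_map_def F_def)
    have *: "?s p \<in> A \<longleftrightarrow> p \<notin> F" if p: "p \<in> U" for p
    proof -
      have S: "(p, t) \<in> topspace ?S" if "t \<in> K" for t using that K(2) p U by auto
      then have "h (p, t) \<in> topspace X" if "t \<in> K" for t
        using continuous_map_image_subset_topspace[OF h] that by blast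
      then have "p \<in> F \<longleftrightarrow> (\<exists>t\<in>K. h (p, t) \<notin> V)"
        using S p unfolding F_def by (force simp del: topspace_prod_topology)
      moreover have "?s p \<in> A \<longleftrightarrow> (\<forall>t\<in>K. h (p, t) \<in> V)"
        unfolding A using paths[OF p] K(2) by (auto simp: image_subset_iff subset_iff)
      ultimately show ?thesis by simp
    qed
    have "?s -` A \<inter> U = U - F"
    proof (rule Set.set_eqI)
      fix p show "p \<in> ?s -` A \<inter> U \<longleftrightarrow> p \<in> U - F" using *[of p] by (cases "p \<in> U") simp_all
    qed
    then have "?s -` A \<inter> topspace ?U = topspace ?U - F" unfolding U .
    with openin_diff[OF openin_topspace F] show "openin ?U (?s -` A \<inter> topspace ?U)" by (simp only:)
  next
    \<comment> \<open>The subbasis must cover the image; \<open>K = {}\<close> makes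
      \<open>paths_in X\<close> itself a member.\<close>
    have "paths_in X \<in> {{\<gamma> \<in> paths_in X. \<gamma> ` K \<subseteq> V} | K V. compact K \<and> K \<subseteq> {0..1} \<and> openin X V}"
      by (intro CollectI exI[of _ "{}"] exI[of _ "topspace X"]) auto
    moreover have "?s ` topspace ?U \<subseteq> paths_in X" unfolding U by (intro image_subsetI paths)
    ultimately show "?s ` topspace ?U \<subseteq>
        \<Union> {{\<gamma> \<in> paths_in X. \<gamma> ` K \<subseteq> V} | K V. compact K \<and> K \<subseteq> {0..1} \<and> openin X V}"
      by (meson Union_upper subset_trans)
  qed
  show "\<forall>p\<in>U. (?s p 0, ?s p 1) = p"
    using assms(1) by (auto simp: continuous_planner_def)
qed

definition planner_cover :: "'c topology \<Rightarrow> nat \<Rightarrow> bool" where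
  "planner_cover X k \<longleftrightarrow> k > 0 \<and>
     (\<exists>U :: nat \<Rightarrow> ('c \<times> 'c) set.
        (\<Union>i<k. U i) = topspace X \<times> topspace X \<and>
        (\<forall>i<k. openin (prod_topology X X) (U i) \<and> (\<exists>h. continuous_planner X (U i) h)))"

lemma topological_complexity_eq_Inf:
  "topological_complexity X = Inf {enat k | k. planner_cover X k}"
proof -
  have *: "(\<exists>s. motion_planner X V s) \<longleftrightarrow> (\<exists>h. continuous_planner X V h)"
    if "openin (prod_topology X X) V" for V
  proof -
    have "V \<subseteq> topspace X \<times> topspace X" using openin_subset[OF that] by simp
    then show ?thesis
      by (intro iffI; elim exE)
         (rule exI, erule continuous_planner_of_motion_planner motion_planner_of_continuous_planner,
          assumption?)+
  qed
  have **: "(\<forall>i<k. openin (prod_topology X X) (U i) \<and> (\<exists>s. motion_planner X (U i) s)) \<longleftrightarrow>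
      (\<forall>i<k. openin (prod_topology X X) (U i) \<and> (\<exists>h. continuous_planner X (U i) h))" for k :: nat and U
    by (rule all_cong1, rule imp_cong, rule refl, rule conj_cong, rule refl, erule *)
  show ?thesis
    unfolding topological_complexity_def planner_cover_def by (simp only: **)
qed

lemma topological_complexity_eqI:
  assumes "planner_cover X k" "\<And>j. planner_cover X j \<Longrightarrow> k \<le> j"
  shows "topological_complexity X = enat k"
  unfolding topological_complexity_eq_Inf
  by (intro antisym Inf_lower Inf_greatest) (use assms in auto)

text \<open>Conjugation: transport the endpoints by \<open>g\<close>, plan in \<open>X\<close>,
  transport the route back by \<open>f\<close>.\<close>

lemma planner_cover_homeomorphic:
  assumes "X homeomorphic_space Y" "planner_cover X k"
  shows "planner_cover Y k"
proof -
  obtain f g where fg: "homeomorphic_maps X Y f g"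
    using assms(1) by (auto simp: homeomorphic_space_def)
  then have f: "continuous_map X Y f" and g: "continuous_map Y X g"
    and gf: "\<And>x. x \<in> topspace X \<Longrightarrow> g (f x) = x" and fg': "\<And>y. y \<in> topspace Y \<Longrightarrow> f (g y) = y"
    by (auto simp: homeomorphic_maps_def)
  obtain U where k: "k > 0" and U: "(\<Union>i<k. U i) = topspace X \<times> topspace X"
    and U': "\<And>i. i < k \<Longrightarrow> openin (prod_topology X X) (U i)"
            "\<And>i. i < k \<Longrightarrow> \<exists>h. continuous_planner X (U i) h"
  proof -
    from assms(2) have "k > 0" and "\<exists>U. (\<Union>i<k. U i) = topspace X \<times> topspace X \<and>
        (\<forall>i<k. openin (prod_topology X X) (U i) \<and> (\<exists>h. continuous_planner X (U i) h))"
      by (simp_all add: planner_cover_def)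
    then show thesis using that by (elim exE conjE) simp
  qed
  define G where "G = map_prod g g"
  have G: "continuous_map (prod_topology Y Y) (prod_topology X X) G"
    unfolding G_def map_prod_def case_prod_unfold using g
    by (intro continuous_map_pairedI)
       (auto intro: continuous_map_compose[OF continuous_map_fst, unfolded comp_def]
                    continuous_map_compose[OF continuous_map_snd, unfolded comp_def])
  define V where "V i = {p \<in> topspace (prod_topology Y Y). G p \<in> U i}" for i
  have gY: "g y \<in> topspace X" if "y \<in> topspace Y" for y
    using g that by (auto simp: continuous_map_def)
  show ?thesis unfolding planner_cover_def
  proof (intro conjI exI[of _ V] allI impI)
    show "k > 0" by fact
    have "\<exists>i<k. G p \<in> U i" if "p \<in> topspace Y \<times> topspace Y" for p
    proof -
      have "G p \<in> topspace X \<times> topspace X" using that gY by (auto simp: G_def)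
      then show ?thesis unfolding U[symmetric] by blast
    qed
    then show "(\<Union>i<k. V i) = topspace Y \<times> topspace Y" by (auto simp: V_def)
    fix i assume i: "i < k"
    show "openin (prod_topology Y Y) (V i)"
      unfolding V_def by (rule openin_continuous_map_preimage[OF G U'(1)[OF i]])
    obtain h where h: "continuous_planner X (U i) h" using U'(2)[OF i] by blast
    have G': "continuous_map (subtopology (prod_topology Y Y) (V i)) (subtopology (prod_topology X X) (U i)) G"
      using G by (auto simp: continuous_map_in_subtopology V_def intro: continuous_map_from_subtopology)
    have "continuous_map (prod_topology (subtopology (prod_topology Y Y) (V i)) (top_of_set {0..1::real}))
        (prod_topology (subtopology (prod_topology X X) (U i)) (top_of_set {0..1})) (\<lambda>x. (G (fst x), snd x))"
      using continuous_map_compose[OF continuous_map_fst G', unfolded comp_def]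
      by (intro continuous_map_pairedI continuous_map_snd)
    moreover have "continuous_map (prod_topology (subtopology (prod_topology X X) (U i)) (top_of_set {0..1})) X h"
      using h by (simp add: continuous_planner_def)
    ultimately have "continuous_map (prod_topology (subtopology (prod_topology Y Y) (V i)) (top_of_set {0..1}))
        Y (f \<circ> (h \<circ> (\<lambda>x. (G (fst x), snd x))))"
      using f by (intro continuous_map_compose)
    moreover have "(f \<circ> (h \<circ> (\<lambda>x. (G (fst x), snd x)))) (p, 0) = fst p"
      "(f \<circ> (h \<circ> (\<lambda>x. (G (fst x), snd x)))) (p, 1) = snd p" if "p \<in> V i" for p
      using h that by (auto simp: V_def continuous_planner_def G_def fg')
    ultimately show "\<exists>h. continuous_planner Y (V i) h"
      unfolding continuous_planner_def by blast
  qed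
qed

lemma topological_complexity_homeomorphic:
  assumes "X homeomorphic_space Y"
  shows "topological_complexity X = topological_complexity Y"
proof -
  have "planner_cover X k \<longleftrightarrow> planner_cover Y k" for k
    using planner_cover_homeomorphic[OF assms] planner_cover_homeomorphic[OF iffD1[OF homeomorphic_space_sym assms]]
    by blast
  then show ?thesis unfolding topological_complexity_eq_Inf by simp
qed

section \<open>Extension from closed sets, and covers from level sets\<close>

lemma continuous_planner_top_of_set:
  assumes "V \<subseteq> M \<times> M"
  shows "continuous_planner (top_of_set M) V h \<longleftrightarrow>
     continuous_on (V \<times> {0..1}) h \<and> h ` (V \<times> {0..1}) \<subseteq> M \<and>
     (\<forall>p\<in>V. h (p, 0) = fst p \<and> h (p, 1) = snd p)"
proof -
  have "subtopology (prod_topology (top_of_set M) (top_of_set M)) V = top_of_set V"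
    using assms by (simp add: prod_topology_subtopology_eu subtopology_subtopology Int_absorb1)
  then show ?thesis
    unfolding continuous_planner_def by (simp add: prod_topology_subtopology_eu image_subset_iff_funcset)
qed

text \<open>
  The partial map given by \<open>H\<close> on \<open>S\<close> and by the two endpoints on \<open>U\<close> extends by Tietze's
  theorem, one coordinate at a time; the extension stays in the relatively open set \<open>M\<close>
  over a neighbourhood of \<open>S\<close>.
\<close>

lemma continuous_planner_neighbourhood:
  fixes M :: "(nat \<Rightarrow> complex) set"
  assumes M: "openin (top_of_set {z. \<forall>j\<ge>d. z j = 1}) M"
    and U: "U \<subseteq> M \<times> M" and S: "closedin (top_of_set U) S"
    and H: "continuous_planner (top_of_set M) S H"
  obtains V h where "openin (top_of_set U) V" "S \<subseteq> V" "continuous_planner (top_of_set M) V h"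
proof -
  let ?I = "{0..1::real}"
  have SU: "S \<subseteq> U" using S by (auto dest: closedin_imp_subset)
  have H': "continuous_on (S \<times> ?I) H" "H ` (S \<times> ?I) \<subseteq> M"
    "\<And>p. p \<in> S \<Longrightarrow> H (p, 0) = fst p" "\<And>p. p \<in> S \<Longrightarrow> H (p, 1) = snd p"
    using H SU U by (auto simp: continuous_planner_top_of_set)
  have A: "M \<subseteq> {z. \<forall>j\<ge>d. z j = 1}" using M by (rule openin_imp_subset)
  define C where "C = S \<times> ?I \<union> U \<times> {0, 1}"
  have CU: "C \<subseteq> U \<times> ?I" using SU by (auto simp: C_def)
  have cl1: "closedin (top_of_set (U \<times> ?I)) (S \<times> ?I)" and cl2: "closedin (top_of_set (U \<times> ?I)) (U \<times> {0, 1})"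
    by (intro closedin_Times S closedin_subtopology_refl[THEN iffD2]; simp add: closed_subset)+
  then have C: "closedin (top_of_set (U \<times> ?I)) C" unfolding C_def by (rule closedin_Un)
  \<comment> \<open>At times 0 and 1 this is the starting point and the end point; the straight line
    between them only provides one continuous formula, and on \<open>C\<close> it is used at these
    two times only.\<close>
  define e where "e j x = of_real (1 - snd x) * fst (fst x) j + of_real (snd x) * snd (fst x) j"
    for j and x :: "((nat \<Rightarrow> complex) \<times> (nat \<Rightarrow> complex)) \<times> real"
  have app: "continuous_on X (\<lambda>x. f x j)" if "continuous_on X f"
    for X and f :: "((nat \<Rightarrow> complex) \<times> (nat \<Rightarrow> complex)) \<times> real \<Rightarrow> nat \<Rightarrow> complex" and j
    using continuous_on_product_then_coordinatewise[OF that] .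
  have e: "continuous_on X (e j)" for X j
    unfolding e_def by (intro continuous_intros app)
  have "\<exists>g. continuous_on (U \<times> ?I) g \<and> (\<forall>x\<in>C. g x = (if fst x \<in> S then H x j else e j x))" for j
  proof -
    have "continuous_on C (\<lambda>x. if fst x \<in> S then H x j else e j x)"
      unfolding C_def
    proof (rule continuous_on_cases_local)
      show "closedin (top_of_set (S \<times> ?I \<union> U \<times> {0, 1})) (S \<times> ?I)"
        "closedin (top_of_set (S \<times> ?I \<union> U \<times> {0, 1})) (U \<times> {0, 1})"
        using cl1 cl2 CU by (auto simp: C_def elim!: closedin_subset_trans)
      show "continuous_on (S \<times> ?I) (\<lambda>x. H x j)" by (rule app[OF H'(1)])
      show "continuous_on (U \<times> {0, 1}) (e j)" by (rule e)
      show "H x j = e j x" if "x \<in> S \<times> ?I \<and> fst x \<notin> S \<or> x \<in> U \<times> {0, 1} \<and> fst x \<in> S" for x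
        using that H'(3,4) by (auto simp: e_def)
    qed
    from Tietze_unbounded[OF this C] show ?thesis by metis
  qed
  then obtain g where g: "\<And>j. continuous_on (U \<times> ?I) (g j)"
      "\<And>j x. x \<in> C \<Longrightarrow> g j x = (if fst x \<in> S then H x j else e j x)"
    by metis
  \<comment> \<open>The constant 1 from coordinate \<open>d\<close> on keeps the extension in the
    space in which \<open>M\<close> is relatively open.\<close>
  define F where "F x = (\<lambda>j. if j < d then g j x else 1)" for x
  have F: "continuous_on (U \<times> ?I) F"
  proof (rule continuous_on_coordinatewise_then_product)
    fix j show "continuous_on (U \<times> ?I) (\<lambda>x. F x j)"
      using g(1)[of j] by (cases "j < d") (simp_all add: F_def)
  qed
  define W where "W = (U \<times> ?I) \<inter> F -` M"
  have W: "openin (top_of_set (U \<times> ?I)) W"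
    unfolding W_def by (rule continuous_openin_preimage[OF F _ M]) (auto simp: F_def)
  have FS: "F x = H x" if "x \<in> S \<times> ?I" for x
  proof
    fix j show "F x j = H x j"
      using that H'(2) A g(2)[of x j] by (force simp: F_def C_def)
  qed
  have F01: "F (p, 0) = fst p" "F (p, 1) = snd p" if "p \<in> U" for p
  proof -
    have "fst p j = 1" "snd p j = 1" if "j \<ge> d" for j using \<open>p \<in> U\<close> U A that by force+
    then show "F (p, 0) = fst p" "F (p, 1) = snd p"
      using that H'(3,4) g(2)[of "(p, 0)"] g(2)[of "(p, 1)"]
      by (auto simp: F_def C_def e_def fun_eq_iff)
  qed
  \<comment> \<open>A pair is discarded if its extended route leaves \<open>M\<close> at any time;
    compactness of the interval makes the discarded set closed.\<close>
  define V where "V = U - fst ` (U \<times> ?I - W)"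
  have "closed_map (top_of_set (U \<times> ?I)) (top_of_set U) fst"
    unfolding prod_topology_subtopology_eu[symmetric]
    by (rule closed_map_fst) (simp add: compact_space_subtopology)
  then have "closedin (top_of_set U) (fst ` (U \<times> ?I - W))"
    using W by (simp add: closed_map_def openin_closedin_eq)
  then have "openin (top_of_set U) V"
    unfolding V_def by (simp add: openin_diff)
  moreover have "S \<subseteq> V"
    using SU FS H'(2) by (auto simp: V_def W_def image_subset_iff)
  moreover have "continuous_planner (top_of_set M) V F"
  proof -
    have VU: "V \<subseteq> U" by (auto simp: V_def)
    have "F ` (V \<times> ?I) \<subseteq> M" by (force simp: V_def W_def)
    then show ?thesis
      using VU U F01 continuous_on_subset[OF F, of "V \<times> ?I"]
      by (subst continuous_planner_top_of_set) auto
  qed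
  ultimately show thesis using that by blast
qed

text \<open>The part of level \<open>k\<close> is closed in the open set of level at most
  \<open>k\<close>, so its planner extends to an open neighbourhood. Levels \<open>0\<close> to
  \<open>K\<close> yield \<open>K + 1\<close> open sets.\<close>

lemma planner_cover_of_level_sets:
  fixes M :: "(nat \<Rightarrow> complex) set" and N :: "(nat \<Rightarrow> complex) \<times> (nat \<Rightarrow> complex) \<Rightarrow> nat"
  assumes M: "openin (top_of_set {z. \<forall>j\<ge>d. z j = 1}) M"
    and N: "\<And>p. p \<in> M \<times> M \<Longrightarrow> N p \<le> K"
    and op: "\<And>k. openin (top_of_set (M \<times> M)) {p \<in> M \<times> M. N p \<le> k}"
    and H: "\<And>k. k \<le> K \<Longrightarrow> \<exists>H. continuous_planner (top_of_set M) {p \<in> M \<times> M. N p = k} H"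
  shows "planner_cover (top_of_set M) (K + 1)"
proof -
  have MM: "prod_topology (top_of_set M) (top_of_set M) = top_of_set (M \<times> M)"
    by (simp add: prod_topology_subtopology_eu)
  have "\<exists>V. openin (top_of_set (M \<times> M)) V \<and> {p \<in> M \<times> M. N p = k} \<subseteq> V \<and>
      (\<exists>h. continuous_planner (top_of_set M) V h)" if k: "k \<le> K" for k
  proof -
    define U where "U = {p \<in> M \<times> M. N p \<le> k}"
    have U: "openin (top_of_set (M \<times> M)) U" unfolding U_def by (rule op)
    have "openin (top_of_set (M \<times> M)) {p \<in> M \<times> M. N p < k}"
    proof (cases k)
      case (Suc l)
      then show ?thesis using op[of l] by (simp add: less_Suc_eq_le)
    qed simp
    then have "openin (top_of_set U) {p \<in> M \<times> M. N p < k}"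
      by (rule openin_subset_trans) (auto simp: U_def)
    moreover have "{p \<in> M \<times> M. N p = k} = U - {p \<in> M \<times> M. N p < k}" by (auto simp: U_def)
    ultimately have S: "closedin (top_of_set U) {p \<in> M \<times> M. N p = k}"
      by (simp add: closedin_diff)
    obtain H where H': "continuous_planner (top_of_set M) {p \<in> M \<times> M. N p = k} H" using H[OF k] ..
    have "U \<subseteq> M \<times> M" by (auto simp: U_def)
    from continuous_planner_neighbourhood[OF M this S H']
    obtain V h where V: "openin (top_of_set U) V" "{p \<in> M \<times> M. N p = k} \<subseteq> V"
        "continuous_planner (top_of_set M) V h"
      .
    then show ?thesis using openin_trans[OF V(1) U] by blast
  qed
  then have "\<forall>k\<in>{..K}. \<exists>V. openin (top_of_set (M \<times> M)) V \<and> {p \<in> M \<times> M. N p = k} \<subseteq> V \<and>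
      (\<exists>h. continuous_planner (top_of_set M) V h)" by simp
  from bchoice[OF this] obtain V where "\<forall>k\<in>{..K}. openin (top_of_set (M \<times> M)) (V k) \<and>
      {p \<in> M \<times> M. N p = k} \<subseteq> V k \<and> (\<exists>h. continuous_planner (top_of_set M) (V k) h)" ..
  then have V: "\<And>k. k \<le> K \<Longrightarrow> openin (top_of_set (M \<times> M)) (V k)"
      "\<And>k. k \<le> K \<Longrightarrow> {p \<in> M \<times> M. N p = k} \<subseteq> V k"
      "\<And>k. k \<le> K \<Longrightarrow> \<exists>h. continuous_planner (top_of_set M) (V k) h"
    by simp_all
  show ?thesis
    unfolding planner_cover_def MM
  proof (intro conjI exI[of _ V] allI impI)
    have "p \<in> (\<Union>i<K + 1. V i)" if "p \<in> M \<times> M" for p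
    proof -
      have "p \<in> V (N p)" using that N V(2)[of "N p"] by blast
      then show ?thesis using N[OF that] by (auto simp: less_Suc_eq_le)
    qed
    moreover have "V i \<subseteq> M \<times> M" if "i < K + 1" for i
      using openin_imp_subset[OF V(1)[of i]] that by simp
    ultimately show "(\<Union>i<K + 1. V i) = topspace (top_of_set M) \<times> topspace (top_of_set M)"
      unfolding topspace_euclidean_subtopology by (intro subset_antisym UN_least subsetI; blast)
  qed (use V in auto)
qed

subsection \<open>Periodic covers of Euclidean space\<close>

lemma tendsto_fun_iff:
  fixes l :: "'i \<Rightarrow> 'b::topological_space"
  shows "(f \<longlongrightarrow> l) F \<longleftrightarrow> (\<forall>i. ((\<lambda>x. f x i) \<longlongrightarrow> l i) F)"
  unfolding limitin_canonical_iff[symmetric] euclidean_product_topology[symmetric]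
  by (simp add: limitin_componentwise)

text \<open>A Lebesgue number for the cover of the torus obtained by dividing out integer
  translations. If no mesh worked, the fractional parts of the offending grid points would
  accumulate in the compact cube, and translated points outside \<open>W i\<close> would converge to
  a point of \<open>W i\<close>. The radius \<open>2 / m\<close> leaves room for segments between
  grid points two steps apart.\<close>

lemma uniform_grid_of_periodic_cover:
  fixes W :: "nat \<Rightarrow> (nat \<Rightarrow> real) set" and n k :: nat
  assumes op: "\<And>i. i < k \<Longrightarrow> open (W i)"
    and cover: "\<And>x. \<exists>i<k. x \<in> W i"
    and periodic: "\<And>i x y. i < k \<Longrightarrow> (\<And>j. j < n \<Longrightarrow> y j - x j \<in> \<int>) \<Longrightarrow> x \<in> W i \<Longrightarrow> y \<in> W i"
  shows "\<exists>m::nat. m > (0::nat) \<and>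
    (\<forall>v :: nat \<Rightarrow> nat. \<exists>i<k. \<forall>y. (\<forall>j<n. \<bar>y j - v j / m\<bar> \<le> 2 / m) \<longrightarrow> y \<in> W i)"
proof (rule ccontr)
  assume "\<not> ?thesis"
  then have neg: "\<forall>m::nat. m = 0 \<or> (\<exists>v :: nat \<Rightarrow> nat. \<forall>i<k. \<exists>y. (\<forall>j<n. \<bar>y j - v j / m\<bar> \<le> 2 / m) \<and> y \<notin> W i)"
    by simp
  have "\<forall>m::nat. \<exists>v :: nat \<Rightarrow> nat. \<forall>i<k. \<exists>y. (\<forall>j<n. \<bar>y j - v j / Suc m\<bar> \<le> 2 / Suc m) \<and> y \<notin> W i"
  proof
    fix m show "\<exists>v :: nat \<Rightarrow> nat. \<forall>i<k. \<exists>y. (\<forall>j<n. \<bar>y j - v j / Suc m\<bar> \<le> 2 / Suc m) \<and> y \<notin> W i"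
      using neg[rule_format, of "Suc m"] by simp
  qed
  from choice[OF this] obtain v :: "nat \<Rightarrow> nat \<Rightarrow> nat" where
    v: "\<And>m i. i < k \<Longrightarrow> \<exists>y. (\<forall>j<n. \<bar>y j - v m j / Suc m\<bar> \<le> 2 / Suc m) \<and> y \<notin> W i" by blast
  \<comment> \<open>Coordinates from \<open>n\<close> on can be set to 0, since the hypothesis
    \<open>periodic\<close> puts no condition on them.\<close>
  define x where "x m = (\<lambda>j. if j < n then frac (v m j / Suc m) else 0)" for m
  define Q :: "(nat \<Rightarrow> real) set" where "Q = PiE UNIV (\<lambda>j. {0..1})"
  have "compactin (product_topology (\<lambda>_::nat. euclideanreal) UNIV) Q"
    unfolding Q_def by (simp add: compactin_PiE)
  then have "seq_compact Q"
    by (metis compactin_euclidean_iff compact_imp_seq_compact euclidean_product_topology)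
  moreover have "x m \<in> Q" for m
    by (auto simp: Q_def x_def frac_lt_1 less_imp_le)
  ultimately obtain l s where s: "strict_mono s" "(x \<circ> s) \<longlonglongrightarrow> l"
    unfolding seq_compact_def by metis
  obtain i where i: "i < k" "l \<in> W i" using cover by blast
  from v[OF i(1)] have "\<forall>m. \<exists>y. (\<forall>j<n. \<bar>y j - v m j / Suc m\<bar> \<le> 2 / Suc m) \<and> y \<notin> W i" by blast
  from choice[OF this] obtain y where y: "\<And>m j. j < n \<Longrightarrow> \<bar>y m j - v m j / Suc m\<bar> \<le> 2 / Suc m"
    "\<And>m. y m \<notin> W i" by blast
  \<comment> \<open>Subtracting the integer part of the grid point, not that of \<open>y\<close>
    itself, keeps \<open>y' m\<close> within \<open>2 / Suc m\<close> of the fractional part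
    \<open>x m\<close>.\<close>
  define y' where "y' m = (\<lambda>j. if j < n then y m j - \<lfloor>v m j / Suc m\<rfloor> else 0)" for m
  have "y' m \<notin> W i" for m
    using periodic[OF i(1), of "y m" "y' m"] y(2) by (auto simp: y'_def)
  moreover have "(y' \<circ> s) \<longlonglongrightarrow> l"
  unfolding tendsto_fun_iff
  proof
    fix j
    have xl: "(\<lambda>m. x (s m) j) \<longlonglongrightarrow> l j"
      using s(2) unfolding comp_def tendsto_fun_iff by blast
    have "(\<lambda>m. 2 / real (Suc m)) \<longlonglongrightarrow> 0" 
      by (rule LIMSEQ_Suc[OF lim_const_over_n])
    then have lim: "(\<lambda>m. 2 / real (Suc (s m))) \<longlonglongrightarrow> 0"
      using s(1) LIMSEQ_subseq_LIMSEQ unfolding comp_def by blast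
    have "\<bar>y' (s m) j - x (s m) j\<bar> \<le> 2 / real (Suc (s m))" for m
      using y(1)[of j "s m"] by (auto simp: y'_def x_def frac_def)
    then have "(\<lambda>m. y' (s m) j - x (s m) j) \<longlonglongrightarrow> 0"
      by (intro Lim_null_comparison[OF _ lim]) simp
    from tendsto_add[OF xl this] show "(\<lambda>m. (y' \<circ> s) m j) \<longlonglongrightarrow> l j" by simp
  qed
  ultimately have "l \<notin> W i"
    using op[OF i(1)] closed_sequentially[of "- W i" "y' \<circ> s" l] by auto
  with i show False by simp
qed

text \<open>
  Lebesgue covering: if at most \<open>n\<close> sets cover, colour a fine grid accordingly. Chains of
  grid points of one colour are bounded, since two points of a chain are never congruent.
  For each colour \<open>i\<close>, the label of a point tells whether it is close to a chain of colour
  \<open>i\<close> that starts at the face \<open>x\<^sub>i = 0\<close>; in the cell provided by Kuhn's lemma the label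
  of the colour of a corner would change, although all its points are close to that corner.
\<close>

lemma periodic_cover_wraps:
  fixes W :: "nat \<Rightarrow> (nat \<Rightarrow> real) set" and n k :: nat
  assumes kn: "k \<le> n" and op: "\<And>i. i < k \<Longrightarrow> open (W i)"
    and cover: "\<And>x. \<exists>i<k. x \<in> W i"
    and periodic: "\<And>i x y. i < k \<Longrightarrow> (\<And>j. j < n \<Longrightarrow> y j - x j \<in> \<int>) \<Longrightarrow> x \<in> W i \<Longrightarrow> y \<in> W i"
  obtains i g where "i < k" "path g" "path_image g \<subseteq> W i"
    "\<And>j. j < n \<Longrightarrow> g 1 j - g 0 j \<in> \<int>" "\<exists>j<n. g 1 j \<noteq> g 0 j"
proof (rule ccontr)
  note wraps = that
  assume contra: "\<not> thesis"
  have "\<exists>m::nat. m > (0::nat) \<and>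
      (\<forall>v :: nat \<Rightarrow> nat. \<exists>i<k. \<forall>y. (\<forall>j<n. \<bar>y j - v j / m\<bar> \<le> 2 / m) \<longrightarrow> y \<in> W i)"
    by (rule uniform_grid_of_periodic_cover) (fact op cover periodic)+
  then obtain m :: nat where m: "m > 0" and
    grid: "\<forall>v :: nat \<Rightarrow> nat. \<exists>i<k. \<forall>y. (\<forall>j<n. \<bar>y j - v j / m\<bar> \<le> 2 / m) \<longrightarrow> y \<in> W i"
    by (elim exE conjE) (rule that)
  from choice[OF grid] obtain c where
    c': "\<forall>v::nat \<Rightarrow> nat. c v < k \<and> (\<forall>y. (\<forall>j<n. \<bar>y j - v j / m\<bar> \<le> 2 / m) \<longrightarrow> y \<in> W (c v))" ..
  have c: "c v < k" "(\<And>j. j < n \<Longrightarrow> \<bar>y j - v j / m\<bar> \<le> 2 / m) \<Longrightarrow> y \<in> W (c v)" for v :: "nat \<Rightarrow> nat" and y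
    using c' by simp_all
  define pt :: "(nat \<Rightarrow> nat) \<Rightarrow> nat \<Rightarrow> real" where "pt v = (\<lambda>j. v j / m)" for v
  \<comment> \<open>Two steps, since a link will have to join the base corner \<open>q\<close> of a
    cell to a chain point that is one step away from another corner of that cell.\<close>
  define R where "R i = {(v, v'). c v = i \<and> c v' = i \<and> (\<forall>j<n. \<bar>int (v j) - int (v' j)\<bar> \<le> 2)}" for i
  have symR: "sym (R i)" for i by (auto simp: sym_def R_def abs_minus_commute)
  have step: "path_component (W i) (pt v) (pt v')" if "(v, v') \<in> R i" for v v' i
    unfolding path_component_def
  proof (intro exI conjI)
    let ?g = "\<lambda>t j. pt v j + t * (pt v' j - pt v j)"
    show "path ?g" unfolding path_def
      by (rule continuous_on_coordinatewise_then_product) (intro continuous_intros)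
    show "pathstart ?g = pt v" "pathfinish ?g = pt v'" by (auto simp: pathstart_def pathfinish_def)
    show "path_image ?g \<subseteq> W i" unfolding path_image_def
    proof (rule image_subsetI)
      fix t :: real assume t: "t \<in> {0..1}"
      have cv: "c v = i" using that by (simp add: R_def)
      have "?g t \<in> W (c v)"
      proof (rule c(2))
        fix j assume "j < n"
        then have "\<bar>int (v j) - int (v' j)\<bar> \<le> 2" using that by (simp add: R_def)
        then have "\<bar>real (v' j) - real (v j)\<bar> \<le> 2" by linarith
        then have "\<bar>pt v' j - pt v j\<bar> \<le> 2 / m"
          using m by (simp add: pt_def diff_divide_distrib[symmetric] divide_right_mono)
        moreover have "\<bar>t * (pt v' j - pt v j)\<bar> \<le> 1 * \<bar>pt v' j - pt v j\<bar>"
          unfolding abs_mult using t by (intro mult_right_mono) auto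
        ultimately show "\<bar>?g t j - v j / m\<bar> \<le> 2 / m" by (simp add: pt_def)
      qed
      then show "?g t \<in> W i" by (simp add: cv)
    qed
  qed
  have chain: "v = v' \<or> path_component (W i) (pt v) (pt v')" if "(v, v') \<in> (R i)\<^sup>*" for v v' i
    using that by induction (use step path_component_trans in blast)+
  \<comment> \<open>A chain between congruent points that differ would give a path in
    \<open>W i\<close> whose ends differ by a nonzero integer vector, which \<open>contra\<close>
    excludes.\<close>
  have incong: "v j = v' j"
    if rel: "(v, v') \<in> (R i)\<^sup>*" and res: "\<And>j. j < n \<Longrightarrow> v j mod m = v' j mod m"
      and "i < k" "j < n" for v v' i j
  proof (rule ccontr)
    assume neq: "v j \<noteq> v' j"
    then obtain g where g: "path g" "path_image g \<subseteq> W i" "pathstart g = pt v" "pathfinish g = pt v'"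
      using chain[OF rel] unfolding path_component_def by fast
    have g': "g 0 = pt v" "g 1 = pt v'" using g by (auto simp: pathstart_def pathfinish_def)
    have "g 1 j' - g 0 j' \<in> \<int>" if "j' < n" for j'
    proof -
      have "int m dvd int (v' j') - int (v j')"
        using res[OF that]
        by (metis mod_eq_dvd_iff zmod_int)
      then obtain q where "int (v' j') - int (v j') = int m * q" by (elim dvdE)
      then have "real (v' j') - real (v j') = real m * of_int q"
        by (metis of_int_diff of_int_mult of_int_of_nat_eq)
      then have "g 1 j' - g 0 j' = of_int q"
        using m by (simp add: g' pt_def diff_divide_distrib[symmetric])
      then show ?thesis by simp
    qed
    moreover have "g 1 j \<noteq> g 0 j" using neq m by (simp add: g' pt_def)
    ultimately show False using contra wraps[of i g] g \<open>i < k\<close> \<open>j < n\<close> by blast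
  qed
  define N where "N = m ^ n"
  \<comment> \<open>By \<open>incong\<close> the residues modulo \<open>m\<close> determine the
    \<open>i\<close>-th entry along a chain, so at most \<open>N\<close> values occur. One of the
    \<open>N + 1\<close> disjoint pairs \<open>2 * w\<close>, \<open>2 * w + 1\<close> is therefore
    missed altogether, and steps of size at most 2 cannot jump over it.\<close>
  have bound: "v i < 2 * N + 2" if u: "u i \<le> 1" and uv: "(u, v) \<in> (R i)\<^sup>*" and i: "i < k" for u v i
  proof -
    define V where "V = (\<lambda>v. v i) ` {v. (u, v) \<in> (R i)\<^sup>*}"
    define res where "res v = (\<lambda>j\<in>{..<n}. v j mod m)" for v :: "nat \<Rightarrow> nat"
    define f where "f r = (SOME v. (u, v) \<in> (R i)\<^sup>* \<and> res v = r) i" for r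
    have "V \<subseteq> f ` (PiE {..<n} (\<lambda>_. {..<m}))"
    proof
      fix t assume "t \<in> V"
      then obtain v where v: "(u, v) \<in> (R i)\<^sup>*" "t = v i" by (auto simp: V_def)
      define v' where "v' = (SOME v'. (u, v') \<in> (R i)\<^sup>* \<and> res v' = res v)"
      have v': "(u, v') \<in> (R i)\<^sup>*" "res v' = res v"
        unfolding v'_def using someI[of "\<lambda>v'. (u, v') \<in> (R i)\<^sup>* \<and> res v' = res v", OF conjI[OF v(1) refl]]
        by auto
      have "(v, u) \<in> (R i)\<^sup>*" using v(1) symR sym_rtrancl symD by metis
      then have "(v, v') \<in> (R i)\<^sup>*" using v'(1) by simp
      moreover have "v j mod m = v' j mod m" if "j < n" for j
        using fun_cong[OF v'(2), of j] that by (simp add: res_def)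
      ultimately have "v i = v' i" using incong i kn by (metis order_less_le_trans)
      then have "t = f (res v)" by (simp add: f_def v'_def v(2))
      moreover have "res v \<in> PiE {..<n} (\<lambda>_. {..<m})" using m by (auto simp: res_def)
      ultimately show "t \<in> f ` (PiE {..<n} (\<lambda>_. {..<m}))" by blast
    qed
    moreover have "finite (PiE {..<n} (\<lambda>_. {..<m}))" by (simp add: finite_PiE)
    ultimately have V: "finite V" "card V \<le> N"
      using surj_card_le[of "PiE {..<n} (\<lambda>_. {..<m})" V f] finite_surj
      by (auto simp: card_PiE N_def)
    have "\<exists>w\<in>{1..N + 1}. 2 * w \<notin> V \<and> 2 * w + 1 \<notin> V"
    proof (rule ccontr)
      assume neg: "\<not> ?thesis"
      have "{1..N + 1} \<subseteq> (\<lambda>t. t div 2) ` V"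
      proof
        fix w assume "w \<in> {1..N + 1}"
        then have "2 * w \<in> V \<or> 2 * w + 1 \<in> V" using neg by blast
        then show "w \<in> (\<lambda>t. t div 2) ` V"
          by (elim disjE) (intro rev_image_eqI, assumption, presburger)+
      qed
      then have "card {1..N + 1} \<le> card V" using V(1) by (meson surj_card_le)
      then show False using V(2) by simp
    qed
    then obtain w where w: "w \<in> {1..N + 1}" "2 * w \<notin> V" "2 * w + 1 \<notin> V" by blast
    have "v i < 2 * w" using uv
    proof induction
      case base
      then show ?case using u w(1) by simp
    next
      case (step y z)
      have "(u, z) \<in> (R i)\<^sup>*" using step.hyps by simp
      then have "z i \<in> V" by (auto simp: V_def)
      moreover have "\<bar>int (y i) - int (z i)\<bar> \<le> 2" using step.hyps(2) i kn by (auto simp: R_def)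
      moreover have "z i \<noteq> 2 * w" "z i \<noteq> 2 * w + 1" using \<open>z i \<in> V\<close> w(2,3) by metis+
      ultimately show ?case using step.IH by linarith
    qed
    then show ?thesis using w(1) by simp
  qed
  \<comment> \<open>The condition \<open>c u = i\<close> gives one-point chains the right colour as
    well, since \<open>R i\<close> constrains only genuine links.\<close>
  define reach where "reach i = {v. \<exists>u. u i \<le> 1 \<and> c u = i \<and> (u, v) \<in> (R i)\<^sup>*}" for i
  have c_reach: "c v = i" if "v \<in> reach i" for v i
  proof -
    from that obtain u where u: "c u = i" "(u, v) \<in> (R i)\<^sup>*" by (auto simp: reach_def)
    from u(2) show ?thesis by (cases rule: rtranclE) (use u(1) in \<open>auto simp: R_def\<close>)
  qed
  define near where "near x y \<longleftrightarrow> (\<forall>j<n. \<bar>int (x j) - int (y j)\<bar> \<le> 1)" for x y :: "nat \<Rightarrow> nat"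
  \<comment> \<open>A colour doubles as a coordinate direction, which is possible because
    \<open>k \<le> n\<close>.\<close>
  define label :: "(nat \<Rightarrow> nat) \<Rightarrow> nat \<Rightarrow> nat" where
    "label x i = (if x i = 0 \<or> i < k \<and> (\<exists>v\<in>reach i. near x v) then 0 else 1)" for x i
  \<comment> \<open>Chain points have \<open>i\<close>-th entry at most \<open>2 * N + 1\<close> and
    points near them at most \<open>2 * N + 2\<close>, so the face \<open>x i = p\<close> gets the
    label 1 that Kuhn's lemma demands.\<close>
  define p where "p = 2 * N + 3"
  have label_p: "label x i = 1" if "i < n" "x i = p" for x i
  proof (rule ccontr)
    assume "label x i \<noteq> 1"
    moreover have "x i \<noteq> 0" using that by (simp add: p_def)
    ultimately obtain v where v: "i < k" "v \<in> reach i" "near x v"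
      by (auto simp: label_def split: if_splits)
    then have "v i < 2 * N + 2" using bound by (auto simp: reach_def)
    moreover have "\<bar>int (x i) - int (v i)\<bar> \<le> 1" using v(3) that(1) by (simp add: near_def)
    ultimately show False using that(2) by (simp add: p_def)
  qed
  have k1: "0 < p" by (simp add: p_def)
  have k2: "\<forall>x. (\<forall>i<n. x i \<le> p) \<longrightarrow> (\<forall>i<n. label x i = (0::nat) \<or> label x i = 1)"
    by (simp add: label_def)
  have k3: "\<forall>x. (\<forall>i<n. x i \<le> p) \<longrightarrow> (\<forall>i<n. x i = 0 \<longrightarrow> label x i = 0)" by (simp add: label_def)
  have k4: "\<forall>x. (\<forall>i<n. x i \<le> p) \<longrightarrow> (\<forall>i<n. x i = p \<longrightarrow> label x i = 1)"
    using label_p by simp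
  obtain q where diff: "\<forall>i<n. \<exists>r s. (\<forall>j<n. q j \<le> r j \<and> r j \<le> q j + 1) \<and>
       (\<forall>j<n. q j \<le> s j \<and> s j \<le> q j + 1) \<and> label r i \<noteq> label s i"
    by (rule kuhn_lemma[OF k1 k2 k3 k4])
  define i where "i = c q"
  have i: "i < k" "i < n" using c(1)[of q] kn by (auto simp: i_def)
  have "\<exists>a b. (\<forall>j<n. q j \<le> a j \<and> a j \<le> q j + 1) \<and> (\<forall>j<n. q j \<le> b j \<and> b j \<le> q j + 1) \<and>
      label a i = 1 \<and> label b i = 0"
  proof -
    obtain r s where rs: "\<forall>j<n. q j \<le> r j \<and> r j \<le> q j + 1" "\<forall>j<n. q j \<le> s j \<and> s j \<le> q j + 1"
      "label r i \<noteq> label s i" using diff i(2) by blast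
    moreover have "label r i = 0 \<or> label r i = 1" "label s i = 0 \<or> label s i = 1"
      by (simp_all add: label_def)
    ultimately have "label r i = 1 \<and> label s i = 0 \<or> label s i = 1 \<and> label r i = 0" by metis
    then show ?thesis using rs(1,2) by blast
  qed
  then obtain a b where ab: "\<And>j. j < n \<Longrightarrow> q j \<le> a j \<and> a j \<le> q j + 1"
    "\<And>j. j < n \<Longrightarrow> q j \<le> b j \<and> b j \<le> q j + 1" "label a i = 1" "label b i = 0" by blast
  \<comment> \<open>If \<open>b\<close> is on the face, then so is \<open>q\<close>; otherwise
    \<open>q\<close> is at most two steps from a chain point near \<open>b\<close>. Either way
    \<open>q\<close>, having colour \<open>i\<close>, belongs to a chain, and this forces the label
    0 on \<open>a\<close> too.\<close>
  have "q \<in> reach i"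
  proof (cases "b i = 0")
    case True
    then show ?thesis using ab(2)[OF i(2)] by (auto simp: reach_def i_def intro!: exI[of _ q])
  next
    case False
    then obtain v where v: "v \<in> reach i" "near b v"
      using ab(4) by (auto simp: label_def split: if_splits)
    have "\<bar>int (v j) - int (q j)\<bar> \<le> 2" if "j < n" for j
    proof -
      have "\<bar>int (b j) - int (v j)\<bar> \<le> 1" using v(2) that by (simp add: near_def)
      then show ?thesis using ab(2)[OF that] by linarith
    qed
    then have "(v, q) \<in> R i" using c_reach[OF v(1)] by (simp add: R_def i_def)
    then show ?thesis using v(1) unfolding reach_def by (blast intro: rtrancl_into_rtrancl)
  qed
  moreover have "near a q"
    unfolding near_def
  proof (intro allI impI)
    fix j assume "j < n" then show "\<bar>int (a j) - int (q j)\<bar> \<le> 1" using ab(1)[of j] by linarith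
  qed
  ultimately have "label a i = 0" using i by (auto simp: label_def)
  with ab(3) show False by simp
qed

subsection \<open>Coordinates on the torus\<close>

definition dot :: "nat \<Rightarrow> (nat \<Rightarrow> int) \<Rightarrow> (nat \<Rightarrow> 'a) \<Rightarrow> 'a::comm_ring_1" where
  "dot d v w = (\<Sum>j<d. of_int (v j) * w j)"

definition laurent :: "nat \<Rightarrow> (nat \<Rightarrow> int) \<Rightarrow> (nat \<Rightarrow> complex) \<Rightarrow> complex" where
  "laurent d v z = (\<Prod>j<d. z j powi v j)"

text \<open>The tail of ones lets the tori of all dimensions share one type while each point keeps a
  unique representation.\<close>

definition coord_torus :: "nat \<Rightarrow> (nat \<Rightarrow> complex) set" where
  "coord_torus d = {z. (\<forall>j<d. z j \<noteq> 0) \<and> (\<forall>j\<ge>d. z j = 1)}"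

definition coord_complement :: "nat \<Rightarrow> (nat \<Rightarrow> int) set \<Rightarrow> (nat \<Rightarrow> complex) set" where
  "coord_complement d X = {z \<in> coord_torus d. \<forall>v\<in>X. laurent d v z \<noteq> 1}"

text \<open>The universal covering map. It turns the equation \<open>laurent d v z = 1\<close> into
  integrality of \<open>dot d v w\<close>, so that the toric arrangement lifts to a periodic affine
  one.\<close>

definition torus_exp :: "nat \<Rightarrow> (nat \<Rightarrow> complex) \<Rightarrow> nat \<Rightarrow> complex" where
  "torus_exp d w = (\<lambda>j. if j < d then exp (2 * of_real pi * \<i> * w j) else 1)"

lemma dot_add: "dot d v (\<lambda>j. w j + w' j) = dot d v w + dot d v w'"
  and dot_diff: "dot d v (\<lambda>j. w j - w' j) = dot d v w - dot d v w'"
  and dot_cmult: "dot d v (\<lambda>j. c * w j) = c * dot d v w"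
  by (simp_all add: dot_def sum.distrib sum_subtractf sum_distrib_left algebra_simps)

lemma dot_of_real: "dot d v (\<lambda>j. of_real (x j)) = of_real (dot d v x)"
  by (simp add: dot_def)

lemma dot_of_int: "dot d v (\<lambda>j. of_int (x j)) = of_int (dot d v x)"
  by (simp add: dot_def)

lemma dot_mono_neutral: "dot d v w = dot e v w" if "e \<le> d" "\<And>j. e \<le> j \<Longrightarrow> v j = 0"
  unfolding dot_def using that by (intro sum.mono_neutral_right) auto

lemma Re_dot: "Re (dot d v w) = dot d v (\<lambda>j. Re (w j))"
  and Im_dot: "Im (dot d v w) = dot d v (\<lambda>j. Im (w j))"
  by (simp_all add: dot_def)

lemma exp_2pi_i_eq_1_iff: "exp (2 * of_real pi * \<i> * x) = 1 \<longleftrightarrow> x \<in> \<int>"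
proof
  assume "exp (2 * of_real pi * \<i> * x) = 1"
  then obtain n :: int where n: "Im x = 0" "2 * pi * Re x = of_int (2 * n) * pi"
    by (auto simp: exp_eq_1)
  then have "x = of_int n" by (simp add: complex_eq_iff)
  then show "x \<in> \<int>" by simp
next
  assume "x \<in> \<int>"
  then obtain n where "x = of_int n" by (elim Ints_cases)
  then show "exp (2 * of_real pi * \<i> * x) = 1"
    using exp_integer_2pi[of "of_int n"] by (simp add: mult_ac)
qed

lemma exp_2pi_i_eq_iff: "exp (2 * of_real pi * \<i> * x) = exp (2 * of_real pi * \<i> * y) \<longleftrightarrow> x - y \<in> \<int>"
  unfolding exp_2pi_i_eq_1_iff[symmetric] by (simp add: algebra_simps exp_diff)

lemma torus_exp_in_coord_torus: "torus_exp d w \<in> coord_torus d"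
  by (simp add: torus_exp_def coord_torus_def)

lemma laurent_torus_exp: "laurent d v (torus_exp d w) = exp (2 * of_real pi * \<i> * dot d v w)"
proof -
  have "laurent d v (torus_exp d w) = (\<Prod>j<d. exp (2 * of_real pi * \<i> * (of_int (v j) * w j)))"
    unfolding laurent_def torus_exp_def
    by (intro prod.cong refl) (simp add: exp_power_int mult_ac)
  then show ?thesis by (simp add: exp_sum dot_def sum_distrib_left)
qed

lemma torus_exp_in_complement_iff:
  "torus_exp d w \<in> coord_complement d X \<longleftrightarrow> (\<forall>v\<in>X. dot d v w \<notin> \<int>)"
  by (simp add: coord_complement_def torus_exp_in_coord_torus laurent_torus_exp exp_2pi_i_eq_1_iff)

lemma torus_exp_eqI: "torus_exp d w = torus_exp d w'" if "\<And>j. j < d \<Longrightarrow> w j - w' j \<in> \<int>"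
  using that by (auto simp: torus_exp_def exp_2pi_i_eq_iff)

lemma continuous_on_torus_exp:
  assumes "\<And>j. j < d \<Longrightarrow> continuous_on S (\<lambda>x. w x j)"
  shows "continuous_on S (\<lambda>x. torus_exp d (w x))"
proof (rule continuous_on_coordinatewise_then_product)
  fix j show "continuous_on S (\<lambda>x. torus_exp d (w x) j)"
    by (cases "j < d") (auto simp: torus_exp_def intro!: continuous_intros assms)
qed

lemma continuous_on_laurent:
  assumes "\<And>j. j < d \<Longrightarrow> continuous_on S (\<lambda>x. z x j)" "\<And>x j. x \<in> S \<Longrightarrow> j < d \<Longrightarrow> z x j \<noteq> 0"
  shows "continuous_on S (\<lambda>x. laurent d v (z x))"
  unfolding laurent_def using assms by (intro continuous_intros) auto

lemma continuous_on_dot: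
  fixes w :: "'b::topological_space \<Rightarrow> nat \<Rightarrow> 'a::real_normed_field"
  assumes "\<And>j. j < d \<Longrightarrow> continuous_on S (\<lambda>x. w x j)"
  shows "continuous_on S (\<lambda>x. dot d v (w x))"
  unfolding dot_def using assms by (intro continuous_intros) auto

lemma continuous_on_component:
  assumes "continuous_on S f"
  shows "continuous_on S (\<lambda>x. f x j)"
  by (rule continuous_on_product_then_coordinatewise[OF assms])

lemma continuous_on_coordinate [continuous_intros]: "continuous_on S (\<lambda>z. z j)"
  by (rule continuous_on_component[OF continuous_on_id])

lemma openin_coord_complement:
  assumes "finite X"
  shows "openin (top_of_set {z. \<forall>j\<ge>d. z j = 1}) (coord_complement d X)"
proof -
  let ?A = "{z :: nat \<Rightarrow> complex. \<forall>j\<ge>d. z j = 1}"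
  have 1: "openin (top_of_set ?A) (coord_torus d)"
  proof -
    have eq: "coord_torus d = ?A \<inter> (\<Inter>j<d. {z. z j \<noteq> 0})" by (auto simp: coord_torus_def)
    show ?thesis
      unfolding eq
      by (intro openin_open_Int open_INT open_Collect_neq finite_lessThan ballI continuous_intros)
  qed
  have "openin (top_of_set (coord_torus d)) (coord_torus d \<inter> (\<lambda>z. laurent d v z) -` (- {1}))" for v
    by (rule continuous_openin_preimage_gen)
       (auto intro!: continuous_on_laurent continuous_intros simp: coord_torus_def)
  then have "openin (top_of_set (coord_torus d))
      ((\<Inter>v\<in>X. coord_torus d \<inter> (\<lambda>z. laurent d v z) -` (- {1})) \<inter> topspace (top_of_set (coord_torus d)))"
    by (intro openin_INT assms)
  also have "(\<Inter>v\<in>X. coord_torus d \<inter> (\<lambda>z. laurent d v z) -` (- {1})) \<inter> topspace (top_of_set (coord_torus d))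
      = coord_complement d X"
    by (auto simp: coord_complement_def)
  finally show ?thesis using 1 openin_trans by blast
qed

section \<open>Winding numbers through continuous logarithms\<close>

lemma exp_2pi_i_constant:
  fixes f :: "real \<Rightarrow> complex"
  assumes "continuous_on {0..1} f" "\<And>s. s \<in> {0..1} \<Longrightarrow> exp (f s) = 1"
  shows "f 0 = f 1"
proof -
  have "f constant_on {0..1}"
  proof (rule continuous_discrete_range_constant)
    fix x :: real assume x: "x \<in> {0..1}"
    have "2 * pi \<le> norm (f y - f x)" if y: "y \<in> {0..1}" "f y \<noteq> f x" for y
    proof -
      obtain m n :: int where "Re (f x) = 0" "Im (f x) = of_int (2 * m) * pi"
        "Re (f y) = 0" "Im (f y) = of_int (2 * n) * pi"
        using assms(2)[OF x] assms(2)[OF y(1)] by (auto simp: exp_eq_1)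
      then have eq: "f y - f x = of_real (of_int (n - m) * (2 * pi)) * \<i>"
        by (simp add: complex_eq_iff algebra_simps)
      with y have "n - m \<noteq> 0" by auto
      then have "1 \<le> \<bar>real_of_int (n - m)\<bar>" by linarith
      then have "1 * (2 * pi) \<le> \<bar>real_of_int (n - m)\<bar> * (2 * pi)" by (intro mult_right_mono) auto
      also have "\<dots> = norm (f y - f x)"
        unfolding eq norm_mult norm_of_real abs_mult norm_ii by simp
      finally show ?thesis by simp
    qed
    then show "\<exists>e>0. \<forall>y. y \<in> {0..1} \<and> f y \<noteq> f x \<longrightarrow> e \<le> norm (f y - f x)"
      using pi_gt_zero by (intro exI[of _ "2 * pi"]) auto
  qed (use assms in auto)
  then show ?thesis by (auto simp: constant_on_def)
qed

text \<open>Invariance of the winding number under free homotopy. The contractible square carries a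
  logarithm; its increment along the loop at parameter \<open>s\<close> is a period, and periods are
  discrete, so it does not depend on \<open>s\<close>. Two logarithms of the same function differ by
  a constant, hence have the same increment.\<close>

lemma loop_log_increment_homotopic:
  fixes \<Psi> :: "real \<times> real \<Rightarrow> complex"
  assumes cont: "continuous_on ({0..1} \<times> {0..1}) \<Psi>"
    and nz: "\<And>x. x \<in> {0..1} \<times> {0..1} \<Longrightarrow> \<Psi> x \<noteq> 0"
    and loop: "\<And>s. s \<in> {0..1} \<Longrightarrow> \<Psi> (s, 0) = \<Psi> (s, 1)"
    and A: "continuous_on {0..1} A" "\<And>t. t \<in> {0..1} \<Longrightarrow> \<Psi> (0, t) = exp (A t)"
    and B: "continuous_on {0..1} B" "\<And>t. t \<in> {0..1} \<Longrightarrow> \<Psi> (1, t) = exp (B t)"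
  shows "A 1 - A 0 = B 1 - B 0"
proof -
  have "contractible ({0..1::real} \<times> {0..1::real})"
    by (intro convex_imp_contractible convex_Times) auto
  then obtain L where L: "continuous_on ({0..1} \<times> {0..1}) L" "\<And>x. x \<in> {0..1} \<times> {0..1} \<Longrightarrow> \<Psi> x = exp (L x)"
    using continuous_logarithm_on_contractible[OF cont _ nz] by metis
  have cL: "continuous_on {0..1} (\<lambda>t. L (f t, g t))"
    if "continuous_on {0..1} f" "continuous_on {0..1} g" "\<And>t. t \<in> {0..1} \<Longrightarrow> f t \<in> {0..1}"
      "\<And>t. t \<in> {0..1} \<Longrightarrow> g t \<in> {0..1}" for f g :: "real \<Rightarrow> real"
    using that by (intro continuous_on_compose2[OF L(1)] continuous_intros) auto
  have "L (0, 1) - L (0, 0) = L (1, 1) - L (1, 0)"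
  proof (rule exp_2pi_i_constant[of "\<lambda>s. L (s, 1) - L (s, 0)"])
    show "continuous_on {0..1} (\<lambda>s. L (s, 1) - L (s, 0))" by (intro continuous_intros cL) auto
    show "exp (L (s, 1) - L (s, 0)) = 1" if "s \<in> {0..1}" for s
      using loop[OF that] L(2)[of "(s, 0)"] L(2)[of "(s, 1)"] that by (simp add: exp_diff)
  qed
  moreover have "L (0, 0) - A 0 = L (0, 1) - A 1"
  proof (rule exp_2pi_i_constant[of "\<lambda>t. L (0, t) - A t"])
    show "continuous_on {0..1} (\<lambda>t. L (0, t) - A t)" by (intro continuous_intros cL A) auto
    show "exp (L (0, t) - A t) = 1" if "t \<in> {0..1}" for t
      using A(2)[OF that] L(2)[of "(0, t)"] that by (simp add: exp_diff)
  qed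
  moreover have "L (1, 0) - B 0 = L (1, 1) - B 1"
  proof (rule exp_2pi_i_constant[of "\<lambda>t. L (1, t) - B t"])
    show "continuous_on {0..1} (\<lambda>t. L (1, t) - B t)" by (intro continuous_intros cL B) auto
    show "exp (L (1, t) - B t) = 1" if "t \<in> {0..1}" for t
      using B(2)[OF that] L(2)[of "(1, t)"] that by (simp add: exp_diff)
  qed
  ultimately show ?thesis by algebra
qed

text \<open>For \<open>c > 0\<close> write \<open>exp u - 1\<close> as
  \<open>exp u * (1 - exp (- u))\<close>, for \<open>c < 0\<close> as \<open>- (1 - exp u)\<close>.
  The last factor stays in the open disc of radius 1 about 1, where \<open>Ln\<close> is continuous,
  so it contributes no winding; the sign accounts for the summand pi i.\<close>

lemma log_exp_minus_1:
  fixes u :: "real \<Rightarrow> complex"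
  assumes u: "continuous_on {0..1} u" and loop: "exp (u 1) = exp (u 0)" and "c \<noteq> 0"
    and Re: "\<And>t. t \<in> {0..1} \<Longrightarrow> Re (u t) = c"
  obtains A where "continuous_on {0..1} A" "\<And>t. t \<in> {0..1} \<Longrightarrow> exp (u t) - 1 = exp (A t)"
    "A 1 - A 0 = (if c > 0 then u 1 - u 0 else 0)"
proof -
  have nonpos: "1 - z \<notin> \<real>\<^sub>\<le>\<^sub>0" if "norm z < 1" for z :: complex
  proof
    assume "1 - z \<in> \<real>\<^sub>\<le>\<^sub>0"
    then have "1 \<le> Re z" by (simp add: complex_nonpos_Reals_iff)
    also have "Re z \<le> norm z" by (rule complex_Re_le_cmod)
    finally show False using that by simp
  qed
  have loop': "exp (- u 1) = exp (- u 0)" using loop by (simp add: exp_minus)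
  show thesis
  proof (cases "c > 0")
    case True
    have "norm (exp (- u t)) < 1" if "t \<in> {0..1}" for t using Re[OF that] True by simp
    note n = nonpos[OF this]
    show thesis
    proof (rule that[of "\<lambda>t. u t + Ln (1 - exp (- u t))"])
      show "continuous_on {0..1} (\<lambda>t. u t + Ln (1 - exp (- u t)))"
        using n by (intro continuous_intros u) auto
      show "exp (u t) - 1 = exp (u t + Ln (1 - exp (- u t)))" if "t \<in> {0..1}" for t
      proof -
        have "1 - exp (- u t) \<noteq> 0" using n[OF that] by auto
        then have "exp (u t + Ln (1 - exp (- u t))) = exp (u t) * (1 - exp (- u t))"
          by (simp add: exp_add exp_Ln)
        then show ?thesis by (simp add: right_diff_distrib flip: exp_add)
      qed
    qed (use True loop' in simp)
  next
    case False
    have "norm (exp (u t)) < 1" if "t \<in> {0..1}" for t using Re[OF that] False \<open>c \<noteq> 0\<close> by simp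
    note n = nonpos[OF this]
    show thesis
    proof (rule that[of "\<lambda>t. of_real pi * \<i> + Ln (1 - exp (u t))"])
      show "continuous_on {0..1} (\<lambda>t. of_real pi * \<i> + Ln (1 - exp (u t)))"
        using n by (intro continuous_intros u) auto
      show "exp (u t) - 1 = exp (of_real pi * \<i> + Ln (1 - exp (u t)))" if "t \<in> {0..1}" for t
      proof -
        have "1 - exp (u t) \<noteq> 0" using n[OF that] by auto
        then show ?thesis by (simp add: exp_add exp_Ln)
      qed
    qed (use False loop in simp)
  qed
qed

subsection \<open>The lower bound\<close>

text \<open>Search on the moment curve (1, x, x^2, ...): there a nonzero linear form becomes a
  nonzero polynomial in x with finitely many roots, so finitely many forms leave a point
  free.\<close>

lemma exists_dot_nonzero:
  assumes "finite X" "\<And>v. v \<in> X \<Longrightarrow> \<exists>j<d. v j \<noteq> 0"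
  obtains l :: "nat \<Rightarrow> real" where "\<forall>v\<in>X. dot d v l \<noteq> 0"
proof (cases d)
  case 0
  then have "X = {}" using assms(2) by auto
  then show thesis using that by simp
next
  case (Suc e)
  have d: "{..<d} = {..e}" using Suc by auto
  have "finite {x :: real. dot d v (\<lambda>j. x ^ j) = 0}" if "v \<in> X" for v
  proof -
    have "\<exists>i\<le>e. real_of_int (v i) \<noteq> 0" using assms(2)[OF that] Suc by (auto simp: less_Suc_eq_le)
    then have "finite {x :: real. (\<Sum>i\<le>e. of_int (v i) * x ^ i) = 0}"
      by (simp add: Transcendental.polyfun_finite_roots)
    then show ?thesis by (simp add: dot_def d)
  qed
  then have "finite (\<Union>v\<in>X. {x :: real. dot d v (\<lambda>j. x ^ j) = 0})" using assms(1) by blast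
  then obtain x :: real where "x \<notin> (\<Union>v\<in>X. {x :: real. dot d v (\<lambda>j. x ^ j) = 0})"
    using ex_new_if_finite[OF infinite_UNIV_char_0] by blast
  then show thesis using that[of "\<lambda>j. x ^ j"] by auto
qed

text \<open>
  Two tori \<open>|z\<^sub>j| = \<rho>\<^sub>j\<close> and \<open>|z\<^sub>j| = 1 / \<rho>\<^sub>j\<close> with generic radii avoid the arrangement.
  A monomial is large on one of them and small on the other, so that the winding number of
  \<open>\<chi> - 1\<close> is that of \<open>\<chi>\<close> on one of them, and zero on the other. Hence a loop in the first torus is freely
  homotopic to a loop in the (first \<open>e\<close> coordinates of the) second one only if both are trivial.
\<close>

lemma planner_cover_lower_bound:
  assumes X: "finite X" and ed: "e \<le> d"
    and supp: "\<And>v j. v \<in> X \<Longrightarrow> e \<le> j \<Longrightarrow> v j = 0"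
    and nz: "\<And>v. v \<in> X \<Longrightarrow> \<exists>j<d. v j \<noteq> 0"
    and nondeg: "\<And>z :: nat \<Rightarrow> int. (\<And>v. v \<in> X \<Longrightarrow> dot e v z = 0) \<Longrightarrow> \<forall>j<e. z j = 0"
    and cover: "planner_cover (top_of_set (coord_complement d X)) k"
  shows "d + e + 1 \<le> k"
proof (rule ccontr)
  assume "\<not> d + e + 1 \<le> k"
  then have kn: "k \<le> d + e" by simp
  define M where "M = coord_complement d X"
  obtain l :: "nat \<Rightarrow> real" where "\<forall>v\<in>X. dot d v l \<noteq> 0"
    by (rule exists_dot_nonzero[OF X nz])
  then have l: "\<And>v. v \<in> X \<Longrightarrow> dot d v l \<noteq> 0" by blast
  obtain U where Uc: "(\<Union>i<k. U i) = M \<times> M"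
    and Uo: "\<And>i. i < k \<Longrightarrow> openin (top_of_set (M \<times> M)) (U i)"
    and Up: "\<And>i. i < k \<Longrightarrow> \<exists>h. continuous_planner (top_of_set M) (U i) h"
  proof -
    from cover have "\<exists>U. (\<Union>i<k. U i) = M \<times> M \<and> (\<forall>i<k. openin (top_of_set (M \<times> M)) (U i) \<and>
        (\<exists>h. continuous_planner (top_of_set M) (U i) h))"
      unfolding planner_cover_def M_def by (simp add: prod_topology_subtopology_eu)
    then show thesis using that by (elim exE conjE) simp
  qed
  \<comment> \<open>Lifts of the two tori: the imaginary parts \<open>- l j\<close> and
    \<open>l j\<close> give the radii exp(2 pi l_j) and their inverses. The first \<open>d\<close>
    parameters are the angles of the first torus, the next \<open>e\<close> are the first
    \<open>e\<close> angles of the second, whose other angles are fixed.\<close>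
  define w1 where "w1 p = (\<lambda>j. of_real (p j) - \<i> * of_real (l j))" for p :: "nat \<Rightarrow> real"
  define w2 where "w2 p = (\<lambda>j. of_real (if j < e then p (d + j) else 0) + \<i> * of_real (l j))"
    for p :: "nat \<Rightarrow> real"
  define F where "F p = (torus_exp d (w1 p), torus_exp d (w2 p))" for p
  have Im1: "Im (dot d v (w1 p)) = - dot d v l" and Im2: "Im (dot d v (w2 p)) = dot d v l" for v p
    by (simp_all add: Im_dot w1_def w2_def dot_def sum_negf)
  have FM: "F p \<in> M \<times> M" for p
  proof -
    have "dot d v (w1 p) \<notin> \<int>" "dot d v (w2 p) \<notin> \<int>" if "v \<in> X" for v
      using l[OF that] Im1[of v p] Im2[of v p] by (auto elim!: Ints_cases)
    then show ?thesis by (simp add: F_def M_def torus_exp_in_complement_iff)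
  qed
  have cw1: "continuous_on S (\<lambda>x. w1 (f x) j)" if "continuous_on S f" for S and f :: "'x::topological_space \<Rightarrow> nat \<Rightarrow> real" and j
    unfolding w1_def by (intro continuous_intros continuous_on_component[OF that])
  have cw2: "continuous_on S (\<lambda>x. w2 (f x) j)" if "continuous_on S f" for S and f :: "'x::topological_space \<Rightarrow> nat \<Rightarrow> real" and j
    unfolding w2_def by (cases "j < e") (auto intro!: continuous_intros continuous_on_component[OF that])
  have cF: "continuous_on S (\<lambda>x. F (f x))" if "continuous_on S f" for S and f :: "'x::topological_space \<Rightarrow> nat \<Rightarrow> real"
    unfolding F_def by (intro continuous_on_Pair continuous_on_torus_exp cw1 cw2 that)
  define W where "W i = {p. F p \<in> U i}" for i
  have W_open: "open (W i)" if "i < k" for i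
  proof -
    have "openin (top_of_set UNIV) (UNIV \<inter> F -` U i)"
      using cF[OF continuous_on_id] FM Uo[OF that] by (intro continuous_openin_preimage[of _ _ "M \<times> M"]) auto
    then show ?thesis by (simp add: W_def vimage_def)
  qed
  have W_cover: "\<exists>i<k. p \<in> W i" for p
  proof -
    have "F p \<in> (\<Union>i<k. U i)" using FM[of p] unfolding Uc .
    then show ?thesis by (auto simp: W_def)
  qed
  have F_periodic: "F q = F p" if "\<And>j. j < d + e \<Longrightarrow> q j - p j \<in> \<int>" for p q
  proof -
    have "w1 q j - w1 p j \<in> \<int>" if "j < d" for j
      using \<open>\<And>j. j < d + e \<Longrightarrow> q j - p j \<in> \<int>\<close>[of j] that
      by (auto simp: w1_def elim!: Ints_cases simp flip: of_real_diff)
    moreover have "w2 q j - w2 p j \<in> \<int>" if "j < d" for j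
      using \<open>\<And>j. j < d + e \<Longrightarrow> q j - p j \<in> \<int>\<close>[of "d + j"] that
      by (auto simp: w2_def elim!: Ints_cases simp flip: of_real_diff)
    ultimately show ?thesis unfolding F_def by (intro arg_cong2[where f=Pair] torus_exp_eqI)
  qed
  have W_periodic: "q \<in> W i" if "i < k" "\<And>j. j < d + e \<Longrightarrow> q j - p j \<in> \<int>" "p \<in> W i" for i p q
    using F_periodic[OF that(2)] that(3) by (simp add: W_def)
  obtain i g where i: "i < k" and g: "path g" "path_image g \<subseteq> W i"
    and gZ: "\<And>j. j < d + e \<Longrightarrow> g 1 j - g 0 j \<in> \<int>" and wrap: "\<exists>j<d + e. g 1 j \<noteq> g 0 j"
    by (rule periodic_cover_wraps[OF kn W_open W_cover W_periodic]) (assumption | rule that)+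
  have cg: "continuous_on {0..1} g" using g(1) by (simp add: path_def)
  have Ug: "F (g t) \<in> U i" if "t \<in> {0..1}" for t
    using g(2) that by (auto simp: path_image_def W_def image_subset_iff)
  obtain h where "continuous_planner (top_of_set M) (U i) h" using Up[OF i] ..
  moreover have "U i \<subseteq> M \<times> M" using openin_imp_subset[OF Uo[OF i]] .
  ultimately have h: "continuous_on (U i \<times> {0..1}) h" "h ` (U i \<times> {0..1}) \<subseteq> M"
    "\<And>p. p \<in> U i \<Longrightarrow> h (p, 0) = fst p \<and> h (p, 1) = snd p"
    by (simp_all add: continuous_planner_top_of_set)
  \<comment> \<open>The time of the planner is the first variable and the loop parameter the second:
    a free homotopy in \<open>M\<close> from the loop in the first torus to the loop in the
    second.\<close>
  define H where "H x = h (F (g (snd x)), fst x)" for x :: "real \<times> real"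
  have cH: "continuous_on ({0..1} \<times> {0..1}) H"
    unfolding H_def
  proof (rule continuous_on_compose2[OF h(1)])
    show "continuous_on ({0..1} \<times> {0..1}) (\<lambda>x :: real \<times> real. (F (g (snd x)), fst x))"
      by (intro continuous_on_Pair cF continuous_on_fst continuous_on_id
            continuous_on_compose2[OF cg continuous_on_snd]) auto
  qed (use Ug in auto)
  have HM: "H x \<in> M" if "x \<in> {0..1} \<times> {0..1}" for x
    using h(2) Ug that by (auto simp: H_def image_subset_iff)
  have Hloop: "H (s, 0) = H (s, 1)" for s
    using F_periodic[OF gZ] by (simp add: H_def)
  have H0: "H (0, t) = torus_exp d (w1 (g t))" and H1: "H (1, t) = torus_exp d (w2 (g t))"
    if "t \<in> {0..1}" for t
    using h(3)[OF Ug[OF that]] by (simp_all add: H_def F_def)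
  define \<delta> where "\<delta> j = g 1 j - g 0 j" for j
  \<comment> \<open>A coordinate is nonzero on \<open>M\<close>, so it winds equally along both
    loops; the second loop does not wind in the coordinates from \<open>e\<close> on.\<close>
  have coord: "\<delta> j = (if j < e then \<delta> (d + j) else 0)" if j: "j < d" for j
  proof -
    have "2 * of_real pi * \<i> * w1 (g 1) j - 2 * of_real pi * \<i> * w1 (g 0) j
        = 2 * of_real pi * \<i> * w2 (g 1) j - 2 * of_real pi * \<i> * w2 (g 0) j"
    proof (rule loop_log_increment_homotopic[of "\<lambda>x. H x j"
          "\<lambda>t. 2 * of_real pi * \<i> * w1 (g t) j" "\<lambda>t. 2 * of_real pi * \<i> * w2 (g t) j"])
      show "H x j \<noteq> 0" if "x \<in> {0..1} \<times> {0..1}" for x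
        using HM[OF that] j by (simp add: M_def coord_complement_def coord_torus_def)
      show "H (0, t) j = exp (2 * of_real pi * \<i> * w1 (g t) j)"
        "H (1, t) j = exp (2 * of_real pi * \<i> * w2 (g t) j)" if "t \<in> {0..1}" for t
        using H0[OF that] H1[OF that] j by (simp_all add: torus_exp_def)
    qed (auto intro!: continuous_on_component[OF cH] continuous_intros cw1 cw2 cg Hloop arg_cong[where f="\<lambda>f. f j"])
    then have "w1 (g 1) j - w1 (g 0) j = w2 (g 1) j - w2 (g 0) j"
      by (simp flip: right_diff_distrib)
    then have "complex_of_real (\<delta> j) = of_real (if j < e then \<delta> (d + j) else 0)"
      by (simp add: w1_def w2_def \<delta>_def)
    then show ?thesis by (simp only: of_real_eq_iff)
  qed
  \<comment> \<open>The function \<open>laurent d v z - 1\<close> has no zero on \<open>M\<close>,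
    so it winds equally along both loops. On the torus where the monomial is large it winds like the
    monomial, on the other one not at all. The monomial itself winds \<open>dot e v \<delta>\<close>
    times along either loop, so this number is 0.\<close>
  have pair: "dot e v \<delta> = 0" if v: "v \<in> X" for v
  proof -
    have lau0: "laurent d v (H (0, t)) = exp (2 * of_real pi * \<i> * dot d v (w1 (g t)))"
      and lau1: "laurent d v (H (1, t)) = exp (2 * of_real pi * \<i> * dot d v (w2 (g t)))"
      if "t \<in> {0..1}" for t using H0[OF that] H1[OF that] by (simp_all add: laurent_torus_exp)
    define u1 where "u1 t = 2 * of_real pi * \<i> * dot d v (w1 (g t))" for t
    define u2 where "u2 t = 2 * of_real pi * \<i> * dot d v (w2 (g t))" for t
    have c1: "continuous_on {0..1} u1" and c2: "continuous_on {0..1} u2"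
      unfolding u1_def u2_def by (intro continuous_intros continuous_on_dot cw1 cw2 cg)+
    have l1: "exp (u1 1) = exp (u1 0)" and l2: "exp (u2 1) = exp (u2 0)"
      using lau0[of 0] lau0[of 1] lau1[of 0] lau1[of 1] Hloop by (auto simp: u1_def u2_def)
    define c where "c = 2 * pi * dot d v l"
    have "c \<noteq> 0" using l[OF v] by (simp add: c_def)
    have R1: "Re (u1 t) = c" and R2: "Re (u2 t) = - c" for t
      using Im1[of v "g t"] Im2[of v "g t"] by (simp_all add: u1_def u2_def c_def)
    obtain A where A: "continuous_on {0..1} A" "\<And>t. t \<in> {0..1} \<Longrightarrow> exp (u1 t) - 1 = exp (A t)"
      "A 1 - A 0 = (if c > 0 then u1 1 - u1 0 else 0)"
      by (rule log_exp_minus_1[OF c1 l1 \<open>c \<noteq> 0\<close> R1]) (rule that)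
    have "- c \<noteq> 0" using \<open>c \<noteq> 0\<close> by simp
    obtain B where B: "continuous_on {0..1} B" "\<And>t. t \<in> {0..1} \<Longrightarrow> exp (u2 t) - 1 = exp (B t)"
      "B 1 - B 0 = (if - c > 0 then u2 1 - u2 0 else 0)"
      by (rule log_exp_minus_1[OF c2 l2 \<open>- c \<noteq> 0\<close> R2]) (rule that)
    have "A 1 - A 0 = B 1 - B 0"
    proof (rule loop_log_increment_homotopic[of "\<lambda>x. laurent d v (H x) - 1"])
      have "H x j \<noteq> 0" if "x \<in> {0..1} \<times> {0..1}" "j < d" for x j
        using HM[OF that(1)] that(2) by (simp add: M_def coord_complement_def coord_torus_def)
      then show "continuous_on ({0..1} \<times> {0..1}) (\<lambda>x. laurent d v (H x) - 1)"
        by (intro continuous_intros continuous_on_laurent continuous_on_component[OF cH])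
      show "laurent d v (H x) - 1 \<noteq> 0" if "x \<in> {0..1} \<times> {0..1}" for x
        using HM[OF that] v by (simp add: M_def coord_complement_def)
      show "laurent d v (H (s, 0)) - 1 = laurent d v (H (s, 1)) - 1" for s by (simp add: Hloop)
      show "laurent d v (H (0, t)) - 1 = exp (A t)" "laurent d v (H (1, t)) - 1 = exp (B t)"
        if "t \<in> {0..1}" for t
        using A(2)[OF that] B(2)[OF that] lau0[OF that] lau1[OF that] by (simp_all add: u1_def u2_def)
    qed (use A B in auto)
    then have "u1 1 - u1 0 = 0 \<or> u2 1 - u2 0 = 0"
      using A(3) B(3) \<open>c \<noteq> 0\<close> by (auto split: if_splits)
    moreover have "u1 1 - u1 0 = 2 * of_real pi * \<i> * of_real (dot e v \<delta>)"
    proof -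
      have "w1 (g 1) j - w1 (g 0) j = of_real (\<delta> j)" for j by (simp add: w1_def \<delta>_def)
      then have "dot d v (w1 (g 1)) - dot d v (w1 (g 0)) = of_real (dot d v \<delta>)"
        by (simp flip: dot_diff dot_of_real)
      moreover have "dot d v \<delta> = dot e v \<delta>" by (rule dot_mono_neutral[OF ed]) (rule supp[OF v])
      ultimately show ?thesis by (simp add: u1_def flip: right_diff_distrib)
    qed
    moreover have "u2 1 - u2 0 = 2 * of_real pi * \<i> * of_real (dot e v \<delta>)"
    proof -
      have "dot d v (w2 (g 1)) - dot d v (w2 (g 0)) = dot d v (\<lambda>j. w2 (g 1) j - w2 (g 0) j)"
        by (simp add: dot_diff)
      also have "\<dots> = dot e v (\<lambda>j. w2 (g 1) j - w2 (g 0) j)"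
        by (rule dot_mono_neutral[OF ed]) (rule supp[OF v])
      also have "\<dots> = dot e v (\<lambda>j. of_real (\<delta> j))"
        unfolding dot_def
      proof (intro sum.cong refl arg_cong2[where f="(*)"])
        fix j assume "j \<in> {..<e}"
        then have "\<delta> j = \<delta> (d + j)" using coord[of j] ed by simp
        with \<open>j \<in> {..<e}\<close> show "w2 (g 1) j - w2 (g 0) j = of_real (\<delta> j)"
          by (simp add: w2_def \<delta>_def)
      qed
      finally show ?thesis by (simp add: u2_def dot_of_real flip: right_diff_distrib)
    qed
    ultimately show ?thesis by (auto simp del: of_real_mult)
  qed
  define z where "z j = \<lfloor>\<delta> j\<rfloor>" for j
  have z: "of_int (z j) = \<delta> j" if "j < d + e" for j
    using gZ[OF that] unfolding z_def \<delta>_def by (metis Ints_cases floor_of_int)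
  have "dot e v z = 0" if "v \<in> X" for v
  proof -
    have "real_of_int (dot e v z) = dot e v \<delta>"
      unfolding dot_def of_int_sum of_int_mult using z ed by (intro sum.cong refl) (auto simp: z)
    then show ?thesis using pair[OF that] by simp
  qed
  then have "\<forall>j<e. z j = 0" by (rule nondeg)
  then have "\<delta> j = 0" if "j < e" for j using z[of j] that ed by simp
  then have small: "\<delta> j = 0" if "j < d" for j using coord[OF that] coord[of j] that ed by (cases "j < e") auto
  \<comment> \<open>The parameters of the second torus: \<open>coord\<close> equates their
    increments with those of the first \<open>e\<close> parameters, which are already known to
    vanish.\<close>
  have "\<delta> j = 0" if "j < d + e" for j
  proof (cases "j < d")
    case False
    then have "\<delta> (j - d) = \<delta> j" using coord[of "j - d"] that ed by simp
    then show ?thesis using small[of "j - d"] False that ed by simp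
  qed (rule small)
  then show False using wrap by (auto simp: \<delta>_def)
qed

subsection \<open>Rational rank\<close>

lemma vector_space_ratfun: "vector_space (\<lambda>(c::rat) (f::nat \<Rightarrow> rat) j. c * f j)"
  unfolding vector_space_def plus_fun_def by (simp add: distrib_left distrib_right mult.assoc)

lemma vector_space_rat: "vector_space ((*) :: rat \<Rightarrow> rat \<Rightarrow> rat)"
  unfolding vector_space_def by (simp add: distrib_left distrib_right mult.assoc)

interpretation ratfun: vector_space "\<lambda>(c::rat) (f::nat \<Rightarrow> rat) j. c * f j"
  by (rule vector_space_ratfun)

definition rat_vec :: "(nat \<Rightarrow> int) \<Rightarrow> nat \<Rightarrow> rat" where
  "rat_vec v = (\<lambda>j. of_int (v j))"

definition unit_vec :: "nat \<Rightarrow> nat \<Rightarrow> 'a::{zero,one}" where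
  "unit_vec i = (\<lambda>j. if j = i then 1 else 0)"

text \<open>The integer points of the rational span, that is, the vectors with a positive multiple
  in the lattice generated by \<open>S\<close>.\<close>

definition qspan :: "(nat \<Rightarrow> int) set \<Rightarrow> (nat \<Rightarrow> int) set" where
  "qspan S = {v. rat_vec v \<in> ratfun.span (rat_vec ` S)}"

definition qrank :: "(nat \<Rightarrow> int) set \<Rightarrow> nat" where
  "qrank S = ratfun.dim (rat_vec ` S)"

lemma rat_vec_unit_vec: "rat_vec (unit_vec i) = unit_vec i"
  by (auto simp: rat_vec_def unit_vec_def)

lemma dot_unit_vec: "j < e \<Longrightarrow> dot e (unit_vec j) w = w j"
proof -
  assume j: "j < e"
  have "dot e (unit_vec j) w = (\<Sum>i<e. if i = j then w j else 0)"
    unfolding dot_def by (intro sum.cong) (auto simp: unit_vec_def)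
  then show ?thesis using j by simp
qed

lemma sum_fun_apply: "(\<Sum>i\<in>I. f i) j = (\<Sum>i\<in>I. f i j)" for f :: "'i \<Rightarrow> nat \<Rightarrow> rat"
  by (induction I rule: infinite_finite_induct) auto

lemma finite_basis:
  assumes "finite V"
  obtains B where "B \<subseteq> V" "finite B" "\<not> ratfun.dependent B" "V \<subseteq> ratfun.span B" "card B = ratfun.dim V"
proof -
  obtain B where B: "B \<subseteq> V" "\<not> ratfun.dependent B" "V \<subseteq> ratfun.span B"
    using ratfun.maximal_independent_subset by blast
  moreover have "card B = ratfun.dim V" by (rule ratfun.basis_card_eq_dim[OF B(1) B(3) B(2)])
  ultimately show thesis using that finite_subset[OF B(1) assms] by blast
qed

lemma independent_card_le_dim:
  assumes "finite V" "B \<subseteq> ratfun.span V" "\<not> ratfun.dependent B"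
  shows "finite B" "card B \<le> ratfun.dim V"
proof -
  obtain C where C: "finite C" "V \<subseteq> ratfun.span C" "card C = ratfun.dim V"
    by (rule finite_basis[OF assms(1)])
  have "B \<subseteq> ratfun.span C"
    by (rule subset_trans[OF assms(2) ratfun.span_mono[OF C(2), unfolded ratfun.span_span]])
  then have "finite B \<and> card B \<le> card C"
    using ratfun.independent_span_bound[OF C(1) assms(3)] by blast
  then show "finite B" "card B \<le> ratfun.dim V" using C(3) by auto
qed

lemma qrank_mono:
  assumes "finite T" "S \<subseteq> T"
  shows "qrank S \<le> qrank T"
proof -
  have fin: "finite (rat_vec ` S)" using assms finite_subset by blast
  obtain B where B: "B \<subseteq> rat_vec ` S" "\<not> ratfun.dependent B" "card B = ratfun.dim (rat_vec ` S)"
    by (rule finite_basis[OF fin])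
  have "B \<subseteq> rat_vec ` T" using B(1) assms(2) by auto
  then have "B \<subseteq> ratfun.span (rat_vec ` T)"
    using ratfun.span_superset by (rule subset_trans)
  from independent_card_le_dim(2)[OF _ this B(2)] show ?thesis
    using B(3) assms(1) by (simp add: qrank_def)
qed

text \<open>Otherwise a basis chosen from \<open>S\<close> could be enlarged by an element of
  \<open>T\<close>, against the comparison of ranks. Applied to nested sets of characters, for
  layers and for strata alike.\<close>

lemma subset_qspan_of_qrank_eq:
  assumes "finite T" "S \<subseteq> T" "qrank T \<le> qrank S"
  shows "T \<subseteq> qspan S"
proof
  fix x assume x: "x \<in> T"
  have fin: "finite (rat_vec ` S)" using assms finite_subset by blast
  obtain B where B: "B \<subseteq> rat_vec ` S" "finite B" "\<not> ratfun.dependent B"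
      "rat_vec ` S \<subseteq> ratfun.span B" "card B = ratfun.dim (rat_vec ` S)"
    by (rule finite_basis[OF fin])
  have "rat_vec x \<in> ratfun.span B"
  proof (rule ccontr)
    assume nin: "rat_vec x \<notin> ratfun.span B"
    have ind: "\<not> ratfun.dependent (insert (rat_vec x) B)"
      by (rule ratfun.independent_insertI[OF nin B(3)])
    have "insert (rat_vec x) B \<subseteq> rat_vec ` T" using x B(1) assms(2) by auto
    then have "insert (rat_vec x) B \<subseteq> ratfun.span (rat_vec ` T)"
      using ratfun.span_superset by (rule subset_trans)
    from independent_card_le_dim(2)[OF _ this ind] have "card (insert (rat_vec x) B) \<le> qrank T"
      using assms(1) by (simp add: qrank_def)
    moreover have "rat_vec x \<notin> B" using nin ratfun.span_superset by blast
    ultimately show False using B(2,5) assms(3) by (simp add: qrank_def)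
  qed
  then show "x \<in> qspan S"
    using ratfun.span_mono[OF B(1)] by (auto simp: qspan_def)
qed

lemma supported_in_span_units:
  fixes f :: "nat \<Rightarrow> rat"
  assumes "\<And>j. m \<le> j \<Longrightarrow> f j = 0"
  shows "f = (\<Sum>i<m. (\<lambda>j. f i * unit_vec i j))"
proof
  fix j
  have "(\<Sum>i<m. f i * unit_vec i j) = (\<Sum>i<m. if i = j then f j else 0)"
    by (intro sum.cong) (auto simp: unit_vec_def)
  also have "\<dots> = f j" using assms[of j] by (cases "j < m") auto
  finally show "f j = (\<Sum>i<m. (\<lambda>j. f i * unit_vec i j)) j" by (simp add: sum_fun_apply)
qed

lemma qrank_le_support:
  assumes "\<And>v j. v \<in> S \<Longrightarrow> m \<le> j \<Longrightarrow> v j = 0"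
  shows "qrank S \<le> m"
proof -
  have "rat_vec ` S \<subseteq> ratfun.span (unit_vec ` {..<m})"
  proof
    fix f assume "f \<in> rat_vec ` S"
    then have "f = (\<Sum>i<m. (\<lambda>j. f i * unit_vec i j))"
      using assms by (intro supported_in_span_units) (auto simp: rat_vec_def)
    also have "\<dots> \<in> ratfun.span (unit_vec ` {..<m})"
      by (intro ratfun.span_sum ratfun.span_scale ratfun.span_base) auto
    finally show "f \<in> ratfun.span (unit_vec ` {..<m})" .
  qed
  then have "qrank S \<le> card (unit_vec ` {..<m} :: (nat \<Rightarrow> rat) set)"
    unfolding qrank_def by (rule ratfun.dim_le_card) simp
  also have "\<dots> \<le> m" using card_image_le[of "{..<m}" unit_vec] by simp
  finally show ?thesis .
qed

lemma inj_unit_vec: "inj (unit_vec :: nat \<Rightarrow> nat \<Rightarrow> 'a::zero_neq_one)"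
  by (auto simp: inj_def unit_vec_def fun_eq_iff split: if_splits)

lemma le_qrank_of_units:
  assumes "finite S" "\<And>i. i < m \<Longrightarrow> unit_vec i \<in> qspan S"
  shows "m \<le> qrank S"
proof -
  let ?U = "unit_vec ` {..<m} :: (nat \<Rightarrow> rat) set"
  have "\<not> ratfun.dependent ?U"
    unfolding ratfun.dependent_def
  proof safe
    fix i assume i: "unit_vec i \<in> ratfun.span (?U - {unit_vec i})"
    have "ratfun.subspace {f :: nat \<Rightarrow> rat. f i = 0}" by (auto simp: ratfun.subspace_def)
    moreover have "?U - {unit_vec i} \<subseteq> {f. f i = 0}" by (auto simp: unit_vec_def)
    ultimately have "ratfun.span (?U - {unit_vec i}) \<subseteq> {f. f i = 0}" by (intro ratfun.span_minimal)
    with i show False by (auto simp: unit_vec_def)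
  qed
  moreover have "?U \<subseteq> ratfun.span (rat_vec ` S)"
    using assms(2) by (auto simp: qspan_def rat_vec_unit_vec)
  ultimately have "card ?U \<le> qrank S"
    using independent_card_le_dim(2) assms(1) by (simp add: qrank_def)
  moreover have "card ?U = m" by (simp add: card_image inj_on_subset[OF inj_unit_vec])
  ultimately show ?thesis by simp
qed

lemma common_denominator:
  fixes w :: "nat \<Rightarrow> rat"
  shows "\<exists>k::int. k > 0 \<and> (\<forall>j<d. \<exists>a::int. of_int k * w j = of_int a)"
proof (induction d)
  case (Suc d)
  then obtain k :: int where k: "k > 0" "\<And>j. j < d \<Longrightarrow> \<exists>a::int. of_int k * w j = of_int a" by blast
  obtain p q where pq: "quotient_of (w d) = (p, q)" by fastforce
  have q: "q > 0" "w d = of_int p / of_int q"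
    using quotient_of_denom_pos[OF pq] quotient_of_div[OF pq] by auto
  have "\<exists>a::int. of_int (k * q) * w j = of_int a" if "j < Suc d" for j
  proof (cases "j = d")
    case True
    then have "of_int (k * q) * w j = of_int (k * p)" using q by simp
    then show ?thesis by blast
  next
    case False
    then have "j < d" using that by simp
    then obtain a where "of_int k * w j = of_int a" using k(2)[of j] by auto
    then have "of_int (k * q) * w j = of_int (q * a)" by (simp add: mult_ac)
    then show ?thesis by blast
  qed
  then show ?case using k(1) q(1) by (intro exI[of _ "k * q"]) auto
qed (auto intro: exI[of _ 1])

text \<open>Extend a basis of the rational span of \<open>S\<close> by \<open>x\<close> and take a
  linear form with value 1 at \<open>x\<close> and 0 on that basis; then clear the denominators of
  its values at the first \<open>d\<close> unit vectors.\<close>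

lemma separating_covector:
  assumes S: "\<And>v j. v \<in> S \<Longrightarrow> d \<le> j \<Longrightarrow> v j = 0" and x: "\<And>j. d \<le> j \<Longrightarrow> x j = 0"
    and nin: "x \<notin> qspan S"
  obtains w :: "nat \<Rightarrow> int" where "\<forall>v\<in>S. dot d v w = 0" "dot d x w \<noteq> 0"
proof -
  obtain B where B: "B \<subseteq> rat_vec ` S" "\<not> ratfun.dependent B" "rat_vec ` S \<subseteq> ratfun.span B"
    using ratfun.maximal_independent_subset by blast
  have nin': "rat_vec x \<notin> ratfun.span B"
    using nin ratfun.span_mono[OF B(1)] by (auto simp: qspan_def)
  have "\<not> ratfun.dependent (insert (rat_vec x) B)"
    by (rule ratfun.independent_insertI[OF nin' B(2)])
  from vector_space_pair.linear_independent_extend[OF vector_space_pair.intro[OF vector_space_ratfun vector_space_rat] this, of "\<lambda>b. if b = rat_vec x then 1 else 0"]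
  obtain g where g: "Vector_Spaces.linear (\<lambda>(c::rat) (f::nat \<Rightarrow> rat) j. c * f j) (*) g"
    and gB: "\<And>b. b \<in> insert (rat_vec x) B \<Longrightarrow> g b = (if b = rat_vec x then 1 else 0)" by blast
  interpret g: Vector_Spaces.linear "\<lambda>(c::rat) (f::nat \<Rightarrow> rat) j. c * f j" "(*)" g by (rule g)
  have gx: "g (rat_vec x) = 1" using gB by simp
  have "rat_vec x \<notin> B" using nin' ratfun.span_superset by blast
  then have "B \<subseteq> {f. g f = 0}" using gB by auto
  moreover have "ratfun.subspace {f. g f = 0}"
    by (auto simp: ratfun.subspace_def g.zero g.add g.scale)
  ultimately have "ratfun.span B \<subseteq> {f. g f = 0}" by (intro ratfun.span_minimal)
  then have gS: "g (rat_vec v) = 0" if "v \<in> S" for v using B(3) that by blast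
  obtain k :: int where k: "k > 0" "\<forall>j<d. \<exists>a::int. of_int k * g (unit_vec j) = of_int a"
    using common_denominator[of d "\<lambda>j. g (unit_vec j)"] by blast
  then have "\<forall>j. \<exists>a::int. j < d \<longrightarrow> of_int k * g (unit_vec j) = of_int a" by blast
  from choice[OF this] obtain w :: "nat \<Rightarrow> int" where
    w: "\<And>j. j < d \<Longrightarrow> of_int (w j) = of_int k * g (unit_vec j)" by auto
  have dot: "rat_of_int (dot d v w) = of_int k * g (rat_vec v)" if "\<And>j. d \<le> j \<Longrightarrow> v j = 0" for v
  proof -
    have "rat_vec v = (\<Sum>i<d. (\<lambda>j. rat_vec v i * unit_vec i j))"
      using that by (intro supported_in_span_units) (simp add: rat_vec_def)
    then have "g (rat_vec v) = g (\<Sum>i<d. (\<lambda>j. rat_vec v i * unit_vec i j))" by simp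
    also have "\<dots> = (\<Sum>i<d. rat_vec v i * g (unit_vec i))" by (simp add: g.sum g.scale)
    finally show ?thesis
      by (simp add: dot_def w rat_vec_def sum_distrib_left mult_ac)
  qed
  show thesis
  proof
    show "\<forall>v\<in>S. dot d v w = 0"
    proof
      fix v assume "v \<in> S"
      then have "rat_of_int (dot d v w) = 0" using dot[of v] gS S by simp
      then show "dot d v w = 0" by simp
    qed
    have "rat_of_int (dot d x w) \<noteq> 0" using dot[of x] gx x k(1) by simp
    then show "dot d x w \<noteq> 0" by simp
  qed
qed

lemma dot_eq_0_of_qspan:
  fixes w :: "nat \<Rightarrow> 'a::field_char_0"
  assumes "x \<in> qspan S" "\<And>v. v \<in> S \<Longrightarrow> dot d v w = 0"
  shows "dot d x w = 0"
proof -
  let ?P = "{f. (\<Sum>j<d. of_rat (f j) * w j) = 0}"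
  have "ratfun.subspace ?P"
    by (auto simp: ratfun.subspace_def of_rat_add of_rat_mult distrib_right sum.distrib mult.assoc
        simp flip: sum_distrib_left)
  moreover have "rat_vec ` S \<subseteq> ?P" using assms(2) by (auto simp: dot_def rat_vec_def)
  ultimately have "ratfun.span (rat_vec ` S) \<subseteq> ?P" by (intro ratfun.span_minimal)
  then show ?thesis using assms(1) by (auto simp: qspan_def dot_def rat_vec_def)
qed

text \<open>The vectors that admit such a denominator form a rational subspace containing
  \<open>S\<close>: for a sum the denominators are multiplied, and a scalar contributes its own.
  What matters is that \<open>n\<close> does not depend on \<open>w\<close>.\<close>

lemma multiple_dot_in_Ints_of_qspan:
  assumes "x \<in> qspan S"
  obtains n :: nat where "n > 0"
    "\<forall>w :: nat \<Rightarrow> complex. (\<forall>v\<in>S. dot d v w \<in> \<int>) \<longrightarrow> of_nat n * dot d x w \<in> \<int>"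
proof -
  define Q where "Q f n \<longleftrightarrow> (\<forall>w :: nat \<Rightarrow> complex. (\<forall>v\<in>S. dot d v w \<in> \<int>) \<longrightarrow>
     of_nat n * (\<Sum>j<d. of_rat (f j) * w j) \<in> \<int>)" for f :: "nat \<Rightarrow> rat" and n :: nat
  let ?P = "{f. \<exists>n>0. Q f n}"
  have "ratfun.subspace ?P"
    unfolding ratfun.subspace_def
  proof (intro conjI ballI allI)
    show "0 \<in> ?P" by (auto simp: Q_def intro: exI[of _ 1])
    fix f assume "f \<in> ?P"
    then obtain n where n: "n > 0" "Q f n" by (elim CollectE exE conjE) (rule that)
    show "f + f' \<in> ?P" if "f' \<in> ?P" for f'
    proof -
      from that obtain m where m: "m > 0" "Q f' m" by (elim CollectE exE conjE) simp
      have "Q (f + f') (n * m)"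
        unfolding Q_def
      proof (intro allI impI)
        fix w :: "nat \<Rightarrow> complex" assume "\<forall>v\<in>S. dot d v w \<in> \<int>"
        then have A: "of_nat n * (\<Sum>j<d. of_rat (f j) * w j) \<in> \<int>"
          and B: "of_nat m * (\<Sum>j<d. of_rat (f' j) * w j) \<in> \<int>"
          using n(2) m(2) unfolding Q_def by blast+
        have "of_nat m * (of_nat n * (\<Sum>j<d. of_rat (f j) * w j)) +
            of_nat n * (of_nat m * (\<Sum>j<d. of_rat (f' j) * w j)) \<in> \<int>"
          by (rule Ints_add[OF Ints_mult[OF Ints_of_nat A] Ints_mult[OF Ints_of_nat B]])
        also have "of_nat m * (of_nat n * (\<Sum>j<d. of_rat (f j) * w j)) +
            of_nat n * (of_nat m * (\<Sum>j<d. of_rat (f' j) * w j))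
            = of_nat (n * m) * (\<Sum>j<d. of_rat ((f + f') j) * w j)"
          by (simp add: of_rat_add distrib_right sum.distrib distrib_left mult_ac)
        finally show "of_nat (n * m) * (\<Sum>j<d. of_rat ((f + f') j) * w j) \<in> \<int>" .
      qed
      then show ?thesis using n(1) m(1) by (intro CollectI exI[of _ "n * m"]) simp
    qed
    show "(\<lambda>j. c * f j) \<in> ?P" for c
    proof -
      obtain p q where pq: "quotient_of c = (p, q)" by fastforce
      have q: "q > 0" "c = of_int p / of_int q"
        using quotient_of_denom_pos[OF pq] quotient_of_div[OF pq] by auto
      have qn: "complex_of_int q = of_nat (nat q)" using q(1) by simp
      have "Q (\<lambda>j. c * f j) (n * nat q)"
        unfolding Q_def
      proof (intro allI impI)
        fix w :: "nat \<Rightarrow> complex" assume "\<forall>v\<in>S. dot d v w \<in> \<int>"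
        then have A: "of_nat n * (\<Sum>j<d. of_rat (f j) * w j) \<in> \<int>" using n(2) unfolding Q_def by blast
        have "of_int p * (of_nat n * (\<Sum>j<d. of_rat (f j) * w j)) \<in> \<int>" by (rule Ints_mult[OF Ints_of_int A])
        also have "of_int p * (of_nat n * (\<Sum>j<d. of_rat (f j) * w j))
            = of_nat (n * nat q) * (of_rat c * (\<Sum>j<d. of_rat (f j) * w j))"
          using q(1) unfolding q(2) by (simp add: of_rat_divide flip: qn)
        also have "of_rat c * (\<Sum>j<d. of_rat (f j) * w j) = (\<Sum>j<d. of_rat (c * f j) * w j)"
          by (simp add: sum_distrib_left of_rat_mult mult.assoc)
        finally show "of_nat (n * nat q) * (\<Sum>j<d. of_rat (c * f j) * w j) \<in> \<int>" .
      qed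
      then show ?thesis using n(1) q(1) by (intro CollectI exI[of _ "n * nat q"]) simp
    qed
  qed
  moreover have "rat_vec ` S \<subseteq> ?P"
    by (auto simp: Q_def rat_vec_def dot_def intro!: exI[of _ 1])
  ultimately have "ratfun.span (rat_vec ` S) \<subseteq> ?P" by (intro ratfun.span_minimal)
  then obtain n where "n > 0" "Q (rat_vec x) n" using assms by (auto simp: qspan_def)
  then show thesis using that[of n] by (simp add: Q_def dot_def rat_vec_def)
qed

text \<open>An enumeration of a basis chosen from \<open>S\<close>. The order matters for the chain
  of layers, where each new member has to cut the preceding layer down strictly.\<close>

lemma independent_sequence:
  assumes "finite S"
  obtains b :: "nat \<Rightarrow> nat \<Rightarrow> int" where "\<forall>i<qrank S. b i \<in> S" "\<forall>i<qrank S. b i \<notin> qspan (b ` {..<i})"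
proof -
  have fin: "finite (rat_vec ` S)" using assms by simp
  obtain B where B: "B \<subseteq> rat_vec ` S" "finite B" "\<not> ratfun.dependent B" "card B = qrank S"
    by (rule finite_basis[OF fin]) (simp add: qrank_def)
  obtain h where h: "bij_betw h {..<qrank S} B"
    using ex_bij_betw_nat_finite[OF B(2)] B(4) by (auto simp: atLeast0LessThan)
  have "\<forall>i. \<exists>v. i < qrank S \<longrightarrow> v \<in> S \<and> rat_vec v = h i"
    using bij_betwE[OF h] B(1) by (metis imageE lessThan_iff subsetD)
  from choice[OF this] obtain b where b: "\<And>i. i < qrank S \<Longrightarrow> b i \<in> S \<and> rat_vec (b i) = h i" by blast
  have "b i \<notin> qspan (b ` {..<i})" if "i < qrank S" for i
  proof
    assume "b i \<in> qspan (b ` {..<i})"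
    then have "h i \<in> ratfun.span (rat_vec ` b ` {..<i})" using b that by (simp add: qspan_def)
    moreover have "rat_vec ` b ` {..<i} \<subseteq> B - {h i}"
    proof -
      have "rat_vec (b j) \<in> B - {h i}" if "j < i" for j
        using b[of j] that \<open>i < qrank S\<close> bij_betwE[OF h] bij_betw_imp_inj_on[OF h]
        by (auto simp: inj_on_def)
      then show ?thesis by auto
    qed
    ultimately have "h i \<in> ratfun.span (B - {h i})" using ratfun.span_mono by blast
    moreover have "h i \<in> B" using bij_betwE[OF h] that by blast
    ultimately show False using B(3) unfolding ratfun.dependent_def by blast
  qed
  with b show thesis using that by blast
qed

subsection \<open>Adapted coordinates\<close>

text \<open>An isomorphism from the multiplicative group onto the integer vectors supported below
  \<open>d\<close>. Adapting coordinates means composing \<open>a\<close> with automorphisms, while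
  \<open>G\<close> stays fixed.\<close>

definition coord_system :: "('a, 'b) monoid_scheme \<Rightarrow> nat \<Rightarrow> ('a \<Rightarrow> nat \<Rightarrow> int) \<Rightarrow> bool" where
  "coord_system G d a \<longleftrightarrow>
     (\<forall>\<alpha>\<in>carrier G. \<forall>\<beta>\<in>carrier G. a (\<alpha> \<otimes>\<^bsub>G\<^esub> \<beta>) = (\<lambda>j. a \<alpha> j + a \<beta> j)) \<and>
     bij_betw a (carrier G) {v. \<forall>j\<ge>d. v j = 0}"

lemma coord_system_compose:
  assumes a: "coord_system G d a"
    and add: "\<And>v v'. \<phi> (\<lambda>j. v j + v' j) = (\<lambda>j. \<phi> v j + \<phi> v' j)"
    and bij: "bij_betw \<phi> {v. \<forall>j\<ge>d. v j = 0} {v. \<forall>j\<ge>d. v j = 0}"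
  shows "coord_system G d (\<phi> \<circ> a)"
  unfolding coord_system_def
proof
  show "bij_betw (\<phi> \<circ> a) (carrier G) {v. \<forall>j\<ge>d. v j = 0}"
    using a bij by (auto simp: coord_system_def intro: bij_betw_trans)
qed (use a add in \<open>simp add: coord_system_def\<close>)

lemma exists_coord_system:
  assumes "free_abelian_of_rank G d"
  obtains a where "coord_system G d a"
proof -
  obtain \<phi> where \<phi>: "\<phi> \<in> iso G (free_Abelian_group {..<d})"
    using assms by (auto simp: free_abelian_of_rank_def is_iso_def)
  have mult: "\<phi> (\<alpha> \<otimes>\<^bsub>G\<^esub> \<beta>) = \<phi> \<alpha> + \<phi> \<beta>" if "\<alpha> \<in> carrier G" "\<beta> \<in> carrier G" for \<alpha> \<beta>
    using \<phi> that by (simp add: iso_def hom_def)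
  have "bij_betw \<phi> (carrier G) {c. Poly_Mapping.keys c \<subseteq> {..<d}}"
    using \<phi> by (simp add: iso_def free_Abelian_group_def)
  moreover have "bij_betw Poly_Mapping.lookup {c. Poly_Mapping.keys c \<subseteq> {..<d}} {v :: nat \<Rightarrow> int. \<forall>j\<ge>d. v j = 0}"
  proof (rule bij_betwI[where g = Abs_poly_mapping])
    show "Poly_Mapping.lookup \<in> {c. Poly_Mapping.keys c \<subseteq> {..<d}} \<rightarrow> {v :: nat \<Rightarrow> int. \<forall>j\<ge>d. v j = 0}"
    proof (rule funcsetI, rule CollectI, intro allI impI)
      fix c :: "nat \<Rightarrow>\<^sub>0 int" and j assume "c \<in> {c. Poly_Mapping.keys c \<subseteq> {..<d}}" "d \<le> j"
      then have "j \<notin> Poly_Mapping.keys c" by auto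
      then show "Poly_Mapping.lookup c j = 0" by (simp add: in_keys_iff)
    qed
    have fin: "finite {j. v j \<noteq> 0}" if "\<forall>j\<ge>d. v j = 0" for v :: "nat \<Rightarrow> int"
      by (rule finite_subset[of _ "{..<d}"]) (use that in \<open>auto simp: not_le[symmetric]\<close>)
    show lookup: "Poly_Mapping.lookup (Abs_poly_mapping v) = v" if "v \<in> {v. \<forall>j\<ge>d. v j = 0}" for v :: "nat \<Rightarrow> int"
      using fin[of v] that by (intro Abs_poly_mapping_inverse) simp
    show "Abs_poly_mapping \<in> {v :: nat \<Rightarrow> int. \<forall>j\<ge>d. v j = 0} \<rightarrow> {c. Poly_Mapping.keys c \<subseteq> {..<d}}"
    proof (rule funcsetI, rule CollectI, rule subsetI)
      fix v :: "nat \<Rightarrow> int" and j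
      assume v: "v \<in> {v. \<forall>j\<ge>d. v j = 0}" and "j \<in> Poly_Mapping.keys (Abs_poly_mapping v)"
      then have "v j \<noteq> 0" using lookup[OF v] by (simp add: in_keys_iff)
      then show "j \<in> {..<d}" using v by (auto simp: not_le[symmetric])
    qed
    show "Abs_poly_mapping (Poly_Mapping.lookup c) = c" for c :: "nat \<Rightarrow>\<^sub>0 int"
      by (rule Poly_Mapping.lookup_inverse)
  qed
  ultimately have "bij_betw (Poly_Mapping.lookup \<circ> \<phi>) (carrier G) {v. \<forall>j\<ge>d. v j = 0}"
    by (rule bij_betw_trans)
  then have "coord_system G d (Poly_Mapping.lookup \<circ> \<phi>)"
    unfolding coord_system_def using mult by (auto simp: lookup_add fun_eq_iff)
  then show thesis by (rule that)
qed

text \<open>An elementary operation, undone by the one with \<open>- s\<close>. Its dual is one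
  subtraction step of the Euclidean algorithm on the annihilating vector.\<close>

lemma coord_system_transvection:
  assumes a: "coord_system G d a" and ij: "i \<noteq> j" "i < d" "j < d"
  shows "coord_system G d (\<lambda>\<alpha>. (a \<alpha>)(j := a \<alpha> j + s * a \<alpha> i))"
proof -
  let ?\<phi> = "\<lambda>s v :: nat \<Rightarrow> int. v(j := v j + s * v i)"
  have "bij_betw (?\<phi> s) {v. \<forall>j\<ge>d. v j = 0} {v. \<forall>j\<ge>d. v j = 0}"
    by (rule bij_betwI[where g = "?\<phi> (- s)"]) (use ij in auto)
  moreover have "?\<phi> s (\<lambda>j. v j + v' j) = (\<lambda>j. ?\<phi> s v j + ?\<phi> s v' j)" for v v'
    by (auto simp: algebra_simps)
  ultimately have "coord_system G d (?\<phi> s \<circ> a)" by (intro coord_system_compose[OF a])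
  then show ?thesis by (simp add: comp_def)
qed

lemma coord_system_permute:
  assumes a: "coord_system G d a" and ij: "i < d" "j < d"
  shows "coord_system G d (\<lambda>\<alpha> k. a \<alpha> (Transposition.transpose i j k))"
proof -
  let ?\<phi> = "\<lambda>(v :: nat \<Rightarrow> int) k. v (Transposition.transpose i j k)"
  have "Transposition.transpose i j k = k" if "d \<le> k" for k
    using that ij by (auto simp: Transposition.transpose_def)
  then have "bij_betw ?\<phi> {v. \<forall>j\<ge>d. v j = 0} {v. \<forall>j\<ge>d. v j = 0}"
    by (intro bij_betwI[where g = ?\<phi>]) auto
  from coord_system_compose[OF a _ this] have "coord_system G d (?\<phi> \<circ> a)" by simp
  then show ?thesis by (simp add: comp_def)
qed

text \<open>
  If the rank is smaller than the number \<open>e\<close> of coordinates in use, some nonzero integer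
  vector \<open>w\<close> annihilates \<open>X\<close>. The Euclidean algorithm reduces \<open>w\<close> to a single nonzero entry,
  and then the corresponding coordinate vanishes on \<open>X\<close>.
\<close>

lemma exists_adapted_coord_system:
  assumes a0: "coord_system G d a0" and X: "finite X" "X \<subseteq> carrier G"
  obtains a e where "coord_system G d a" "e \<le> d" "\<And>\<alpha> j. \<alpha> \<in> X \<Longrightarrow> e \<le> j \<Longrightarrow> a \<alpha> j = 0"
    "qrank (a ` X) = e"
proof -
  \<comment> \<open>\<open>P e\<close> says that in some coordinates the characters use only the
    first \<open>e\<close> entries; the least such \<open>e\<close> will turn out to be the
    rank.\<close>
  define P where "P e \<longleftrightarrow> (\<exists>a. coord_system G d a \<and> (\<forall>\<alpha>\<in>X. \<forall>j\<ge>e. a \<alpha> j = 0))" for e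
  have "P d"
    unfolding P_def
  proof (intro exI conjI ballI)
    fix \<alpha> assume "\<alpha> \<in> X"
    then have "a0 \<alpha> \<in> {v. \<forall>j\<ge>d. v j = 0}"
      using X a0 unfolding coord_system_def by (meson bij_betwE subsetD)
    then show "\<forall>j\<ge>d. a0 \<alpha> j = 0" by simp
  qed (rule a0)
  define e where "e = (LEAST e. P e)"
  have e: "P e" "e \<le> d" unfolding e_def using \<open>P d\<close> by (auto intro: LeastI Least_le)
  have least: "\<not> P m" if "m < e" for m using that not_less_Least unfolding e_def by blast
  from e(1) obtain a where a: "coord_system G d a" and supp: "\<And>\<alpha> j. \<alpha> \<in> X \<Longrightarrow> e \<le> j \<Longrightarrow> a \<alpha> j = 0"
    unfolding P_def by blast
  have "qrank (a ` X) = e"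
  proof (rule ccontr)
    assume neq: "qrank (a ` X) \<noteq> e"
    have "qrank (a ` X) \<le> e" by (rule qrank_le_support) (use supp in auto)
    \<comment> \<open>A rank below \<open>e\<close> leaves some unit vector outside the span, and a
      covector that separates it from the characters is the nonzero vector to be reduced.\<close>
    with neq have "\<not> e \<le> qrank (a ` X)" by simp
    then obtain j0 where j0: "j0 < e" "unit_vec j0 \<notin> qspan (a ` X)"
      using le_qrank_of_units[of "a ` X" e] X(1) by blast
    have "\<And>v j. v \<in> a ` X \<Longrightarrow> e \<le> j \<Longrightarrow> v j = 0" using supp by auto
    moreover have "\<And>j. e \<le> j \<Longrightarrow> unit_vec j0 j = (0::int)" using j0(1) by (auto simp: unit_vec_def)
    ultimately obtain w :: "nat \<Rightarrow> int" where w: "\<forall>v\<in>a ` X. dot e v w = 0" "dot e (unit_vec j0) w \<noteq> 0"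
      by (rule separating_covector[OF _ _ j0(2)])
    \<comment> \<open>The measure of the Euclidean algorithm, minimised over all coordinate systems
      and annihilating vectors simultaneously.\<close>
    define Q where "Q m \<longleftrightarrow> (\<exists>a w. coord_system G d a \<and> (\<forall>\<alpha>\<in>X. \<forall>j\<ge>e. a \<alpha> j = 0) \<and>
        (\<forall>\<alpha>\<in>X. dot e (a \<alpha>) w = 0) \<and> (\<exists>j<e. w j \<noteq> 0) \<and> m = (\<Sum>j<e. nat \<bar>w j\<bar>))" for m
    have "\<exists>j<e. w j \<noteq> 0"
    proof (rule ccontr)
      assume "\<not> ?thesis"
      then have "dot e (unit_vec j0) w = 0" by (simp add: dot_def)
      with w(2) show False by simp
    qed
    then have "Q (\<Sum>j<e. nat \<bar>w j\<bar>)" unfolding Q_def using a supp w(1) by blast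
    define m where "m = (LEAST m. Q m)"
    have Qm: "Q m" unfolding m_def by (rule LeastI) fact
    have leastQ: "m \<le> m'" if "Q m'" for m' unfolding m_def using that by (rule Least_le)
    from Qm obtain a w where a: "coord_system G d a" and supp: "\<And>\<alpha> j. \<alpha> \<in> X \<Longrightarrow> e \<le> j \<Longrightarrow> a \<alpha> j = 0"
      and w: "\<And>\<alpha>. \<alpha> \<in> X \<Longrightarrow> dot e (a \<alpha>) w = 0" and wn: "\<exists>j<e. w j \<noteq> 0" and m: "m = (\<Sum>j<e. nat \<bar>w j\<bar>)"
      unfolding Q_def by blast
    obtain i where i: "i < e" "w i \<noteq> 0" using wn by blast
    show False
    proof (cases "\<exists>j<e. j \<noteq> i \<and> w j \<noteq> 0")
      case False
      have "a \<alpha> i = 0" if "\<alpha> \<in> X" for \<alpha>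
      proof -
        have "dot e (a \<alpha>) w = (\<Sum>j<e. if j = i then a \<alpha> i * w i else 0)"
          unfolding dot_def using False by (intro sum.cong) auto
        then show ?thesis using w[OF that] i by simp
      qed
      \<comment> \<open>Transposing \<open>i\<close> with the last used coordinate
        \<open>e - 1\<close> empties the latter, against the minimality of \<open>e\<close>.\<close>
      then have "\<forall>\<alpha>\<in>X. \<forall>j\<ge>e - 1. a \<alpha> (Transposition.transpose i (e - 1) j) = 0"
        using i supp by (auto simp: Transposition.transpose_def)
      moreover have "coord_system G d (\<lambda>\<alpha> j. a \<alpha> (Transposition.transpose i (e - 1) j))"
        using i e(2) by (intro coord_system_permute[OF a]) auto
      ultimately have "P (e - 1)" unfolding P_def by blast
      then show False using least[of "e - 1"] i by simp
    next
      case True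
      then obtain i j where ij: "i < e" "j < e" "i \<noteq> j" "w j \<noteq> 0" "\<bar>w j\<bar> \<le> \<bar>w i\<bar>"
        using i by (metis nle_le)
      \<comment> \<open>With this sign \<open>w i - s * w j\<close> has absolute value
        \<open>\<bar>w i\<bar> - \<bar>w j\<bar>\<close>. The changes of \<open>w\<close> at
        \<open>i\<close> and of \<open>a\<close> at \<open>j\<close> are dual, so \<open>dot\<close>
        is preserved.\<close>
      define s where "s = sgn (w i) * sgn (w j)"
      define w' where "w' = w(i := w i - s * w j)"
      define a' where "a' \<alpha> = (a \<alpha>)(j := a \<alpha> j + s * a \<alpha> i)" for \<alpha>
      have split: "(\<Sum>k<e. f k) = f i + f j + (\<Sum>k\<in>{..<e} - {i, j}. f k)" for f :: "nat \<Rightarrow> 'x::comm_monoid_add"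
      proof -
        have "{..<e} = insert i (insert j ({..<e} - {i, j}))" using ij by auto
        then have "(\<Sum>k<e. f k) = (\<Sum>k\<in>insert i (insert j ({..<e} - {i, j})). f k)" by simp
        then show ?thesis using ij by (simp add: add.assoc)
      qed
      have "\<bar>w' i\<bar> = \<bar>w i\<bar> - \<bar>w j\<bar>"
        using ij by (simp add: w'_def s_def sgn_if abs_if split: if_splits)
      then have small: "\<bar>w' i\<bar> < \<bar>w i\<bar>" using ij(4) by simp
      have "Q (\<Sum>k<e. nat \<bar>w' k\<bar>)"
        unfolding Q_def
      proof (rule exI[of _ a'], rule exI[of _ w'], intro conjI ballI)
        show "coord_system G d a'"
          unfolding a'_def by (rule coord_system_transvection[OF a]) (use ij e(2) in auto)
        show "\<forall>j\<ge>e. a' \<alpha> j = 0" if "\<alpha> \<in> X" for \<alpha> using supp[OF that] ij by (auto simp: a'_def)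
        show "dot e (a' \<alpha>) w' = 0" if "\<alpha> \<in> X" for \<alpha>
        proof -
          have "dot e (a' \<alpha>) w' = dot e (a \<alpha>) w"
            unfolding dot_def split using ij(3)
            by (auto simp: a'_def w'_def algebra_simps intro!: sum.cong)
          then show ?thesis using w[OF that] by simp
        qed
        show "\<exists>j<e. w' j \<noteq> 0" using ij by (auto simp: w'_def intro!: exI[of _ j])
      qed (rule refl)
      moreover have "(\<Sum>k<e. nat \<bar>w' k\<bar>) < m"
      proof -
        have "(\<Sum>k\<in>{..<e} - {i, j}. nat \<bar>w' k\<bar>) = (\<Sum>k\<in>{..<e} - {i, j}. nat \<bar>w k\<bar>)"
          by (intro sum.cong) (auto simp: w'_def)
        moreover have "nat \<bar>w' i\<bar> < nat \<bar>w i\<bar>" "w' j = w j" using small ij by (auto simp: w'_def)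
        ultimately show ?thesis unfolding m split by simp
      qed
      ultimately show False using leastQ by fastforce
    qed
  qed
  with a supp e(2) show thesis using that by blast
qed

text \<open>A homomorphism on integer vectors is determined by its values on the unit vectors.
  Multiplicativity is asked only on vectors supported below \<open>d\<close>, the image of a
  coordinate system.\<close>

lemma multiplicative_eq_laurent:
  fixes \<tau> :: "(nat \<Rightarrow> int) \<Rightarrow> complex"
  assumes mult: "\<And>v v'. \<forall>j\<ge>d. v j = 0 \<Longrightarrow> \<forall>j\<ge>d. v' j = 0 \<Longrightarrow> \<tau> (\<lambda>j. v j + v' j) = \<tau> v * \<tau> v'"
    and nz: "\<And>v. \<forall>j\<ge>d. v j = 0 \<Longrightarrow> \<tau> v \<noteq> 0"
    and v: "\<forall>j\<ge>d. v j = 0"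
  shows "\<tau> v = laurent d v (\<lambda>j. \<tau> (unit_vec j))"
proof -
  have \<tau>0: "\<tau> (\<lambda>_. 0) = 1" using mult[of "\<lambda>_. 0" "\<lambda>_. 0"] nz[of "\<lambda>_. 0"] by simp
  have pow: "\<tau> (\<lambda>i. n * unit_vec j i) = \<tau> (unit_vec j) powi n" if j: "j < d" for j and n :: int
  proof -
    have u: "\<forall>i\<ge>d. n * unit_vec j i = 0" for n :: int using j by (simp add: unit_vec_def)
    have nat: "\<tau> (\<lambda>i. int m * unit_vec j i) = \<tau> (unit_vec j) ^ m" for m
    proof (induction m)
      case (Suc m)
      have "\<tau> (\<lambda>i. int (Suc m) * unit_vec j i) = \<tau> (\<lambda>i. int m * unit_vec j i + 1 * unit_vec j i)"
        by (simp add: algebra_simps)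
      also have "\<dots> = \<tau> (\<lambda>i. int m * unit_vec j i) * \<tau> (\<lambda>i. 1 * unit_vec j i)"
        by (rule mult[OF u u])
      finally show ?case using Suc by (simp add: mult.commute)
    qed (simp add: \<tau>0)
    show ?thesis
    proof (cases "n \<ge> 0")
      case True
      then show ?thesis using nat[of "nat n"] by (simp add: power_int_def)
    next
      case False
      have "\<tau> (\<lambda>i. n * unit_vec j i) * \<tau> (\<lambda>i. - n * unit_vec j i)
          = \<tau> (\<lambda>i. n * unit_vec j i + - n * unit_vec j i)"
        by (rule mult[OF u u, symmetric])
      then have "\<tau> (\<lambda>i. n * unit_vec j i) * \<tau> (\<lambda>i. - n * unit_vec j i) = 1" by (simp add: \<tau>0)
      moreover have "\<tau> (\<lambda>i. - n * unit_vec j i) = \<tau> (unit_vec j) ^ nat (- n)"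
        using nat[of "nat (- n)"] False by simp
      ultimately have "\<tau> (\<lambda>i. n * unit_vec j i) * \<tau> (unit_vec j) ^ nat (- n) = 1" by simp
      then have "\<tau> (\<lambda>i. n * unit_vec j i) = inverse (\<tau> (unit_vec j) ^ nat (- n))"
        by (metis inverse_unique mult.commute)
      then show ?thesis using False by (simp add: power_int_def power_inverse)
    qed
  qed
  \<comment> \<open>Induction on the length of the support, splitting off the last
    coordinate.\<close>
  have "k \<le> d \<Longrightarrow> \<forall>j\<ge>k. v j = 0 \<Longrightarrow> \<tau> v = laurent k v (\<lambda>j. \<tau> (unit_vec j))" for k v
  proof (induction k arbitrary: v)
    case 0
    then have "v = (\<lambda>_. 0)" by auto
    then show ?case by (simp add: \<tau>0 laurent_def)
  next
    case (Suc k)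
    define v' where "v' = v(k := 0)"
    have v': "\<forall>j\<ge>k. v' j = 0"
    proof (intro allI impI)
      fix j assume "k \<le> j"
      then show "v' j = 0" using Suc.prems(2) by (cases "j = k") (auto simp: v'_def)
    qed
    have "\<tau> v = \<tau> (\<lambda>j. v' j + v k * unit_vec k j)"
      by (rule arg_cong[where f = \<tau>]) (auto simp: v'_def unit_vec_def)
    also have "\<dots> = \<tau> v' * \<tau> (\<lambda>j. v k * unit_vec k j)"
      using v' Suc.prems(1) by (intro mult) (auto simp: unit_vec_def)
    also have "\<tau> v' = laurent k v' (\<lambda>j. \<tau> (unit_vec j))"
      using Suc.IH[OF _ v'] Suc.prems(1) by simp
    also have "\<dots> = laurent k v (\<lambda>j. \<tau> (unit_vec j))"
      unfolding laurent_def by (intro prod.cong) (auto simp: v'_def)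
    also have "\<tau> (\<lambda>j. v k * unit_vec k j) = \<tau> (unit_vec k) powi v k"
      using Suc.prems(1) by (intro pow) simp
    finally show ?case by (simp add: laurent_def)
  qed
  from this[OF order_refl v] show ?thesis .
qed

section \<open>The torus of the group and its coordinate model\<close>

definition to_coord :: "('a, 'b) monoid_scheme \<Rightarrow> nat \<Rightarrow> ('a \<Rightarrow> nat \<Rightarrow> int) \<Rightarrow> ('a \<Rightarrow> complex) \<Rightarrow> nat \<Rightarrow> complex" where
  "to_coord G d a t = (\<lambda>j. if j < d then t (inv_into (carrier G) a (unit_vec j)) else 1)"

definition from_coord :: "('a, 'b) monoid_scheme \<Rightarrow> nat \<Rightarrow> ('a \<Rightarrow> nat \<Rightarrow> int) \<Rightarrow> (nat \<Rightarrow> complex) \<Rightarrow> 'a \<Rightarrow> complex" where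
  "from_coord G d a z = (\<lambda>\<alpha>\<in>carrier G. laurent d (a \<alpha>) z)"

lemma laurent_unit_vec: "j < d \<Longrightarrow> laurent d (unit_vec j) z = z j"
proof -
  assume j: "j < d"
  have "laurent d (unit_vec j) z = (\<Prod>i<d. if i = j then z j else 1)"
    unfolding laurent_def by (intro prod.cong) (auto simp: unit_vec_def)
  then show ?thesis using j by simp
qed

locale coordinates =
  fixes G :: "('a, 'b) monoid_scheme" (structure) and d :: nat and a :: "'a \<Rightarrow> nat \<Rightarrow> int"
  assumes group_G: "group G" and coord_system: "coord_system G d a"
begin

lemma coord_mult: "\<alpha> \<in> carrier G \<Longrightarrow> \<beta> \<in> carrier G \<Longrightarrow> a (\<alpha> \<otimes> \<beta>) = (\<lambda>j. a \<alpha> j + a \<beta> j)"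
  and coord_bij: "bij_betw a (carrier G) {v. \<forall>j\<ge>d. v j = 0}"
  using coord_system by (auto simp: coord_system_def)

lemma coord_support: "\<alpha> \<in> carrier G \<Longrightarrow> d \<le> j \<Longrightarrow> a \<alpha> j = 0"
  using bij_betwE[OF coord_bij] by blast

lemma torus_eq_laurent:
  assumes t: "t \<in> torus G"
  shows "to_coord G d a t \<in> coord_torus d"
    and "\<alpha> \<in> carrier G \<Longrightarrow> t \<alpha> = laurent d (a \<alpha>) (to_coord G d a t)"
proof -
  let ?b = "inv_into (carrier G) a"
  have b: "?b v \<in> carrier G" "a (?b v) = v" if "\<forall>j\<ge>d. v j = 0" for v
    using that coord_bij bij_betw_inv_into_right[OF coord_bij, of v] bij_betwE[OF bij_betw_inv_into[OF coord_bij]]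
    by auto
  have t': "t (\<alpha> \<otimes> \<beta>) = t \<alpha> * t \<beta>" "t \<alpha> \<noteq> 0" if "\<alpha> \<in> carrier G" "\<beta> \<in> carrier G" for \<alpha> \<beta>
    using t that by (auto simp: torus_def hom_def nonzero_complex_def)
  have mult: "t (?b (\<lambda>j. v j + v' j)) = t (?b v) * t (?b v')" if v: "\<forall>j\<ge>d. v j = 0" "\<forall>j\<ge>d. v' j = 0" for v v'
  proof -
    have "a (?b v \<otimes> ?b v') = (\<lambda>j. v j + v' j)" using coord_mult b v by simp
    moreover have "?b v \<otimes> ?b v' \<in> carrier G" using b(1) v group_G by (simp add: group_def monoid.m_closed)
    ultimately have "?b (\<lambda>j. v j + v' j) = ?b v \<otimes> ?b v'"
      using bij_betw_inv_into_left[OF coord_bij] by metis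
    then show ?thesis using t'(1) b(1) v by simp
  qed
  have nz: "t (?b v) \<noteq> 0" if "\<forall>j\<ge>d. v j = 0" for v using t'(2) b(1)[OF that] by blast
  have u: "\<forall>i\<ge>d. unit_vec j i = (0::int)" if "j < d" for j using that by (simp add: unit_vec_def)
  show "to_coord G d a t \<in> coord_torus d"
    using nz u by (simp add: to_coord_def coord_torus_def)
  show "t \<alpha> = laurent d (a \<alpha>) (to_coord G d a t)" if \<alpha>: "\<alpha> \<in> carrier G"
  proof -
    have "t \<alpha> = t (?b (a \<alpha>))" using bij_betw_inv_into_left[OF coord_bij \<alpha>] by simp
    also have "\<dots> = laurent d (a \<alpha>) (\<lambda>j. t (?b (unit_vec j)))"
    proof (rule multiplicative_eq_laurent[where \<tau> = "\<lambda>v. t (?b v)"])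
      show "\<forall>j\<ge>d. a \<alpha> j = 0" using coord_support[OF \<alpha>] by blast
    qed (fact mult nz)+
    also have "\<dots> = laurent d (a \<alpha>) (to_coord G d a t)"
      unfolding laurent_def by (intro prod.cong) (auto simp: to_coord_def)
    finally show ?thesis .
  qed
qed

lemma from_coord_in_torus:
  assumes z: "z \<in> coord_torus d"
  shows "from_coord G d a z \<in> torus G" "to_coord G d a (from_coord G d a z) = z"
proof -
  have nz: "z j \<noteq> 0" if "j < d" for j using z that by (simp add: coord_torus_def)
  have add: "laurent d (\<lambda>j. v j + v' j) z = laurent d v z * laurent d v' z" for v v'
    unfolding laurent_def by (simp add: power_int_add nz prod.distrib)
  have "laurent d v z \<noteq> 0" for v unfolding laurent_def using nz by simp
  then show "from_coord G d a z \<in> torus G"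
    using add coord_mult group_G
    by (auto simp: torus_def hom_def nonzero_complex_def from_coord_def group_def monoid.m_closed)
  show "to_coord G d a (from_coord G d a z) = z"
  proof
    fix j
    show "to_coord G d a (from_coord G d a z) j = z j"
    proof (cases "j < d")
      case True
      then have u: "unit_vec j \<in> {v :: nat \<Rightarrow> int. \<forall>j\<ge>d. v j = 0}" by (simp add: unit_vec_def)
      have "inv_into (carrier G) a (unit_vec j) \<in> carrier G" "a (inv_into (carrier G) a (unit_vec j)) = unit_vec j"
        using bij_betw_inv_into_right[OF coord_bij u] bij_betwE[OF bij_betw_inv_into[OF coord_bij]] u by auto
      then show ?thesis using True by (simp add: to_coord_def from_coord_def laurent_unit_vec)
    next
      case False
      then show ?thesis using z by (simp add: to_coord_def coord_torus_def)
    qed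
  qed
qed

lemma from_to_coord: "t \<in> torus G \<Longrightarrow> from_coord G d a (to_coord G d a t) = t"
  using torus_eq_laurent(2) unfolding from_coord_def
  by (intro extensionalityI[of _ "carrier G"]) (auto simp: torus_def)

lemma continuous_map_from_coord:
  "continuous_map (top_of_set (coord_torus d)) (torus_topology G) (from_coord G d a)"
  unfolding torus_topology_def continuous_map_in_subtopology continuous_map_componentwise
proof (intro conjI ballI)
  show "from_coord G d a ` topspace (top_of_set (coord_torus d)) \<subseteq> extensional (carrier G)"
    by (auto simp: from_coord_def)
  show "from_coord G d a \<in> topspace (top_of_set (coord_torus d)) \<rightarrow> torus G"
    using from_coord_in_torus by auto
  fix \<alpha> assume "\<alpha> \<in> carrier G"
  moreover have "continuous_on (coord_torus d) (\<lambda>z. laurent d (a \<alpha>) z)"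
    by (intro continuous_on_laurent continuous_intros) (auto simp: coord_torus_def)
  ultimately show "continuous_map (top_of_set (coord_torus d)) euclidean (\<lambda>z. from_coord G d a z \<alpha>)"
    by (simp add: from_coord_def)
qed

text \<open>Pointwise convergence makes both directions continuous: \<open>to_coord\<close>
  evaluates on a basis, and the values of \<open>from_coord\<close> are Laurent monomials.\<close>

lemma complement_homeomorphic:
  assumes X: "\<XX> \<subseteq> carrier G"
  shows "subtopology (torus_topology G) (arrangement_complement G \<XX>)
    homeomorphic_space top_of_set (coord_complement d (a ` \<XX>))"
proof -
  let ?M = "coord_complement d (a ` \<XX>)" and ?A = "arrangement_complement G \<XX>"
  have A: "t \<in> ?A \<longleftrightarrow> t \<in> torus G \<and> (\<forall>\<alpha>\<in>\<XX>. t \<alpha> \<noteq> 1)" for t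
    by (auto simp: arrangement_complement_def hypertorus_def)
  have M: "?M \<subseteq> coord_torus d" by (auto simp: coord_complement_def)
  have toM: "to_coord G d a t \<in> ?M" if t: "t \<in> ?A" for t
  proof -
    have t': "t \<in> torus G" "\<And>\<alpha>. \<alpha> \<in> \<XX> \<Longrightarrow> t \<alpha> \<noteq> 1" using t by (auto simp: A)
    have "laurent d (a \<alpha>) (to_coord G d a t) \<noteq> 1" if "\<alpha> \<in> \<XX>" for \<alpha>
      using torus_eq_laurent(2)[OF t'(1), of \<alpha>] t'(2)[OF that] that X by auto
    then show ?thesis using torus_eq_laurent(1)[OF t'(1)] by (auto simp: coord_complement_def)
  qed
  have fromA: "from_coord G d a z \<in> ?A" if z: "z \<in> ?M" for z
    using from_coord_in_torus(1)[of z] z M X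
    by (auto simp: A coord_complement_def from_coord_def subset_iff)
  have "homeomorphic_maps (subtopology (torus_topology G) ?A) (top_of_set ?M) (to_coord G d a) (from_coord G d a)"
    unfolding homeomorphic_maps_def
  proof (intro conjI ballI)
    have "continuous_map (subtopology (torus_topology G) ?A) euclidean (to_coord G d a)"
      unfolding euclidean_product_topology[symmetric] continuous_map_componentwise_UNIV
    proof
      fix j
      have "inv_into (carrier G) a (unit_vec j) \<in> carrier G" if "j < d"
        using that bij_betwE[OF bij_betw_inv_into[OF coord_bij]] by (simp add: unit_vec_def)
      then show "continuous_map (subtopology (torus_topology G) ?A) euclidean (\<lambda>t. to_coord G d a t j)"
        by (cases "j < d")
           (auto simp: to_coord_def torus_topology_def
             intro!: continuous_map_from_subtopology continuous_map_product_projection)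
    qed
    then show "continuous_map (subtopology (torus_topology G) ?A) (top_of_set ?M) (to_coord G d a)"
      using toM by (auto simp: continuous_map_in_subtopology)
    have "continuous_map (top_of_set ?M) (torus_topology G) (from_coord G d a)"
      using continuous_map_from_subtopology_mono[OF continuous_map_from_coord M] .
    then show "continuous_map (top_of_set ?M) (subtopology (torus_topology G) ?A) (from_coord G d a)"
      using fromA by (auto simp: continuous_map_in_subtopology)
    show "from_coord G d a (to_coord G d a t) = t" if "t \<in> topspace (subtopology (torus_topology G) ?A)" for t
      using that from_to_coord by simp
    show "to_coord G d a (from_coord G d a z) = z" if "z \<in> topspace (top_of_set ?M)" for z
      using that M from_coord_in_torus(2) by auto
  qed
  then show ?thesis by (auto simp: homeomorphic_space_def)
qed

end

subsection \<open>The rank of the poset of layers\<close>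

lemma torus_exp_surj:
  assumes "z \<in> coord_torus d"
  obtains w where "z = torus_exp d w"
proof
  have "2 * of_real pi * \<i> * (Ln (z j) / (2 * of_real pi * \<i>)) = Ln (z j)" for j
    by simp
  then show "z = torus_exp d (\<lambda>j. Ln (z j) / (2 * of_real pi * \<i>))"
    using assms by (auto simp: torus_exp_def coord_torus_def fun_eq_iff)
qed

lemma poset_rank_eqI:
  assumes bound: "\<And>C. finite C \<Longrightarrow> subset.chain P C \<Longrightarrow> card C \<le> n + 1"
    and ex: "finite C" "subset.chain P C" "card C = n + 1"
  shows "poset_rank P = n"
  unfolding poset_rank_def
proof (rule Max_eqI)
  have "{card C - 1 | C. finite C \<and> subset.chain P C} \<subseteq> {..n}"
    using bound by fastforce
  then show "finite {card C - 1 | C. finite C \<and> subset.chain P C}" by (rule finite_subset) simp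
  show "y \<le> n" if "y \<in> {card C - 1 | C. finite C \<and> subset.chain P C}" for y
    using that bound by fastforce
  show "n \<in> {card C - 1 | C. finite C \<and> subset.chain P C}"
    using ex by force
qed

context coordinates
begin

definition common_kernel :: "'a set \<Rightarrow> ('a \<Rightarrow> complex) set" where
  "common_kernel S = torus G \<inter> (\<Inter>\<alpha>\<in>S. hypertorus G \<alpha>)"

text \<open>The largest subset of \<XX> that can define the layer. It is determined by
  \<open>L\<close>, and it grows as \<open>L\<close> shrinks.\<close>

definition layer_chars :: "'a set \<Rightarrow> ('a \<Rightarrow> complex) set \<Rightarrow> 'a set" where
  "layer_chars \<XX> L = {\<alpha> \<in> \<XX>. L \<subseteq> hypertorus G \<alpha>}"

lemma in_common_kernel: "t \<in> common_kernel S \<longleftrightarrow> t \<in> torus G \<and> (\<forall>\<alpha>\<in>S. t \<alpha> = 1)"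
  by (auto simp: common_kernel_def hypertorus_def)

text \<open>Enlarging a defining set to all characters trivial on \<open>L\<close> shrinks the
  kernel, but \<open>L\<close> is still contained in it and so remains a component.\<close>

lemma layer_component:
  assumes "L \<in> layers G (toric_arrangement G \<XX>)"
  shows "L \<in> components_in G (common_kernel (layer_chars \<XX> L))"
proof -
  obtain S where S: "S \<subseteq> \<XX>" and L: "L \<in> components_in G (common_kernel S)"
    using assms unfolding layers_toric_arrangement common_kernel_def by blast
  have LS: "L \<subseteq> common_kernel S" by (rule components_inD(1)[OF L])
  then have SL: "S \<subseteq> layer_chars \<XX> L"
    using S by (auto simp: layer_chars_def common_kernel_def)
  show ?thesis
  proof (rule components_in_sandwich[OF L])
    show "L \<subseteq> common_kernel (layer_chars \<XX> L)"
      using LS by (auto simp: layer_chars_def common_kernel_def)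
    fix D assume "D \<in> components_in G (common_kernel (layer_chars \<XX> L))"
    then have "D \<subseteq> common_kernel (layer_chars \<XX> L)" by (rule components_inD(1))
    also have "\<dots> \<subseteq> common_kernel S" using SL unfolding common_kernel_def by blast
    finally show "D \<subseteq> common_kernel S" .
  qed
qed

lemma torus_exp_of_torus:
  assumes "t \<in> torus G"
  obtains w where "\<And>\<alpha>. \<alpha> \<in> carrier G \<Longrightarrow> t \<alpha> = exp (2 * of_real pi * \<i> * dot d (a \<alpha>) w)"
proof -
  obtain w where "to_coord G d a t = torus_exp d w"
    by (rule torus_exp_surj[OF torus_eq_laurent(1)[OF assms]])
  then show thesis using that torus_eq_laurent(2)[OF assms] by (simp add: laurent_torus_exp)
qed

lemma continuous_map_eval:
  assumes "\<alpha> \<in> carrier G"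
  shows "continuous_map (torus_topology G) euclidean (\<lambda>t. t \<alpha>)"
  unfolding torus_topology_def
  by (intro continuous_map_from_subtopology continuous_map_product_projection assms)

text \<open>
  A character in the rational span of the characters defining \<open>L\<close> takes values in a finite
  group of roots of unity on \<open>L\<close>, hence is constant there.
\<close>

lemma layer_subset_of_qspan:
  assumes X: "\<XX> \<subseteq> carrier G"
    and L: "L \<in> layers G (toric_arrangement G \<XX>)" "L' \<in> layers G (toric_arrangement G \<XX>)"
    and sub: "L' \<subseteq> L" and span: "a ` layer_chars \<XX> L' \<subseteq> qspan (a ` layer_chars \<XX> L)"
  shows "L \<subseteq> L'"
proof -
  note cL = layer_component[OF L(1)] and cL' = layer_component[OF L(2)]
  have LT: "L \<subseteq> torus G" and L'ne: "L' \<noteq> {}" and conL: "connectedin (torus_topology G) L"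
    using components_inD[OF cL] components_inD[OF cL'] by auto
  have "L \<subseteq> common_kernel (layer_chars \<XX> L')"
  proof
    fix t assume t: "t \<in> L"
    have "t \<alpha> = 1" if \<alpha>: "\<alpha> \<in> layer_chars \<XX> L'" for \<alpha>
    proof -
      have \<alpha>G: "\<alpha> \<in> carrier G" using \<alpha> X by (auto simp: layer_chars_def)
      have "a \<alpha> \<in> qspan (a ` layer_chars \<XX> L)" using span \<alpha> by blast
      then obtain n :: nat where n: "n > 0" "\<forall>w :: nat \<Rightarrow> complex.
          (\<forall>v\<in>a ` layer_chars \<XX> L. dot d v w \<in> \<int>) \<longrightarrow> of_nat n * dot d (a \<alpha>) w \<in> \<int>"
        by (rule multiple_dot_in_Ints_of_qspan)
      have "(\<lambda>t. t \<alpha>) ` L \<subseteq> {z. z ^ n = 1}"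
      proof (rule image_subsetI)
        fix s assume s: "s \<in> L"
        then have "s \<in> torus G" using LT by blast
        then obtain w where w: "\<And>\<beta>. \<beta> \<in> carrier G \<Longrightarrow> s \<beta> = exp (2 * of_real pi * \<i> * dot d (a \<beta>) w)"
          by (rule torus_exp_of_torus) (rule that)
        have "dot d (a \<beta>) w \<in> \<int>" if "\<beta> \<in> layer_chars \<XX> L" for \<beta>
        proof -
          have "\<beta> \<in> carrier G" "s \<beta> = 1" using that s X by (auto simp: layer_chars_def hypertorus_def)
          then show ?thesis using w[of \<beta>] by (simp add: exp_2pi_i_eq_1_iff)
        qed
        then have "of_nat n * dot d (a \<alpha>) w \<in> \<int>" using n(2) by blast
        then have "exp (2 * of_real pi * \<i> * (of_nat n * dot d (a \<alpha>) w)) = 1"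
          by (simp add: exp_2pi_i_eq_1_iff)
        moreover have "s \<alpha> ^ n = exp (2 * of_real pi * \<i> * (of_nat n * dot d (a \<alpha>) w))"
          unfolding w[OF \<alpha>G] exp_of_nat_mult[symmetric] by (simp add: mult_ac)
        ultimately show "s \<alpha> \<in> {z. z ^ n = 1}" by simp
      qed
      moreover have "finite {z :: complex. z ^ n = 1}" using n(1) by (intro finite_roots_unity) simp
      ultimately have "finite ((\<lambda>t. t \<alpha>) ` L)" by (rule finite_subset)
      moreover have "connected ((\<lambda>t. t \<alpha>) ` L)"
        using connectedin_continuous_map_image[OF continuous_map_eval[OF \<alpha>G] conL] by simp
      ultimately have "(\<lambda>t. t \<alpha>) ` L = {} \<or> (\<exists>x. (\<lambda>t. t \<alpha>) ` L = {x})"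
        using connected_finite_iff_sing by blast
      then obtain x where x: "(\<lambda>t. t \<alpha>) ` L = {x}" using t by blast
      obtain s where s: "s \<in> L'" using L'ne by blast
      have "s \<alpha> = 1" using s \<alpha> by (auto simp: layer_chars_def hypertorus_def)
      moreover have "s \<alpha> = x" "t \<alpha> = x" using x s t sub by blast+
      ultimately show ?thesis by simp
    qed
    then show "t \<in> common_kernel (layer_chars \<XX> L')" using t LT by (auto simp: in_common_kernel)
  qed
  moreover have "L' \<inter> L \<noteq> {}" using sub L'ne by blast
  ultimately show "L \<subseteq> L'" by (rule components_in_maximal[OF cL' conL])
qed

text \<open>A smaller layer has more characters, and by \<open>layer_subset_of_qspan\<close> equal
  rank forces equal layers. So the rank of \<open>layer_chars\<close> is injective on a chain, with
  values from 0 to the rank of all of \<XX>.\<close>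

lemma layer_chain_card:
  assumes X: "finite \<XX>" "\<XX> \<subseteq> carrier G"
    and C: "finite C" "subset.chain (layers G (toric_arrangement G \<XX>)) C"
  shows "card C \<le> qrank (a ` \<XX>) + 1"
proof -
  have CL: "C \<subseteq> layers G (toric_arrangement G \<XX>)"
    and tot: "\<And>L L'. L \<in> C \<Longrightarrow> L' \<in> C \<Longrightarrow> L \<subseteq> L' \<or> L' \<subseteq> L"
    using C(2) by (simp_all add: subset_chain_def)
  define q where "q L = qrank (a ` layer_chars \<XX> L)" for L
  have eq: "L = L'" if L: "L \<in> C" "L' \<in> C" "L' \<subseteq> L" and q: "q L = q L'" for L L'
  proof -
    have "a ` layer_chars \<XX> L' \<subseteq> qspan (a ` layer_chars \<XX> L)"
    proof (rule subset_qspan_of_qrank_eq)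
      show "finite (a ` layer_chars \<XX> L')" using X(1) by (simp add: layer_chars_def)
      show "a ` layer_chars \<XX> L \<subseteq> a ` layer_chars \<XX> L'"
        using L(3) by (intro image_mono) (auto simp: layer_chars_def)
      show "qrank (a ` layer_chars \<XX> L') \<le> qrank (a ` layer_chars \<XX> L)"
        using q by (simp add: q_def)
    qed
    from layer_subset_of_qspan[OF X(2) subsetD[OF CL L(1)] subsetD[OF CL L(2)] L(3) this]
    have "L \<subseteq> L'" .
    with L(3) show ?thesis by blast
  qed
  have "inj_on q C"
  proof (rule inj_onI)
    fix L L' assume "L \<in> C" "L' \<in> C" "q L = q L'"
    then show "L = L'" using eq[of L L'] eq[of L' L] tot[of L L'] by auto
  qed
  moreover have "q ` C \<subseteq> {..qrank (a ` \<XX>)}"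
    using X(1) by (auto simp: q_def layer_chars_def intro!: qrank_mono)
  ultimately have "card C \<le> card {..qrank (a ` \<XX>)}" by (intro card_inj_on_le) auto
  then show ?thesis by simp
qed

text \<open>Impose independent characters one at a time and take the component through the identity
  of the torus. Each step is strict: a curve from the identity, on which the earlier characters stay
  1, takes the next one to -1.\<close>

lemma exists_layer_chain:
  assumes X: "finite \<XX>" "\<XX> \<subseteq> carrier G"
  obtains C where "finite C" "subset.chain (layers G (toric_arrangement G \<XX>)) C"
    "card C = qrank (a ` \<XX>) + 1"
proof -
  define r where "r = qrank (a ` \<XX>)"
  obtain b where b: "\<forall>i<r. b i \<in> a ` \<XX>" "\<forall>i<r. b i \<notin> qspan (b ` {..<i})"
    unfolding r_def by (rule independent_sequence[of "a ` \<XX>"]) (use X in auto)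
  have "\<forall>i. \<exists>\<alpha>. i < r \<longrightarrow> \<alpha> \<in> \<XX> \<and> a \<alpha> = b i" using b(1) by (auto simp: image_iff) metis
  from choice[OF this] obtain c where c: "\<And>i. i < r \<Longrightarrow> c i \<in> \<XX> \<and> a (c i) = b i" by blast
  have cG: "c i \<in> carrier G" if "i < r" for i using c[OF that] X(2) by blast
  define e where "e = from_coord G d a (\<lambda>_. 1)"
  have e: "e \<in> torus G" unfolding e_def by (rule from_coord_in_torus) (simp add: coord_torus_def)
  have "e \<in> common_kernel (c ` {..<i})" if "i \<le> r" for i
    using e cG that by (auto simp: in_common_kernel e_def from_coord_def laurent_def)
  then have "\<exists>L. i \<le> r \<longrightarrow> L \<in> components_in G (common_kernel (c ` {..<i})) \<and> e \<in> L" for i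
    using components_in_exists[of G "{e}" "common_kernel (c ` {..<i})"] e by (metis connectedin_sing empty_not_insert empty_subsetI insert_subset topspace_torus_topology)
  then obtain L where L: "\<And>i. i \<le> r \<Longrightarrow> L i \<in> components_in G (common_kernel (c ` {..<i}))"
    and eL: "\<And>i. i \<le> r \<Longrightarrow> e \<in> L i" by metis
  have strict: "L (Suc i) \<subset> L i" if i: "i < r" for i
  proof
    have "common_kernel (c ` {..<Suc i}) \<subseteq> common_kernel (c ` {..<i})" by (auto simp: in_common_kernel)
    then have "L (Suc i) \<subseteq> common_kernel (c ` {..<i})"
      using components_inD(1)[OF L[of "Suc i"]] i by auto
    then show "L (Suc i) \<subseteq> L i"
      using eL[of i] eL[of "Suc i"] i
      by (intro components_in_maximal[OF L components_inD(4)[OF L]]) auto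
    have bsupp: "b j k = 0" if "j < r" "d \<le> k" for j k
      using c[OF that(1)] coord_support[OF cG[OF that(1)] that(2)] by simp
    have "\<And>v j. v \<in> b ` {..<i} \<Longrightarrow> d \<le> j \<Longrightarrow> v j = 0" using bsupp i by auto
    moreover have "\<And>j. d \<le> j \<Longrightarrow> b i j = 0" using bsupp i by auto
    moreover have "b i \<notin> qspan (b ` {..<i})" using b(2) i by blast
    ultimately obtain w :: "nat \<Rightarrow> int" where w: "\<forall>v\<in>b ` {..<i}. dot d v w = 0" "dot d (b i) w \<noteq> 0"
      by (rule separating_covector)
    \<comment> \<open>The factor 2 makes the pairing with \<open>b i\<close> equal to 1/2 at
      \<open>s = 1\<close>, so that the new character has the value -1 there.\<close>
    define W where "W s = (\<lambda>j. (of_real s / of_int (2 * dot d (b i) w)) * of_int (w j) :: complex)" for s :: real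
    define \<gamma> where "\<gamma> s = from_coord G d a (torus_exp d (W s))" for s
    have dotW: "dot d v (W s) = (of_real s / of_int (2 * dot d (b i) w)) * of_int (dot d v w)" for v s
      unfolding W_def dot_cmult dot_of_int ..
    have \<gamma>: "\<gamma> s \<beta> = exp (2 * of_real pi * \<i> * dot d (a \<beta>) (W s))" if "\<beta> \<in> carrier G" for s \<beta>
      using that by (simp add: \<gamma>_def from_coord_def laurent_torus_exp)
    have "continuous_map euclidean (torus_topology G) \<gamma>"
    proof -
      have "continuous_on UNIV (\<lambda>s. torus_exp d (W s))"
        by (intro continuous_on_torus_exp) (use w(2) in \<open>auto simp: W_def intro!: continuous_intros\<close>)
      then have "continuous_map euclidean (top_of_set (coord_torus d)) (\<lambda>s. torus_exp d (W s))"
        using torus_exp_in_coord_torus by (simp add: continuous_map_in_subtopology)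
      from continuous_map_compose[OF this continuous_map_from_coord] show ?thesis
        by (simp add: comp_def \<gamma>_def[abs_def])
    qed
    then have "connectedin (torus_topology G) (\<gamma> ` {0..1})"
      by (rule connectedin_continuous_map_image) simp
    moreover have "\<gamma> ` {0..1} \<subseteq> common_kernel (c ` {..<i})"
    proof (rule image_subsetI)
      fix s :: real
      have "\<gamma> s (c j) = 1" if "j < i" for j
        using w(1) that i by (simp add: \<gamma> cG c dotW)
      moreover have "\<gamma> s \<in> torus G"
        unfolding \<gamma>_def by (rule from_coord_in_torus[OF torus_exp_in_coord_torus])
      ultimately show "\<gamma> s \<in> common_kernel (c ` {..<i})" by (auto simp: in_common_kernel)
    qed
    moreover have "\<gamma> 0 = e"
      unfolding \<gamma>_def e_def by (rule arg_cong[where f = "from_coord G d a"]) (auto simp: torus_exp_def W_def)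
    then have "L i \<inter> \<gamma> ` {0..1} \<noteq> {}" using eL[of i] i by (metis IntI atLeastAtMost_iff empty_iff imageI less_imp_le order_refl zero_le_one)
    ultimately have "\<gamma> ` {0..1} \<subseteq> L i" using i by (intro components_in_maximal[OF L]) auto
    then have "\<gamma> 1 \<in> L i" by auto
    moreover have "\<gamma> 1 (c i) = -1"
    proof -
      have "2 * of_real pi * \<i> * dot d (b i) (W 1) = of_real pi * \<i>" using w(2) by (simp add: dotW)
      then have "exp (2 * of_real pi * \<i> * dot d (a (c i)) (W 1)) = - 1"
        using c[OF i] by (simp only: exp_pi_i)
      then show ?thesis by (simp only: \<gamma>[OF cG[OF i]])
    qed
    then have "\<gamma> 1 \<notin> L (Suc i)"
      using components_inD(1)[OF L[of "Suc i"]] i by (auto simp: in_common_kernel)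
    ultimately show "L (Suc i) \<noteq> L i" by blast
  qed
  have anti: "L j \<subset> L i" if "i < j" "j \<le> r" for i j
    using that
  proof (induction j)
    case (Suc j)
    show ?case
    proof (cases "i = j")
      case True
      then show ?thesis using strict[of j] Suc.prems by simp
    next
      case False
      then have "L j \<subset> L i" using Suc by simp
      then show ?thesis using strict[of j] Suc.prems by (simp add: psubset_trans)
    qed
  qed simp
  show thesis
  proof (rule that[of "L ` {..r}"])
    have "L i \<in> layers G (toric_arrangement G \<XX>)" if "i \<le> r" for i
    proof -
      have "c ` {..<i} \<in> Pow \<XX>" using c that by auto
      with L[OF that] show ?thesis unfolding layers_toric_arrangement common_kernel_def by blast
    qed
    moreover have "L i \<subseteq> L j \<or> L j \<subseteq> L i" if "i \<le> r" "j \<le> r" for i j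
      using anti[of i j] anti[of j i] that by (cases i j rule: linorder_cases) auto
    ultimately show "subset.chain (layers G (toric_arrangement G \<XX>)) (L ` {..r})"
      by (auto simp: subset_chain_def)
    have "inj_on L {..r}"
    proof (rule inj_onI)
      fix i j assume "i \<in> {..r}" "j \<in> {..r}" "L i = L j"
      then show "i = j" using anti[of i j] anti[of j i] by (cases i j rule: linorder_cases) auto
    qed
    then show "card (L ` {..r}) = qrank (a ` \<XX>) + 1" by (simp add: card_image r_def)
  qed simp
qed

theorem arrangement_rank_eq_qrank:
  assumes "finite \<XX>" "\<XX> \<subseteq> carrier G"
  shows "arrangement_rank G (toric_arrangement G \<XX>) = qrank (a ` \<XX>)"
proof -
  obtain C where "finite C" "subset.chain (layers G (toric_arrangement G \<XX>)) C"
    "card C = qrank (a ` \<XX>) + 1"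
    by (rule exists_layer_chain[OF assms])
  then show ?thesis
    unfolding arrangement_rank_def using layer_chain_card[OF assms] by (intro poset_rank_eqI)
qed

end

subsection \<open>The upper bound\<close>

text \<open>A lift along \<open>torus_exp\<close> with real parts in \<open>[0, 1)\<close>. It jumps
  where a coordinate is a positive real, which is why the unit vectors are included in
  \<open>chars\<close>.\<close>

definition torus_log :: "(nat \<Rightarrow> complex) \<Rightarrow> nat \<Rightarrow> complex" where
  "torus_log z j = of_real (Arg2pi (z j) / (2 * pi)) - \<i> * of_real (ln (norm (z j)) / (2 * pi))"

lemma exp_torus_log: "z j \<noteq> 0 \<Longrightarrow> exp (2 * of_real pi * \<i> * torus_log z j) = z j"
proof -
  assume nz: "z j \<noteq> 0"
  have "2 * of_real pi * \<i> * torus_log z j = of_real (ln (norm (z j))) + \<i> * of_real (Arg2pi (z j))"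
    by (simp add: torus_log_def complex_eq_iff)
  then have "exp (2 * of_real pi * \<i> * torus_log z j) = of_real (exp (ln (norm (z j)))) * exp (\<i> * of_real (Arg2pi (z j)))"
    by (simp add: exp_add exp_of_real)
  also have "\<dots> = z j" using Arg2pi_eq[of "z j"] nz by simp
  finally show ?thesis .
qed

lemma Re_torus_log: "0 \<le> Re (torus_log z j)" "Re (torus_log z j) < 1"
  using Arg2pi_ge_0[of "z j"] Arg2pi_lt_2pi[of "z j"] by (simp_all add: torus_log_def)

lemma torus_exp_torus_log: "z \<in> coord_torus d \<Longrightarrow> torus_exp d (torus_log z) = z"
  by (auto simp: torus_exp_def coord_torus_def exp_torus_log fun_eq_iff)

lemma tendsto_dot:
  fixes w :: "'b \<Rightarrow> nat \<Rightarrow> 'a::real_normed_field"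
  assumes "\<And>j. j < d \<Longrightarrow> ((\<lambda>x. w x j) \<longlongrightarrow> l j) F"
  shows "((\<lambda>x. dot d v (w x)) \<longlongrightarrow> dot d v l) F"
  unfolding dot_def using assms by (intro tendsto_intros) auto

text \<open>Use the branch \<open>Ln (z j / z0 j)\<close> centred at \<open>z0\<close>: it is
  continuous at \<open>z0\<close> even if \<open>torus_log\<close> jumps there, and the resulting
  lift differs from \<open>torus_log\<close> by integers on the whole torus.\<close>

lemma local_torus_log:
  assumes z0: "z0 \<in> coord_torus d"
  obtains l :: "(nat \<Rightarrow> complex) \<Rightarrow> nat \<Rightarrow> complex"
  where "\<forall>j. ((\<lambda>z. l z j) \<longlongrightarrow> torus_log z0 j) (at z0 within coord_torus d)"
    "\<forall>z\<in>coord_torus d. \<forall>j. l z j - torus_log z j \<in> \<int>"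
proof
  define l where "l z j = torus_log z0 j + Ln (z j / z0 j) / (2 * of_real pi * \<i>)" for z :: "nat \<Rightarrow> complex" and j
  have nz: "z j \<noteq> 0" if "z \<in> coord_torus d" for z j
    using that by (cases "j < d") (auto simp: coord_torus_def)
  show "\<forall>j. ((\<lambda>z. l z j) \<longlongrightarrow> torus_log z0 j) (at z0 within coord_torus d)"
  proof
    fix j
    have "continuous_on UNIV (\<lambda>z :: nat \<Rightarrow> complex. z j)" by (intro continuous_intros)
    then have "((\<lambda>z. z j) \<longlongrightarrow> z0 j) (at z0)" by (simp add: continuous_on_def)
    then have "((\<lambda>z. z j) \<longlongrightarrow> z0 j) (at z0 within coord_torus d)"
      using tendsto_within_subset by blast
    then have "((\<lambda>z. z j / z0 j) \<longlongrightarrow> z0 j / z0 j) (at z0 within coord_torus d)"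
      using nz[OF z0] by (intro tendsto_intros) auto
    then have "((\<lambda>z. Ln (z j / z0 j)) \<longlongrightarrow> Ln (z0 j / z0 j)) (at z0 within coord_torus d)"
      by (rule tendsto_Ln) (use nz[OF z0] in simp)
    then have "((\<lambda>z. l z j) \<longlongrightarrow> torus_log z0 j + Ln (z0 j / z0 j) / (2 * of_real pi * \<i>)) (at z0 within coord_torus d)"
      unfolding l_def by (intro tendsto_add tendsto_const tendsto_divide) auto
    then show "((\<lambda>z. l z j) \<longlongrightarrow> torus_log z0 j) (at z0 within coord_torus d)"
      using nz[OF z0] by simp
  qed
  show "\<forall>z\<in>coord_torus d. \<forall>j. l z j - torus_log z j \<in> \<int>"
  proof (intro ballI allI)
    fix z j assume z: "z \<in> coord_torus d"
    have "exp (2 * of_real pi * \<i> * l z j) = exp (2 * of_real pi * \<i> * torus_log z0 j + Ln (z j / z0 j))"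
      by (simp add: l_def distrib_left)
    also have "\<dots> = exp (2 * of_real pi * \<i> * torus_log z j)"
      using nz[OF z, of j] nz[OF z0, of j] by (simp add: exp_add exp_torus_log)
    finally show "l z j - torus_log z j \<in> \<int>" by (simp add: exp_2pi_i_eq_iff)
  qed
qed

lemma notin_Ints_between:
  fixes x :: real
  assumes "of_int m < x" "x < of_int m + 1"
  shows "x \<notin> \<int>"
proof
  assume "x \<in> \<int>"
  then obtain n where "x = of_int n" by (elim Ints_cases)
  with assms have "of_int m < real_of_int n" "real_of_int n < of_int (m + 1)" by simp_all
  then show False unfolding of_int_less_iff by simp
qed

lemma convex_combination_pos:
  fixes x y t :: real
  assumes "0 < x" "0 < y" "0 \<le> t" "t \<le> 1"
  shows "0 < (1 - t) * x + t * y"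
proof (cases "t = 0")
  case False
  then have "0 < t * y" using assms by simp
  then show ?thesis using assms by (simp add: add_nonneg_pos)
qed (use assms in simp)

lemma openin_of_eventually:
  assumes "\<And>x. x \<in> S \<Longrightarrow> P x \<Longrightarrow> \<forall>\<^sub>F y in at x within S. P y"
  shows "openin (top_of_set S) {x \<in> S. P x}"
proof (subst openin_subopen, rule ballI)
  fix x assume x: "x \<in> {x \<in> S. P x}"
  then obtain A where A: "open A" "x \<in> A" "\<And>y. y \<in> A \<Longrightarrow> y \<noteq> x \<Longrightarrow> y \<in> S \<Longrightarrow> P y"
    using assms[of x] unfolding eventually_at_topological by blast
  show "\<exists>T. openin (top_of_set S) T \<and> x \<in> T \<and> T \<subseteq> {x \<in> S. P x}"
  proof (intro exI conjI)
    show "openin (top_of_set S) (S \<inter> A)" using A(1) by (rule openin_open_Int)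
  qed (use A x in auto)
qed

text \<open>\<open>P\<close> is also required at \<open>fst p0\<close> itself, because a pair
  different from \<open>p0\<close> may share its first component.\<close>

lemma eventually_fst_within:
  assumes "\<forall>\<^sub>F z in at (fst p0) within A. P z" "P (fst p0)"
  shows "\<forall>\<^sub>F p in at p0 within A \<times> B. P (fst p)"
proof -
  obtain S where S: "open S" "fst p0 \<in> S" "\<And>z. z \<in> S \<Longrightarrow> z \<in> A \<Longrightarrow> P z"
    using assms unfolding eventually_at_topological by metis
  have "open (S \<times> UNIV)" using S(1) by (simp add: open_Times)
  then show ?thesis
    unfolding eventually_at_topological using S by (intro exI[of _ "S \<times> UNIV"]) (auto simp: mem_Times_iff)
qed

lemma eventually_snd_within:
  assumes "\<forall>\<^sub>F z in at (snd p0) within B. P z" "P (snd p0)"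
  shows "\<forall>\<^sub>F p in at p0 within A \<times> B. P (snd p)"
proof -
  obtain S where S: "open S" "snd p0 \<in> S" "\<And>z. z \<in> S \<Longrightarrow> z \<in> B \<Longrightarrow> P z"
    using assms unfolding eventually_at_topological by metis
  have "open (UNIV \<times> S)" using S(1) by (simp add: open_Times)
  then show ?thesis
    unfolding eventually_at_topological using S by (intro exI[of _ "UNIV \<times> S"]) (auto simp: mem_Times_iff)
qed

lemma eventually_in_within: "\<forall>\<^sub>F x in at a within S. x \<in> S"
  by (simp add: eventually_at_filter)

lemma Ints_diff_less_1:
  fixes x y :: real
  assumes "x - y \<in> \<int>" "\<bar>x - y\<bar> < 1"
  shows "x = y"
proof -
  obtain n where n: "x - y = of_int n" using assms(1) by (elim Ints_cases)
  then have "\<bar>real_of_int n\<bar> < 1" using assms(2) by simp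
  then have "n = 0" by linarith
  with n show ?thesis by simp
qed

text \<open>
  The strata are those of the real arrangement of the arguments: the stratum of \<open>z\<close> is
  determined by the characters of \<open>X\<close> and the coordinates that are positive at \<open>z\<close>, its
  codimension \<open>codim z\<close> is the rank of this set. On the points of given codimension the
  arguments \<open>Re (torus_log z j)\<close> in \<open>[0, 1)\<close> are continuous, and \<open>cell z\<close>, which records the
  position of \<open>torus_log z\<close> relative to the affine hyperplanes \<open>v = n\<close> for integers \<open>n\<close>, is
  locally constant.
\<close>

locale real_stratification =
  fixes X :: "(nat \<Rightarrow> int) set" and d e :: nat
  assumes finite_X: "finite X" and e_le_d: "e \<le> d"
    and support: "\<And>v j. v \<in> X \<Longrightarrow> e \<le> j \<Longrightarrow> v j = 0"
begin

abbreviation "M \<equiv> coord_complement d X"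

definition "chars = X \<union> unit_vec ` {..<e}"

definition "re_dot z v = dot e v (\<lambda>j. Re (torus_log z j))"

definition "pos z = {v \<in> chars. re_dot z v \<in> \<int>}"

definition "codim z = qrank (pos z)"

text \<open>Floor and ceiling together tell an integer value from one inside an open unit interval.
  At an integer value the imaginary part is nonzero on \<open>M\<close>, so the last entry records
  its sign. Either way the condition on the value of the form is convex.\<close>

definition "cell z = (\<lambda>v\<in>X. (\<lfloor>re_dot z v\<rfloor>, \<lceil>re_dot z v\<rceil>, re_dot z v \<in> \<int> \<and> Im (dot e v (torus_log z)) > 0))"

lemma finite_chars: "finite chars"
  by (simp add: chars_def finite_X)

lemma M_torus: "z \<in> M \<Longrightarrow> z \<in> coord_torus d"
  by (simp add: coord_complement_def)

lemma codim_le: "codim z \<le> e"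
  unfolding codim_def by (rule qrank_le_support) (auto simp: pos_def chars_def support unit_vec_def)

lemma dot_torus_log_notin_Ints: "dot e v (torus_log z) \<notin> \<int>" if "z \<in> M" "v \<in> X"
proof -
  have "torus_exp d (torus_log z) \<in> M" using that(1) torus_exp_torus_log[OF M_torus[OF that(1)]] by simp
  moreover have "dot d v (torus_log z) = dot e v (torus_log z)"
    by (rule dot_mono_neutral[OF e_le_d]) (rule support[OF that(2)])
  ultimately show ?thesis using that(2) by (auto simp: torus_exp_in_complement_iff)
qed

text \<open>Near \<open>z0\<close> noninteger values stay in their unit interval, so
  \<open>pos z \<subseteq> pos z0\<close> and the codimension cannot rise. If it does not drop,
  \<open>pos z0\<close> lies in the rational span of \<open>pos z\<close>; the forms in
  \<open>pos z\<close> keep their values, hence so do those in \<open>pos z0\<close>, and the lift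
  \<open>l\<close> stays in the branch of \<open>torus_log\<close>.\<close>

lemma eventually_stratum:
  assumes z0: "z0 \<in> M"
  obtains l :: "(nat \<Rightarrow> complex) \<Rightarrow> nat \<Rightarrow> complex"
  where "\<forall>j. ((\<lambda>z. l z j) \<longlongrightarrow> torus_log z0 j) (at z0 within M)"
    "\<forall>\<^sub>F z in at z0 within M. codim z \<le> codim z0 \<and>
       (codim z = codim z0 \<longrightarrow> cell z = cell z0 \<and> (\<forall>j<e. torus_log z j = l z j))"
proof -
  obtain l :: "(nat \<Rightarrow> complex) \<Rightarrow> nat \<Rightarrow> complex"
    where l: "\<forall>j. ((\<lambda>z. l z j) \<longlongrightarrow> torus_log z0 j) (at z0 within coord_torus d)"
      and lZ: "\<forall>z\<in>coord_torus d. \<forall>j. l z j - torus_log z j \<in> \<int>"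
    by (rule local_torus_log[OF M_torus[OF z0]])
  have l': "((\<lambda>z. l z j) \<longlongrightarrow> torus_log z0 j) (at z0 within M)" for j
    by (rule tendsto_within_subset[OF l[rule_format]]) (auto simp: M_torus)
  define D where "D z v = dot e v (\<lambda>j. Re (l z j))" for z v
  have D: "((\<lambda>z. D z v) \<longlongrightarrow> re_dot z0 v) (at z0 within M)" for v
    unfolding D_def re_dot_def by (intro tendsto_dot tendsto_Re l')
  have I: "((\<lambda>z. Im (dot e v (l z))) \<longlongrightarrow> Im (dot e v (torus_log z0))) (at z0 within M)" for v
    by (intro tendsto_Im tendsto_dot l')
  have E1: "\<forall>\<^sub>F z in at z0 within M. \<forall>v\<in>chars. re_dot z0 v \<notin> \<int> \<longrightarrow>
      of_int \<lfloor>re_dot z0 v\<rfloor> < D z v \<and> D z v < of_int \<lfloor>re_dot z0 v\<rfloor> + 1"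
  proof (intro eventually_ball_finite finite_chars ballI)
    fix v
    show "\<forall>\<^sub>F z in at z0 within M. re_dot z0 v \<notin> \<int> \<longrightarrow>
      of_int \<lfloor>re_dot z0 v\<rfloor> < D z v \<and> D z v < of_int \<lfloor>re_dot z0 v\<rfloor> + 1"
    proof (cases "re_dot z0 v \<in> \<int>")
      case False
      then have "of_int \<lfloor>re_dot z0 v\<rfloor> \<noteq> re_dot z0 v" by (metis Ints_of_int)
      then have "of_int \<lfloor>re_dot z0 v\<rfloor> < re_dot z0 v" "re_dot z0 v < of_int \<lfloor>re_dot z0 v\<rfloor> + 1"
        by linarith+
      then have "\<forall>\<^sub>F z in at z0 within M. of_int \<lfloor>re_dot z0 v\<rfloor> < D z v"
        "\<forall>\<^sub>F z in at z0 within M. D z v < of_int \<lfloor>re_dot z0 v\<rfloor> + 1"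
        using D[of v] by (auto intro: order_tendstoD)
      then show ?thesis by eventually_elim simp
    qed simp
  qed
  have E2: "\<forall>\<^sub>F z in at z0 within M. \<forall>v\<in>chars. \<bar>D z v - re_dot z0 v\<bar> < 1"
  proof (intro eventually_ball_finite finite_chars ballI)
    fix v show "\<forall>\<^sub>F z in at z0 within M. \<bar>D z v - re_dot z0 v\<bar> < 1"
      using tendstoD[OF D[of v], of 1] by (simp add: dist_real_def)
  qed
  have E3: "\<forall>\<^sub>F z in at z0 within M. \<forall>v\<in>X. Im (dot e v (torus_log z0)) \<noteq> 0 \<longrightarrow>
      (Im (dot e v (l z)) > 0 \<longleftrightarrow> Im (dot e v (torus_log z0)) > 0)"
  proof (intro eventually_ball_finite finite_X ballI)
    fix v
    consider "Im (dot e v (torus_log z0)) = 0" | "Im (dot e v (torus_log z0)) > 0" | "Im (dot e v (torus_log z0)) < 0"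
      by linarith
    then show "\<forall>\<^sub>F z in at z0 within M. Im (dot e v (torus_log z0)) \<noteq> 0 \<longrightarrow>
      (Im (dot e v (l z)) > 0 \<longleftrightarrow> Im (dot e v (torus_log z0)) > 0)"
    proof cases
      case 2
      from order_tendstoD(1)[OF I[of v] 2] show ?thesis by eventually_elim (use 2 in simp)
    next
      case 3
      from order_tendstoD(2)[OF I[of v] 3] show ?thesis by eventually_elim (use 3 in simp)
    qed simp
  qed
  have "\<forall>\<^sub>F z in at z0 within M. codim z \<le> codim z0 \<and>
       (codim z = codim z0 \<longrightarrow> cell z = cell z0 \<and> (\<forall>j<e. torus_log z j = l z j))"
    using E1 E2 E3 eventually_in_within[where a = z0 and S = M]
  proof eventually_elim
    case (elim z)
    note E1 = elim(1) and E2 = elim(2) and E3 = elim(3)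
    have lz: "l z j - torus_log z j \<in> \<int>" for j using lZ M_torus[OF elim(4)] by blast
    have Re_lz: "Re (l z j) - Re (torus_log z j) \<in> \<int>" for j
      using lz[of j] by (auto elim!: Ints_cases simp flip: minus_complex.sel)
    have D_iff: "re_dot z v \<in> \<int> \<longleftrightarrow> D z v \<in> \<int>" for v
    proof -
      have "D z v - re_dot z v = dot e v (\<lambda>j. Re (l z j) - Re (torus_log z j))"
        by (simp add: D_def re_dot_def dot_diff)
      also have "\<dots> \<in> \<int>" unfolding dot_def using Re_lz by (intro Ints_sum Ints_mult) auto
      finally have *: "D z v - re_dot z v \<in> \<int>" .
      show ?thesis using Ints_add[OF *, of "re_dot z v"] Ints_diff[OF _ *, of "D z v"] by auto
    qed
    have sub: "pos z \<subseteq> pos z0"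
    proof
      fix v assume v: "v \<in> pos z"
      then have vc: "v \<in> chars" and DZ: "D z v \<in> \<int>" by (auto simp: pos_def D_iff)
      then have "re_dot z0 v \<in> \<int>" using E1 notin_Ints_between by blast
      with vc show "v \<in> pos z0" by (simp add: pos_def)
    qed
    have fin: "finite (pos z0)" using finite_chars by (simp add: pos_def)
    have "cell z = cell z0 \<and> (\<forall>j<e. torus_log z j = l z j)" if eq: "codim z = codim z0"
    proof -
      \<comment> \<open>The displacement of the arguments. A form in \<open>pos z\<close> takes on
        it an integer value of absolute value below 1, hence 0, and this passes to the rational
        span.\<close>
      define u where "u j = Re (l z j) - Re (torus_log z0 j)" for j
      have u: "dot e v u = D z v - re_dot z0 v" for v
        unfolding u_def by (simp add: dot_diff D_def re_dot_def)
      have "dot e v u = 0" if v: "v \<in> pos z" for v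
      proof -
        have "D z v \<in> \<int>" "re_dot z0 v \<in> \<int>" "v \<in> chars" using v sub by (auto simp: pos_def D_iff)
        then have "D z v = re_dot z0 v" using E2 by (intro Ints_diff_less_1) auto
        then show ?thesis by (simp add: u)
      qed
      moreover have "pos z0 \<subseteq> qspan (pos z)"
        using subset_qspan_of_qrank_eq[OF fin sub] eq by (simp add: codim_def)
      ultimately have "dot e v u = 0" if "v \<in> pos z0" for v
        using dot_eq_0_of_qspan[of v "pos z"] that by blast
      then have D0: "D z v = re_dot z0 v" if "v \<in> pos z0" for v using u that by simp
      have torus_log: "torus_log z j = l z j" if j: "j < e" for j
      proof -
        have uc: "unit_vec j \<in> chars" using j by (simp add: chars_def)
        have Du: "D z (unit_vec j) = Re (l z j)" "re_dot z0 (unit_vec j) = Re (torus_log z0 j)"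
          using j by (simp_all add: D_def re_dot_def dot_unit_vec)
        \<comment> \<open>A coordinate on the jump at \<open>z0\<close> keeps its argument; any
          other one has its argument strictly between 0 and 1 and keeps it there. This bound singles
          out \<open>torus_log z j\<close> among the integer translates of
          \<open>l z j\<close>.\<close>
        have "0 \<le> Re (l z j) \<and> Re (l z j) < 1"
        proof (cases "Re (torus_log z0 j) \<in> \<int>")
          case True
          then have "unit_vec j \<in> pos z0" using uc by (simp add: pos_def Du)
          then show ?thesis using D0[of "unit_vec j"] Re_torus_log[of z0 j] by (simp add: Du)
        next
          case False
          have "\<lfloor>Re (torus_log z0 j)\<rfloor> = 0" using Re_torus_log[of z0 j] by linarith
          then show ?thesis using E1 uc False by (fastforce simp: Du)
        qed
        then have "\<bar>Re (l z j) - Re (torus_log z j)\<bar> < 1" using Re_torus_log[of z j] by linarith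
        then have "Re (l z j) = Re (torus_log z j)" using Re_lz by (intro Ints_diff_less_1)
        moreover have "Im (l z j - torus_log z j) = 0"
        proof -
          obtain n where n: "l z j - torus_log z j = of_int n" using lz[of j] by (elim Ints_cases)
          show ?thesis unfolding n by simp
        qed
        ultimately show ?thesis by (simp add: complex_eq_iff)
      qed
      then have dl: "dot e v (torus_log z) = dot e v (l z)" for v by (simp add: dot_def)
      have rd: "re_dot z v = D z v" for v using torus_log by (simp add: re_dot_def D_def dot_def)
      have "cell z v = cell z0 v" for v
      proof (cases "v \<in> X")
        case vX: True
        then have vc: "v \<in> chars" by (simp add: chars_def)
        show ?thesis
        proof (cases "re_dot z0 v \<in> \<int>")
          case True
          then have v0: "v \<in> pos z0" using vc by (simp add: pos_def)
          have "Im (dot e v (torus_log z0)) \<noteq> 0"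
          proof
            assume "Im (dot e v (torus_log z0)) = 0"
            moreover have "Re (dot e v (torus_log z0)) \<in> \<int>" using True by (simp add: re_dot_def Re_dot)
            then obtain n where "Re (dot e v (torus_log z0)) = of_int n" by (elim Ints_cases)
            ultimately have "dot e v (torus_log z0) = of_int n" by (simp add: complex_eq_iff)
            then show False using dot_torus_log_notin_Ints[OF z0 vX] by simp
          qed
          then show ?thesis using E3 vX True D0[OF v0] by (simp add: cell_def rd dl)
        next
          case False
          then have b: "of_int \<lfloor>re_dot z0 v\<rfloor> < D z v" "D z v < of_int \<lfloor>re_dot z0 v\<rfloor> + 1"
            using E1 vc by auto
          have "D z v \<notin> \<int>" using b by (rule notin_Ints_between)
          moreover have "of_int \<lfloor>re_dot z0 v\<rfloor> < re_dot z0 v" using False by (metis Ints_of_int floor_less_iff le_less of_int_floor_le)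
          then have "\<lceil>re_dot z0 v\<rceil> = \<lfloor>re_dot z0 v\<rfloor> + 1" by linarith
          moreover have "\<lfloor>D z v\<rfloor> = \<lfloor>re_dot z0 v\<rfloor>" "\<lceil>D z v\<rceil> = \<lfloor>re_dot z0 v\<rfloor> + 1" using b by linarith+
          ultimately show ?thesis using vX False by (simp add: cell_def rd)
        qed
      qed (simp add: cell_def)
      then show ?thesis using torus_log by auto
    qed
    moreover have "codim z \<le> codim z0" unfolding codim_def using qrank_mono[OF fin sub] .
    ultimately show ?case by blast
  qed
  with l' that show thesis by blast
qed

lemma continuous_on_torus_log:
  assumes j: "j < e"
  shows "continuous_on {z \<in> M. codim z = k} (\<lambda>z. torus_log z j)"
  unfolding continuous_on_def
proof
  let ?L = "{z \<in> M. codim z = k}"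
  fix z0 assume z0: "z0 \<in> ?L"
  then have "z0 \<in> M" by simp
  then obtain l :: "(nat \<Rightarrow> complex) \<Rightarrow> nat \<Rightarrow> complex"
    where l: "\<forall>j. ((\<lambda>z. l z j) \<longlongrightarrow> torus_log z0 j) (at z0 within M)"
      and ev: "\<forall>\<^sub>F z in at z0 within M. codim z \<le> codim z0 \<and>
       (codim z = codim z0 \<longrightarrow> cell z = cell z0 \<and> (\<forall>j<e. torus_log z j = l z j))"
    by (rule eventually_stratum)
  have le: "at z0 within ?L \<le> at z0 within M" by (rule at_le) auto
  have "\<forall>\<^sub>F z in at z0 within ?L. torus_log z j = l z j"
    using filter_leD[OF le ev] eventually_in_within[where a = z0 and S = ?L]
    by eventually_elim (use z0 j in auto)
  moreover have "((\<lambda>z. l z j) \<longlongrightarrow> torus_log z0 j) (at z0 within ?L)"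
    using l by (blast intro: tendsto_mono[OF le])
  ultimately show "((\<lambda>z. torus_log z j) \<longlongrightarrow> torus_log z0 j) (at z0 within ?L)"
    by (simp add: filterlim_cong[OF refl refl, of "\<lambda>z. torus_log z j" "\<lambda>z. l z j"])
qed

text \<open>If the real parts lie in a common open unit interval, convexity keeps them off the
  integers. If both are integers, the imaginary parts are nonzero of the same sign, and no convex
  combination of them vanishes.\<close>

lemma same_cell_segment:
  assumes M: "z \<in> M" "z' \<in> M" and cell: "cell z = cell z'" and v: "v \<in> X" and t: "0 \<le> t" "t \<le> 1"
  shows "dot e v (\<lambda>j. torus_log z j + of_real t * (torus_log z' j - torus_log z j)) \<notin> \<int>"
proof
  define p where "p z = re_dot z v" for z
  define q where "q z = Im (dot e v (torus_log z))" for z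
  have pq: "dot e v (torus_log z) = Complex (p z) (q z)" for z
    by (simp add: complex_eq_iff p_def q_def re_dot_def Re_dot)
  have c: "\<lfloor>p z\<rfloor> = \<lfloor>p z'\<rfloor>" "\<lceil>p z\<rceil> = \<lceil>p z'\<rceil>" "p z \<in> \<int> \<and> q z > 0 \<longleftrightarrow> p z' \<in> \<int> \<and> q z' > 0"
    using fun_cong[OF cell, of v] v by (simp_all add: cell_def p_def q_def)
  have nz: "q y \<noteq> 0" if y: "y \<in> M" "p y \<in> \<int>" for y
  proof
    assume "q y = 0"
    moreover obtain n where "p y = of_int n" using y(2) by (elim Ints_cases)
    ultimately have "dot e v (torus_log y) = of_int n" unfolding pq by (simp add: complex_eq_iff)
    then show False using dot_torus_log_notin_Ints[OF y(1) v] by simp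
  qed
  have eq: "dot e v (\<lambda>j. torus_log z j + of_real t * (torus_log z' j - torus_log z j))
      = Complex (p z + t * (p z' - p z)) (q z + t * (q z' - q z))"
    unfolding dot_add dot_cmult dot_diff pq by (simp add: complex_eq_iff)
  assume "dot e v (\<lambda>j. torus_log z j + of_real t * (torus_log z' j - torus_log z j)) \<in> \<int>"
  then obtain n where "Complex (p z + t * (p z' - p z)) (q z + t * (q z' - q z)) = of_int n"
    unfolding eq by (elim Ints_cases)
  then have n: "p z + t * (p z' - p z) = of_int n" "q z + t * (q z' - q z) = 0"
    by (simp_all add: complex_eq_iff)
  have conv: "p z + t * (p z' - p z) = (1 - t) * p z + t * p z'" "q z + t * (q z' - q z) = (1 - t) * q z + t * q z'"
    by (simp_all add: algebra_simps)
  show False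
  proof (cases "p z \<in> \<int>")
    case True
    then have "p z' \<in> \<int>" using c(1,2) by (metis Ints_cases Ints_of_int ceiling_of_int floor_of_int le_floor_iff ceiling_le_iff order_antisym order_refl)
    have "(0 < q z \<and> 0 < q z') \<or> (q z < 0 \<and> q z' < 0)"
      using nz[OF M(1) True] nz[OF M(2) \<open>p z' \<in> \<int>\<close>] c(3) True \<open>p z' \<in> \<int>\<close> by auto
    then show False
    proof
      assume "0 < q z \<and> 0 < q z'"
      then have "0 < (1 - t) * q z + t * q z'" using t by (intro convex_combination_pos) auto
      then show False using n(2) conv by simp
    next
      assume "q z < 0 \<and> q z' < 0"
      then have "0 < (1 - t) * (- q z) + t * (- q z')" using t by (intro convex_combination_pos) auto
      then show False using n(2) conv by simp
    qed
  next
    case False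
    define m where "m = \<lfloor>p z\<rfloor>"
    have nint: "p z' \<notin> \<int>" using False c(1,2) by (metis Ints_cases Ints_of_int ceiling_of_int floor_of_int le_floor_iff ceiling_le_iff order_antisym order_refl)
    have "of_int m \<noteq> p z" "of_int m \<noteq> p z'" using False nint by (metis Ints_of_int)+
    then have b: "of_int m < p z" "p z < of_int m + 1" "of_int m < p z'" "p z' < of_int m + 1"
      using c(1) unfolding m_def by linarith+
    have "0 < (1 - t) * (p z - of_int m) + t * (p z' - of_int m)"
      using b t by (intro convex_combination_pos) auto
    moreover have "0 < (1 - t) * (of_int m + 1 - p z) + t * (of_int m + 1 - p z')"
      using b t by (intro convex_combination_pos) auto
    ultimately have "of_int m < real_of_int n" "real_of_int n < of_int m + 1"
      using n(1) by (simp_all add: algebra_simps)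
    from notin_Ints_between[OF this] show False by simp
  qed
qed

text \<open>On the complex line through \<open>a\<close> and \<open>b\<close> each of the countably
  many hyperplanes excludes at most one parameter, and the plane minus a countable set is path
  connected.\<close>

lemma exists_torus_log_path:
  assumes a: "\<And>v. v \<in> X \<Longrightarrow> dot e v a \<notin> \<int>" and b: "\<And>v. v \<in> X \<Longrightarrow> dot e v b \<notin> \<int>"
  obtains P :: "real \<Rightarrow> nat \<Rightarrow> complex" where "P 0 = a" "P 1 = b"
    "\<forall>j. continuous_on {0..1} (\<lambda>t. P t j)" "\<forall>v\<in>X. \<forall>t\<in>{0..1}. dot e v (P t) \<notin> \<int>"
proof -
  define B where "B = (\<Union>v\<in>X. \<Union>n::int. {s. dot e v a + s * (dot e v b - dot e v a) = of_int n})"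
  have fin: "finite {s. dot e v a + s * (dot e v b - dot e v a) = of_int n}" if v: "v \<in> X" for v and n :: int
  proof (cases "dot e v b = dot e v a")
    case True
    then have "{s. dot e v a + s * (dot e v b - dot e v a) = of_int n} = {}" using a[OF v] by auto
    then show ?thesis by simp
  next
    case False
    have "{s. dot e v a + s * (dot e v b - dot e v a) = of_int n}
        \<subseteq> {(of_int n - dot e v a) / (dot e v b - dot e v a)}"
      using False by (auto simp: field_simps)
    then show ?thesis by (rule finite_subset) simp
  qed
  have "countable B"
    unfolding B_def by (intro countable_UN countable_finite[OF finite_X] countableI_type countable_finite[OF fin])
  then have "path_connected (- B)" by (intro path_connected_complement_countable) auto
  moreover have "0 \<in> - B" by (auto simp: B_def) (metis a Ints_of_int)
  moreover have "1 \<in> - B" by (auto simp: B_def) (metis b Ints_of_int)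
  ultimately obtain \<zeta> where \<zeta>: "path \<zeta>" "path_image \<zeta> \<subseteq> - B" "pathstart \<zeta> = 0" "pathfinish \<zeta> = 1"
    unfolding path_connected_def by blast
  show thesis
  proof
    let ?P = "\<lambda>t j. a j + \<zeta> t * (b j - a j)"
    show "?P 0 = a" "?P 1 = b" using \<zeta>(3,4) by (simp_all add: pathstart_def pathfinish_def)
    show "\<forall>j. continuous_on {0..1} (\<lambda>t. ?P t j)"
      using \<zeta>(1) unfolding path_def by (intro allI continuous_intros)
    show "\<forall>v\<in>X. \<forall>t\<in>{0..1}. dot e v (?P t) \<notin> \<int>"
    proof (intro ballI notI)
      fix v and t :: real assume v: "v \<in> X" and t: "t \<in> {0..1}" and "dot e v (?P t) \<in> \<int>"
      then obtain n where "dot e v (?P t) = of_int n" by (elim Ints_cases)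
      then have "dot e v a + \<zeta> t * (dot e v b - dot e v a) = of_int n"
        by (simp only: dot_add dot_cmult dot_diff)
      then have "\<zeta> t \<in> B" using v by (auto simp: B_def)
      moreover have "\<zeta> t \<in> - B" using \<zeta>(2) t by (auto simp: path_image_def image_subset_iff)
      ultimately show False by simp
    qed
  qed
qed


text \<open>The coordinates whose quotient lies on the branch cut of \<open>Ln\<close>. The cut
  contains 0, but quotients are nonzero on \<open>M\<close>, so only negative reals occur
  there.\<close>

definition "neg p = {j \<in> {e..<d}. snd p j / fst p j \<in> \<real>\<^sub>\<le>\<^sub>0}"

definition "level p = codim (fst p) + codim (snd p) + card (neg p)"

text \<open>The discrete data that determine all choices made by the planner.\<close>

definition "invariants p = (codim (fst p), cell (fst p), codim (snd p), cell (snd p), neg p)"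

lemma level_le: "level p \<le> d + e"
proof -
  have "card (neg p) \<le> card {e..<d}" by (intro card_mono) (auto simp: neg_def)
  then show ?thesis using codim_le[of "fst p"] codim_le[of "snd p"] e_le_d by (simp add: level_def)
qed

text \<open>All three summands of the level are upper semicontinuous, the last one because the
  branch cut is closed. Equality of the sums therefore forces equality of each summand, and with it
  of the cells and of \<open>neg\<close>.\<close>

lemma eventually_level:
  assumes p0: "p0 \<in> M \<times> M"
  shows "\<forall>\<^sub>F p in at p0 within M \<times> M. level p \<le> level p0 \<and> (level p = level p0 \<longrightarrow> invariants p = invariants p0)"
proof -
  let ?Q = "\<lambda>z0 z. codim z \<le> codim z0 \<and> (codim z = codim z0 \<longrightarrow> cell z = cell z0)"
  have Q: "\<forall>\<^sub>F z in at z0 within M. ?Q z0 z" if "z0 \<in> M" for z0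
  proof -
    obtain l :: "(nat \<Rightarrow> complex) \<Rightarrow> nat \<Rightarrow> complex" where
      "\<forall>\<^sub>F z in at z0 within M. codim z \<le> codim z0 \<and>
       (codim z = codim z0 \<longrightarrow> cell z = cell z0 \<and> (\<forall>j<e. torus_log z j = l z j))"
      by (rule eventually_stratum[OF \<open>z0 \<in> M\<close>])
    then show ?thesis by eventually_elim blast
  qed
  have 1: "\<forall>\<^sub>F p in at p0 within M \<times> M. ?Q (fst p0) (fst p)"
    using p0 by (intro eventually_fst_within Q) auto
  have 2: "\<forall>\<^sub>F p in at p0 within M \<times> M. ?Q (snd p0) (snd p)"
    using p0 by (intro eventually_snd_within Q) auto
  have "\<forall>\<^sub>F p in at p0 within M \<times> M. \<forall>j\<in>{e..<d} - neg p0. j \<notin> neg p"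
  proof (intro eventually_ball_finite ballI)
    fix j assume j: "j \<in> {e..<d} - neg p0"
    have "continuous_on UNIV (\<lambda>p :: (nat \<Rightarrow> complex) \<times> (nat \<Rightarrow> complex). fst p j)"
      "continuous_on UNIV (\<lambda>p :: (nat \<Rightarrow> complex) \<times> (nat \<Rightarrow> complex). snd p j)"
      by (intro continuous_on_component[OF continuous_on_fst[OF continuous_on_id]]
          continuous_on_component[OF continuous_on_snd[OF continuous_on_id]])+
    then have "((\<lambda>p. fst p j) \<longlongrightarrow> fst p0 j) (at p0)" "((\<lambda>p. snd p j) \<longlongrightarrow> snd p0 j) (at p0)"
      by (simp_all add: continuous_on_def del: split_paired_All)
    then have "((\<lambda>p. fst p j) \<longlongrightarrow> fst p0 j) (at p0 within M \<times> M)" "((\<lambda>p. snd p j) \<longlongrightarrow> snd p0 j) (at p0 within M \<times> M)"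
      by (auto intro: tendsto_within_subset)
    moreover have "fst p0 j \<noteq> 0"
      using p0 j M_torus[of "fst p0"] by (auto simp: coord_torus_def)
    ultimately have "((\<lambda>p. snd p j / fst p j) \<longlongrightarrow> snd p0 j / fst p0 j) (at p0 within M \<times> M)"
      by (intro tendsto_divide)
    moreover have "snd p0 j / fst p0 j \<in> - \<real>\<^sub>\<le>\<^sub>0" using j by (auto simp: neg_def)
    moreover have "open (- \<real>\<^sub>\<le>\<^sub>0 :: complex set)" using closed_nonpos_Reals_complex by (rule open_Compl)
    ultimately have "\<forall>\<^sub>F p in at p0 within M \<times> M. snd p j / fst p j \<in> - \<real>\<^sub>\<le>\<^sub>0"
      by (intro topological_tendstoD)
    then show "\<forall>\<^sub>F p in at p0 within M \<times> M. j \<notin> neg p" by eventually_elim (simp add: neg_def)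
  qed simp
  with 1 2 show ?thesis
  proof eventually_elim
    case (elim p)
    have sub: "neg p \<subseteq> neg p0" using elim(3) by (auto simp: neg_def)
    have fin: "finite (neg p0)" by (simp add: neg_def)
    have "card (neg p) \<le> card (neg p0)" using sub fin by (rule card_mono[rotated])
    moreover have "card (neg p) = card (neg p0) \<Longrightarrow> neg p = neg p0" using card_subset_eq[OF fin sub] .
    ultimately show ?case using elim(1,2) unfolding level_def invariants_def by auto
  qed
qed

text \<open>Allows the three legs of a route to be added up in one formula: the clamps of
  \<open>3 * s\<close>, \<open>3 * s - 1\<close> and \<open>3 * s - 2\<close> each run from 0 to 1
  on their own third of the time and are constant elsewhere.\<close>

definition "clamp01 x = max 0 (min 1 x)" for x :: real

lemma clamp01: "clamp01 x \<in> {0..1}" "continuous_on S f \<Longrightarrow> continuous_on S (\<lambda>x. clamp01 (f x))"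
  unfolding clamp01_def by (auto intro!: continuous_intros)

text \<open>
  In the first \<open>e\<close> coordinates, the planner moves straight to the reference point \<open>a\<close> of the
  first cell, along the path \<open>P\<close> to the reference point \<open>b\<close> of the second cell, and
  straight to the end point; in the other coordinates it multiplies by \<open>exp (s * Ln (z' / z))\<close>.
\<close>

definition "plan a b P x = (\<lambda>j.
  if j < e then exp (2 * of_real pi * \<i> * (torus_log (fst (fst x)) j
      + of_real (clamp01 (3 * snd x)) * (a j - torus_log (fst (fst x)) j)
      + (P (clamp01 (3 * snd x - 1)) j - a j)
      + of_real (clamp01 (3 * snd x - 2)) * (torus_log (snd (fst x)) j - b j)))
  else if j < d then fst (fst x) j * exp (of_real (snd x) * Ln (snd (fst x) j / fst (fst x) j))
  else 1)"
  for a b :: "nat \<Rightarrow> complex" and P :: "real \<Rightarrow> nat \<Rightarrow> complex"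
    and x :: "((nat \<Rightarrow> complex) \<times> (nat \<Rightarrow> complex)) \<times> real"

lemma M_nonzero: "z \<in> M \<Longrightarrow> z j \<noteq> 0"
  using M_torus[of z] by (cases "j < d") (auto simp: coord_torus_def)

lemma plan_in_M:
  assumes p: "z \<in> M" "z' \<in> M" and y: "y \<in> M" "cell z = cell y" and y': "y' \<in> M" "cell z' = cell y'"
    and P: "P 0 = torus_log y" "P 1 = torus_log y'" "\<forall>v\<in>X. \<forall>t\<in>{0..1}. dot e v (P t) \<notin> \<int>"
    and s: "s \<in> {0..1}"
  shows "plan (torus_log y) (torus_log y') P ((z, z'), s) \<in> M"
proof -
  define W where "W = (\<lambda>j. torus_log z j + of_real (clamp01 (3 * s)) * (torus_log y j - torus_log z j)
      + (P (clamp01 (3 * s - 1)) j - torus_log y j) + of_real (clamp01 (3 * s - 2)) * (torus_log z' j - torus_log y' j))"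
  have W: "dot e v W \<notin> \<int>" if v: "v \<in> X" for v
  proof -
    \<comment> \<open>On each third two of the clamps are constant and \<open>W\<close> reduces to a
      single leg: a segment inside a cell, the path \<open>P\<close>, or again a segment inside a
      cell.\<close>
    consider "s \<le> 1/3" | "1/3 \<le> s" "s \<le> 2/3" | "2/3 \<le> s" by linarith
    then show ?thesis
    proof cases
      case 1
      then have "clamp01 (3 * s - 1) = 0" "clamp01 (3 * s - 2) = 0" by (auto simp: clamp01_def)
      then have "W = (\<lambda>j. torus_log z j + of_real (clamp01 (3 * s)) * (torus_log y j - torus_log z j))"
        by (simp add: W_def P)
      then show ?thesis using same_cell_segment[OF p(1) y(1) y(2) v] clamp01(1)[of "3 * s"] by simp
    next
      case 2
      then have "clamp01 (3 * s) = 1" "clamp01 (3 * s - 2) = 0" by (auto simp: clamp01_def)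
      then have "W = P (clamp01 (3 * s - 1))" by (simp add: W_def)
      then show ?thesis using P(3) v clamp01(1) by simp
    next
      case 3
      then have "clamp01 (3 * s) = 1" "clamp01 (3 * s - 1) = 1" by (auto simp: clamp01_def)
      then have "W = (\<lambda>j. torus_log y' j + of_real (clamp01 (3 * s - 2)) * (torus_log z' j - torus_log y' j))"
        by (simp add: W_def P)
      then show ?thesis using same_cell_segment[OF y'(1) p(2) y'(2)[symmetric] v] clamp01(1)[of "3 * s - 2"] by simp
    qed
  qed
  let ?h = "plan (torus_log y) (torus_log y') P ((z, z'), s)"
  have h: "?h j = torus_exp e W j" if "j < e" for j
    using that by (simp add: plan_def torus_exp_def W_def)
  have "laurent d v ?h \<noteq> 1" if v: "v \<in> X" for v
  proof -
    have "laurent d v ?h = laurent e v ?h"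
      unfolding laurent_def using e_le_d support[OF v] by (intro prod.mono_neutral_right) auto
    also have "\<dots> = laurent e v (torus_exp e W)"
      unfolding laurent_def using h by (intro prod.cong) auto
    finally show ?thesis using W[OF v] by (simp add: laurent_torus_exp exp_2pi_i_eq_1_iff)
  qed
  moreover have "?h \<in> coord_torus d"
    using e_le_d M_nonzero[OF p(1)] by (auto simp: coord_torus_def plan_def)
  ultimately show ?thesis by (simp add: coord_complement_def)
qed

lemma plan_endpoints:
  assumes p: "z \<in> M" "z' \<in> M" and P: "P 0 = a" "P 1 = b"
  shows "plan a b P ((z, z'), 0) = z" "plan a b P ((z, z'), 1) = z'"
proof -
  have "z j = 1" "z' j = 1" if "d \<le> j" for j
    using that p M_torus[OF p(1)] M_torus[OF p(2)] by (auto simp: coord_torus_def)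
  then show "plan a b P ((z, z'), 0) = z" "plan a b P ((z, z'), 1) = z'"
    using P p M_nonzero by (auto simp: plan_def clamp01_def exp_torus_log fun_eq_iff)
qed

lemma continuous_on_plan:
  assumes p0: "p0 \<in> M \<times> M" and T: "T = {p \<in> M \<times> M. invariants p = invariants p0}"
    and P: "\<forall>j. continuous_on {0..1} (\<lambda>t. P t j)"
  shows "continuous_on (T \<times> {0..1}) (plan a b P)"
proof (rule continuous_on_coordinatewise_then_product)
  fix j
  let ?T = "T \<times> {0..1::real}"
  have TM: "fst x \<in> M \<times> M" "invariants (fst x) = invariants p0" if "x \<in> ?T" for x
    using that T by auto
  have c1: "continuous_on ?T (\<lambda>x. fst (fst x) j)" and c2: "continuous_on ?T (\<lambda>x. snd (fst x) j)"
    by (intro continuous_on_component[OF continuous_on_fst[OF continuous_on_fst[OF continuous_on_id]]]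
        continuous_on_component[OF continuous_on_snd[OF continuous_on_fst[OF continuous_on_id]]])+
  have s: "continuous_on ?T snd" by (intro continuous_intros)
  consider "j < e" | "e \<le> j" "j < d" | "d \<le> j" by linarith
  then show "continuous_on ?T (\<lambda>x. plan a b P x j)"
  proof cases
    case 1
    have l1: "continuous_on ?T (\<lambda>x. torus_log (fst (fst x)) j)"
      by (rule continuous_on_compose2[OF continuous_on_torus_log[OF 1, of "codim (fst p0)"]
            continuous_on_fst[OF continuous_on_fst[OF continuous_on_id]]])
         (use TM in \<open>auto simp: invariants_def\<close>)
    have l2: "continuous_on ?T (\<lambda>x. torus_log (snd (fst x)) j)"
      by (rule continuous_on_compose2[OF continuous_on_torus_log[OF 1, of "codim (snd p0)"]
            continuous_on_snd[OF continuous_on_fst[OF continuous_on_id]]])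
         (use TM in \<open>auto simp: invariants_def\<close>)
    have "continuous_on ?T (\<lambda>x. clamp01 (3 * snd x - 1))" by (intro clamp01(2) continuous_intros s)
    then have P': "continuous_on ?T (\<lambda>x. P (clamp01 (3 * snd x - 1)) j)"
      by (rule continuous_on_compose2[OF P[rule_format]]) (use clamp01(1) in auto)
    have "continuous_on ?T (\<lambda>x. exp (2 * of_real pi * \<i> * (torus_log (fst (fst x)) j
      + of_real (clamp01 (3 * snd x)) * (a j - torus_log (fst (fst x)) j)
      + (P (clamp01 (3 * snd x - 1)) j - a j)
      + of_real (clamp01 (3 * snd x - 2)) * (torus_log (snd (fst x)) j - b j))))"
      by (intro continuous_on_exp continuous_on_mult continuous_on_add continuous_on_diff
          continuous_on_of_real clamp01(2) continuous_on_const l1 l2 P' s)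
    then show ?thesis using 1 by (simp add: plan_def)
  next
    case 2
    have r: "continuous_on ?T (\<lambda>x. snd (fst x) j / fst (fst x) j)"
      using TM M_nonzero by (intro continuous_on_divide c1 c2) auto
    have "continuous_on ?T (\<lambda>x. Ln (snd (fst x) j / fst (fst x) j))"
    proof (cases "j \<in> neg p0")
      case False
      have nn: "snd (fst x) j / fst (fst x) j \<notin> \<real>\<^sub>\<le>\<^sub>0" if "x \<in> ?T" for x
        using TM[OF that] False 2 by (auto simp: invariants_def neg_def)
      show ?thesis using nn by (intro continuous_on_Ln' r)
    next
      \<comment> \<open>On the whole piece the quotient \<open>y\<close> is a negative real. There
        \<open>Ln y\<close> agrees with \<open>Ln (- y)\<close> plus pi i, which is continuous,
        although \<open>Ln\<close> is discontinuous across the cut.\<close>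
      case True
      have neg: "snd (fst x) j / fst (fst x) j \<in> \<real>\<^sub>\<le>\<^sub>0" "snd (fst x) j / fst (fst x) j \<noteq> 0" if "x \<in> ?T" for x
      proof -
        have "j \<in> neg (fst x)" using TM[OF that] True by (simp add: invariants_def)
        then show "snd (fst x) j / fst (fst x) j \<in> \<real>\<^sub>\<le>\<^sub>0" by (simp add: neg_def)
        show "snd (fst x) j / fst (fst x) j \<noteq> 0" using TM(1)[OF that] M_nonzero by (auto simp: mem_Times_iff)
      qed
      have pos: "- (snd (fst x) j / fst (fst x) j) \<notin> \<real>\<^sub>\<le>\<^sub>0" if "x \<in> ?T" for x
        using neg[OF that] by (auto simp: complex_nonpos_Reals_iff complex_eq_iff)
      have "continuous_on ?T (\<lambda>x. Ln (- (snd (fst x) j / fst (fst x) j)) + \<i> * of_real pi)"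
        using pos by (intro continuous_on_add continuous_on_const continuous_on_Ln' continuous_on_minus r)
      moreover have "Ln (- (snd (fst x) j / fst (fst x) j)) + \<i> * of_real pi = Ln (snd (fst x) j / fst (fst x) j)"
        if "x \<in> ?T" for x
      proof -
        define y where "y = - (snd (fst x) j / fst (fst x) j)"
        have "y \<noteq> 0" "Im y = 0" "0 \<le> Re y" using neg[OF that] by (auto simp: y_def complex_nonpos_Reals_iff)
        then have "Ln (- y) = Ln y + \<i> * of_real pi" using Ln_minus[of y] by simp
        then show ?thesis by (simp add: y_def)
      qed
      ultimately show ?thesis by (rule continuous_on_eq)
    qed
    then have "continuous_on ?T (\<lambda>x. fst (fst x) j * exp (of_real (snd x) * Ln (snd (fst x) j / fst (fst x) j)))"
      by (intro continuous_on_mult continuous_on_exp continuous_on_of_real c1 s)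
    then show ?thesis using 2 by (simp add: plan_def)
  next
    case 3
    then show ?thesis using e_le_d by (simp add: plan_def)
  qed
qed

text \<open>Within one level, the pairs with given invariants form a relatively open piece. The
  routes on a piece depend continuously on the pair, so the planners of the disjoint pieces paste
  together.\<close>

theorem planner_cover_upper_bound: "planner_cover (top_of_set M) (d + e + 1)"
proof (rule planner_cover_of_level_sets[where N = level])
  show "openin (top_of_set {z. \<forall>j\<ge>d. z j = 1}) M" by (rule openin_coord_complement[OF finite_X])
  show "level p \<le> d + e" for p by (rule level_le)
  show "openin (top_of_set (M \<times> M)) {p \<in> M \<times> M. level p \<le> k}" for k
  proof (rule openin_of_eventually)
    fix p0 assume "p0 \<in> M \<times> M" "level p0 \<le> k"
    from eventually_level[OF this(1)] show "\<forall>\<^sub>F p in at p0 within M \<times> M. level p \<le> k"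
      by eventually_elim (use \<open>level p0 \<le> k\<close> in auto)
  qed
  fix k
  define L where "L = {p \<in> M \<times> M. level p = k}"
  define ref where "ref c = (SOME z. z \<in> M \<and> cell z = c)" for c
  have ref: "ref (cell z) \<in> M" "cell z = cell (ref (cell z))" if "z \<in> M" for z
    using someI[of "\<lambda>y. y \<in> M \<and> cell y = cell z" z] that unfolding ref_def by simp_all
  have "\<forall>q. \<exists>P :: real \<Rightarrow> nat \<Rightarrow> complex. q \<in> M \<times> M \<longrightarrow> P 0 = torus_log (ref (cell (fst q))) \<and> P 1 = torus_log (ref (cell (snd q))) \<and>
      (\<forall>j. continuous_on {0..1} (\<lambda>t. P t j)) \<and> (\<forall>v\<in>X. \<forall>t\<in>{0..1}. dot e v (P t) \<notin> \<int>)"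
  proof
    fix q :: "(nat \<Rightarrow> complex) \<times> (nat \<Rightarrow> complex)"
    show "\<exists>P :: real \<Rightarrow> nat \<Rightarrow> complex. q \<in> M \<times> M \<longrightarrow> P 0 = torus_log (ref (cell (fst q))) \<and> P 1 = torus_log (ref (cell (snd q))) \<and>
      (\<forall>j. continuous_on {0..1} (\<lambda>t. P t j)) \<and> (\<forall>v\<in>X. \<forall>t\<in>{0..1}. dot e v (P t) \<notin> \<int>)"
    proof (cases "q \<in> M \<times> M")
      case True
      then have q: "fst q \<in> M" "snd q \<in> M" by auto
      obtain P :: "real \<Rightarrow> nat \<Rightarrow> complex" where "P 0 = torus_log (ref (cell (fst q)))" "P 1 = torus_log (ref (cell (snd q)))"
        "\<forall>j. continuous_on {0..1} (\<lambda>t. P t j)" "\<forall>v\<in>X. \<forall>t\<in>{0..1}. dot e v (P t) \<notin> \<int>"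
        by (rule exists_torus_log_path[OF dot_torus_log_notin_Ints[OF ref(1)[OF q(1)]] dot_torus_log_notin_Ints[OF ref(1)[OF q(2)]]])
      then show ?thesis by blast
    qed simp
  qed
  from choice[OF this] obtain Q :: "(nat \<Rightarrow> complex) \<times> (nat \<Rightarrow> complex) \<Rightarrow> real \<Rightarrow> nat \<Rightarrow> complex" where
    Q: "\<forall>q. q \<in> M \<times> M \<longrightarrow> Q q 0 = torus_log (ref (cell (fst q))) \<and> Q q 1 = torus_log (ref (cell (snd q))) \<and>
      (\<forall>j. continuous_on {0..1} (\<lambda>t. Q q t j)) \<and> (\<forall>v\<in>X. \<forall>t\<in>{0..1}. dot e v (Q q t) \<notin> \<int>)" ..
  \<comment> \<open>Indexed by cells rather than by points, so that pairs with equal invariants are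
    given the same planner.\<close>
  define R where "R c c' = Q (ref c, ref c')" for c c'
  have R: "R (cell z) (cell z') 0 = torus_log (ref (cell z))" "R (cell z) (cell z') 1 = torus_log (ref (cell z'))"
    "\<forall>j. continuous_on {0..1} (\<lambda>t. R (cell z) (cell z') t j)"
    "\<forall>v\<in>X. \<forall>t\<in>{0..1}. dot e v (R (cell z) (cell z') t) \<notin> \<int>" if "z \<in> M" "z' \<in> M" for z z'
  proof -
    have "(ref (cell z), ref (cell z')) \<in> M \<times> M" using ref that by simp
    note q = Q[THEN spec, THEN mp, OF this, unfolded fst_conv snd_conv
        ref(2)[OF that(1), symmetric] ref(2)[OF that(2), symmetric], folded R_def]
    show "R (cell z) (cell z') 0 = torus_log (ref (cell z))" "R (cell z) (cell z') 1 = torus_log (ref (cell z'))"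
      "\<forall>j. continuous_on {0..1} (\<lambda>t. R (cell z) (cell z') t j)"
      "\<forall>v\<in>X. \<forall>t\<in>{0..1}. dot e v (R (cell z) (cell z') t) \<notin> \<int>"
      by (rule q[THEN conjunct1] q[THEN conjunct2, THEN conjunct1]
          q[THEN conjunct2, THEN conjunct2, THEN conjunct1] q[THEN conjunct2, THEN conjunct2, THEN conjunct2])+
  qed
  define f where "f q = plan (torus_log (ref (cell (fst q)))) (torus_log (ref (cell (snd q)))) (R (cell (fst q)) (cell (snd q)))"
    for q :: "(nat \<Rightarrow> complex) \<times> (nat \<Rightarrow> complex)"
  define H where "H x = f (fst x) x" for x
  define T where "T q = {p \<in> L. invariants p = invariants q} \<times> {0..1::real}" for q
  have "continuous_map (top_of_set (L \<times> {0..1})) euclidean H"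
  proof (rule pasting_lemma[where I = L and T = T and f = f])
    fix q assume q: "q \<in> L"
    then have qM: "q \<in> M \<times> M" by (simp add: L_def)
    have "openin (top_of_set L) {p \<in> L. invariants p = invariants q}"
    proof (rule openin_of_eventually)
      fix p0 assume p0: "p0 \<in> L" "invariants p0 = invariants q"
      then have p0M: "p0 \<in> M \<times> M" by (simp add: L_def)
      have le: "at p0 within L \<le> at p0 within M \<times> M" by (rule at_le) (auto simp: L_def)
      show "\<forall>\<^sub>F p in at p0 within L. invariants p = invariants q"
        using filter_leD[OF le eventually_level[OF p0M]] eventually_in_within[where a = p0 and S = L]
        by eventually_elim (use p0 in \<open>auto simp: L_def\<close>)
    qed
    then have "openin (prod_topology (top_of_set L) (top_of_set {0..1})) (T q)"
      unfolding T_def openin_prod_Times_iff by (simp add: closedin_subtopology_refl)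
    then show "openin (top_of_set (L \<times> {0..1})) (T q)" by (simp add: prod_topology_subtopology_eu)
    have "continuous_on ({p \<in> M \<times> M. invariants p = invariants q} \<times> {0..1}) (f q)"
      unfolding f_def by (rule continuous_on_plan[OF qM refl R(3)]) (use qM in auto)
    then have "continuous_on (T q) (f q)"
      by (rule continuous_on_subset) (auto simp: T_def L_def)
    moreover have "subtopology (top_of_set (L \<times> {0..1})) (T q) = top_of_set (T q)"
      by (simp add: subtopology_subtopology T_def Int_absorb1 Sigma_mono)
    ultimately show "continuous_map (subtopology (top_of_set (L \<times> {0..1})) (T q)) euclidean (f q)"
      by simp
  next
    fix q q' x assume "q \<in> L" "q' \<in> L" "x \<in> topspace (top_of_set (L \<times> {0..1})) \<inter> T q \<inter> T q'"
    then have "invariants q = invariants q'" by (auto simp: T_def)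
    then show "f q x = f q' x" by (simp add: f_def invariants_def)
  next
    fix x assume "x \<in> topspace (top_of_set (L \<times> {0..1::real}))"
    then show "\<exists>q. q \<in> L \<and> x \<in> T q \<and> H x = f q x"
      by (intro exI[of _ "fst x"]) (auto simp: T_def H_def)
  qed
  then have "continuous_on (L \<times> {0..1}) H" by simp
  moreover have "H ` (L \<times> {0..1}) \<subseteq> M"
  proof (rule image_subsetI)
    fix x assume "x \<in> L \<times> {0..1::real}"
    then obtain z z' s where x: "x = ((z, z'), s)" and z: "z \<in> M" "z' \<in> M" and s: "s \<in> {0..1}"
      by (auto simp: L_def)
    have "plan (torus_log (ref (cell z))) (torus_log (ref (cell z'))) (R (cell z) (cell z')) ((z, z'), s) \<in> M"
      by (rule plan_in_M[OF z ref[OF z(1)] ref[OF z(2)] R(1,2,4)[OF z] s])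
    then show "H x \<in> M" by (simp add: H_def f_def x)
  qed
  moreover have "H (p, 0) = fst p \<and> H (p, 1) = snd p" if "p \<in> L" for p
  proof -
    have z: "fst p \<in> M" "snd p \<in> M" using that by (auto simp: L_def)
    show ?thesis using plan_endpoints[OF z R(1,2)[OF z]] by (simp add: H_def f_def)
  qed
  moreover have "L \<subseteq> M \<times> M" by (auto simp: L_def)
  ultimately have "continuous_planner (top_of_set M) L H" by (simp add: continuous_planner_top_of_set)
  then show "\<exists>H. continuous_planner (top_of_set M) {p \<in> M \<times> M. level p = k} H"
    unfolding L_def by blast
qed

end

subsection \<open>The main theorem\<close>

theorem theorem4p3p2:
  fixes G :: "('a, 'b) monoid_scheme" and \<XX> :: "'a set" and d r :: nat
  assumes "free_abelian_of_rank G d"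
    and "finite \<XX>" and "\<XX> \<subseteq> carrier G - {\<one>\<^bsub>G\<^esub>}"
    and "strictly_supersolvable G (toric_arrangement G \<XX>)"
    and "arrangement_rank G (toric_arrangement G \<XX>) = r"
  shows "topological_complexity
           (subtopology (torus_topology G) (arrangement_complement G \<XX>)) = enat (d + r + 1)"
proof -
  have grp: "group G" using assms(1) by (simp add: free_abelian_of_rank_def comm_group_def)
  have XG: "\<XX> \<subseteq> carrier G" using assms(3) by blast
  obtain a0 where a0: "coord_system G d a0" by (rule exists_coord_system[OF assms(1)])
  obtain a e where a: "coord_system G d a" and ed: "e \<le> d"
    and supp: "\<And>\<alpha> j. \<alpha> \<in> \<XX> \<Longrightarrow> e \<le> j \<Longrightarrow> a \<alpha> j = 0" and rank: "qrank (a ` \<XX>) = e"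
    by (rule exists_adapted_coord_system[OF a0 assms(2) XG]) (rule that)
  interpret coordinates G d a by (rule coordinates.intro[OF grp a])
  \<comment> \<open>The rank of the poset of layers is the rational rank of the characters, hence
    the number of adapted coordinates.\<close>
  have er: "e = r" using arrangement_rank_eq_qrank[OF assms(2) XG] rank assms(5) by simp
  let ?X = "a ` \<XX>"
  have finX: "finite ?X" using assms(2) by simp
  have suppX: "v j = 0" if "v \<in> ?X" "e \<le> j" for v j using supp that by auto
  have "\<exists>j<d. a \<alpha> j \<noteq> 0" if \<alpha>: "\<alpha> \<in> \<XX>" for \<alpha>
  proof (rule ccontr)
    assume zero: "\<not> ?thesis"
    have \<alpha>G: "\<alpha> \<in> carrier G" and "\<alpha> \<noteq> \<one>\<^bsub>G\<^esub>" using \<alpha> assms(3) by auto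
    have oneG: "\<one>\<^bsub>G\<^esub> \<in> carrier G" using grp by (simp add: group_def monoid.one_closed)
    have "a \<alpha> j = 0" for j using zero coord_support[OF \<alpha>G, of j] by (cases "j < d") auto
    then have "a \<alpha> = (\<lambda>_. 0)" by blast
    moreover have "a \<one>\<^bsub>G\<^esub> = (\<lambda>_. 0)"
    proof
      fix j
      have "\<one>\<^bsub>G\<^esub> \<otimes>\<^bsub>G\<^esub> \<one>\<^bsub>G\<^esub> = \<one>\<^bsub>G\<^esub>" using grp oneG by (simp add: group_def monoid.l_one)
      then have "a \<one>\<^bsub>G\<^esub> j = a \<one>\<^bsub>G\<^esub> j + a \<one>\<^bsub>G\<^esub> j"
        using fun_cong[OF coord_mult[OF oneG oneG], of j] by simp
      then show "a \<one>\<^bsub>G\<^esub> j = 0" by simp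
    qed
    ultimately have "\<alpha> = \<one>\<^bsub>G\<^esub>"
      using inj_onD[OF bij_betw_imp_inj_on[OF coord_bij] _ \<alpha>G oneG] by simp
    with \<open>\<alpha> \<noteq> \<one>\<^bsub>G\<^esub>\<close> show False by simp
  qed
  then have nzX: "\<exists>j<d. v j \<noteq> 0" if "v \<in> ?X" for v using that by blast
  \<comment> \<open>The first \<open>e\<close> unit vectors are supported below \<open>e\<close>, as
    the characters are, so adjoining them cannot raise the rank above \<open>e\<close>; they must
    lie in the span already.\<close>
  have units: "unit_vec j \<in> qspan ?X" if j: "j < e" for j
  proof -
    have "qrank (?X \<union> unit_vec ` {..<e}) \<le> e"
      by (rule qrank_le_support) (auto simp: supp unit_vec_def)
    then have "?X \<union> unit_vec ` {..<e} \<subseteq> qspan ?X"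
      using finX rank by (intro subset_qspan_of_qrank_eq) auto
    then show ?thesis using j by blast
  qed
  \<comment> \<open>A vector annihilated by the characters is annihilated by their rational span, in
    particular by the unit vectors, which read off its entries.\<close>
  have nondeg: "\<forall>j<e. z j = 0" if z: "\<And>v. v \<in> ?X \<Longrightarrow> dot e v z = 0" for z :: "nat \<Rightarrow> int"
  proof (intro allI impI)
    fix j assume j: "j < e"
    have "dot e v (\<lambda>j. rat_of_int (z j)) = 0" if "v \<in> ?X" for v
      using z[OF that] by (simp add: dot_of_int)
    then have "dot e (unit_vec j) (\<lambda>j. rat_of_int (z j)) = 0"
      by (rule dot_eq_0_of_qspan[OF units[OF j]])
    then show "z j = 0" using j by (simp add: dot_unit_vec)
  qed
  interpret real_stratification ?X d e
    by unfold_locales (fact finX, fact ed, fact suppX)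
  have "topological_complexity (top_of_set (coord_complement d ?X)) = enat (d + e + 1)"
  proof (rule topological_complexity_eqI[OF planner_cover_upper_bound])
    fix k assume "planner_cover (top_of_set (coord_complement d ?X)) k"
    then show "d + e + 1 \<le> k"
      using finX ed suppX nzX nondeg by (rule planner_cover_lower_bound[rotated -1])
  qed
  then show ?thesis
    unfolding topological_complexity_homeomorphic[OF complement_homeomorphic[OF XG]] er .
qed

end
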